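(* Let $\Omega\subset\mathbb{R}^2$ be a bounded Lipschitz domain and let $\gamma\in\mathcal{M}(\Omega)$ be a positive finite measure. Then for every $u\in L^1(\Omega)$, $$\mathrm{TV}_{pwL}^{\gamma}(u)=\sup_{\substack{\varphi\in C_0^{\infty}(\Omega;\mathbb{R}^2)\\ |\varphi|_2\leq 1}}\left\{\int_\Omega u\,\operatorname{div}\varphi\,dx-\int_\Omega|\varphi|_2\,d\gamma\right\},$$ where $|\varphi|_2$ denotes the pointwise Euclidean norm $x\mapsto|\varphi(x)|_2$ of $\varphi$, and the constraint $|\varphi|_2\le 1$ is understood pointwise on $\Omega$.
   Context: $\mathcal{M}(\Omega)$ denotes the space of finite signed (scalar-valued) Borel measures on $\Omega$, and $\mathfrak{M}(\Omega,\mathbb{R}^2)$ denotes the space of finite $\mathbb{R}^2$-valued Radon measures on $\Omega$. A measure $\mu\in\mathcal{M}(\Omega)$ is positive if $\mu(E)\ge 0$ for every (Borel) $E\subseteq\Omega$; for $\mu_1,\mu_2\in\mathcal{M}(\Omega)$, $\mu_1\leq\mu_2$ means that $\mu_2-\mu_1$ is positive. For $g\in\mathfrak{M}(\Omega,\mathbb{R}^2)$ the variation measure $|g|$ is defined by $$|g|(E)=\sup\Big\{\sum_{i=1}^\infty\|g(E_i)\|_2 \;\Big|\; E=\bigcup_{i\in\mathbb{N}}E_i,\ E_i \text{ pairwise disjoint (Borel)}\Big\},$$ and the Radon norm is $\|g\|_{\mathfrak{M}}=|g|(\Omega)$, equivalently the dual norm $\sup\{\int_\Omega\varphi\cdot dg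 : \varphi\in C_0(\Omega;\mathbb{R}^2),\ |\varphi|_2\le1\}$. For $u\in L^1(\Omega)$, $Du$ denotes the weak (distributional) gradient of $u$. If $Du-g$ is not a finite Radon measure (i.e. $u\notin BV(\Omega)$), then $\|Du-g\|_{\mathfrak{M}}$ is understood to be $+\infty$. For a finite positive measure $\gamma\in\mathcal{M}(\Omega)$ and $u\in L^1(\Omega)$ the functional $\mathrm{TV}_{pwL}^\gamma$ is defined by $$\mathrm{TV}_{pwL}^{\gamma}(u):=\inf\big\{\|Du-g\|_{\mathfrak{M}} : g\in\mathfrak{M}(\Omega,\mathbb{R}^2),\ |g|\leq\gamma\big\}.$$ $C_0^\infty(\Omega;\mathbb{R}^2)$ denotes the smooth compactly supported vector fields on $\Omega$, and $C_0(\Omega;\mathbb{R}^2)$ its closure in the supremum norm. *)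

theory Defs
  imports "HOL-Analysis.Analysis"
begin

text \<open>
  The notions are set up for an arbitrary Euclidean space; on the type real ^ 2 the norm is the
  Euclidean norm.  Measures on \<open>\<Omega>\<close> live on the Borel sigma-algebra
  \<open>restrict_space borel \<Omega>\<close> of the subspace \<open>\<Omega>\<close>.
\<close>


section \<open>Bounded Lipschitz domains\<close>

text \<open>
  Near each boundary point \<open>p\<close> the set \<open>\<Omega>\<close> lies strictly on one side of a Lipschitz graph: \<open>e\<close> is
  the vertical direction of the local orthonormal frame, \<open>x - (x \<bullet> e) *\<^sub>R e\<close> is the
  projection of \<open>x\<close> to the hyperplane orthogonal to \<open>e\<close>, and \<open>\<psi>\<close> is the graph function on this
  hyperplane.
\<close>

definition lipschitz_boundary :: "'a::euclidean_space set \<Rightarrow> bool" where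
  "lipschitz_boundary \<Omega> \<longleftrightarrow>
     (\<forall>p \<in> frontier \<Omega>. \<exists>e \<psi> L r. norm e = 1 \<and> r > 0 \<and> L-lipschitz_on {y. y \<bullet> e = 0} \<psi> \<and>
        (\<forall>x \<in> ball p r. x \<in> \<Omega> \<longleftrightarrow> \<psi> (x - (x \<bullet> e) *\<^sub>R e) < x \<bullet> e))"

definition bounded_lipschitz_domain :: "'a::euclidean_space set \<Rightarrow> bool" where
  "bounded_lipschitz_domain \<Omega> \<longleftrightarrow>
     \<Omega> \<noteq> {} \<and> open \<Omega> \<and> connected \<Omega> \<and> bounded \<Omega> \<and> lipschitz_boundary \<Omega>"


section \<open>Vector measures\<close>

definition variation ::
  "'a::euclidean_space set \<Rightarrow> ('a set \<Rightarrow> 'b::euclidean_space) \<Rightarrow> 'a set \<Rightarrow> ennreal" where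
  "variation \<Omega> g E =
     (SUP A \<in> {A :: nat \<Rightarrow> 'a set. range A \<subseteq> sets (restrict_space borel \<Omega>) \<and>
                 disjoint_family A \<and> (\<Union>i. A i) = E}.
        \<Sum>i. ennreal (norm (g (A i))))"

text \<open>
  A finite vector-valued Radon measure is a countably additive function of finite total variation on
  the Borel sets of \<open>\<Omega>\<close>; regularity is automatic for open \<open>\<Omega>\<close>.  Off the
  Borel sets it is set to \<open>0\<close>, so that equality of measures is equality of HOL functions.
\<close>

definition radon_measures ::
  "'a::euclidean_space set \<Rightarrow> ('a set \<Rightarrow> 'b::euclidean_space) set" where
  "radon_measures \<Omega> =
     {g. (\<forall>E. E \<notin> sets (restrict_space borel \<Omega>) \<longrightarrow> g E = 0) \<and>
         (\<forall>A :: nat \<Rightarrow> 'a set. range A \<subseteq> sets (restrict_space borel \<Omega>) \<and> disjoint_family A \<longrightarrow>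
            (\<lambda>i. g (A i)) sums g (\<Union>i. A i)) \<and>
         variation \<Omega> g \<Omega> < \<infinity>}"

text \<open>
  The integral against a scalar signed measure is taken through its Jordan decomposition.  The
  positive part is \<open>\<mu>\<^sup>+ E = sup {\<mu> F | F \<subseteq> E}\<close>, and \<open>\<mu>\<^sup>- = (- \<mu>)\<^sup>+\<close>;
  since \<open>\<mu> {} = 0\<close>, the truncation of negative values by \<open>ennreal\<close> does not change the supremum.
\<close>

definition jordan_pos :: "'a::euclidean_space set \<Rightarrow> ('a set \<Rightarrow> real) \<Rightarrow> 'a measure" where
  "jordan_pos \<Omega> \<mu> =
     measure_of \<Omega> (sets (restrict_space borel \<Omega>))
       (\<lambda>E. SUP F \<in> {F \<in> sets (restrict_space borel \<Omega>). F \<subseteq> E}. ennreal (\<mu> F))"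

definition signed_integral ::
  "'a::euclidean_space set \<Rightarrow> ('a set \<Rightarrow> real) \<Rightarrow> ('a \<Rightarrow> real) \<Rightarrow> real" where
  "signed_integral \<Omega> \<mu> f =
     integral\<^sup>L (jordan_pos \<Omega> \<mu>) f - integral\<^sup>L (jordan_pos \<Omega> (\<lambda>E. - \<mu> E)) f"

definition vector_integral ::
  "'a::euclidean_space set \<Rightarrow> ('a set \<Rightarrow> 'b::euclidean_space) \<Rightarrow> ('a \<Rightarrow> 'b) \<Rightarrow> real" where
  "vector_integral \<Omega> g \<phi> = (\<Sum>b\<in>Basis. signed_integral \<Omega> (\<lambda>E. g E \<bullet> b) (\<lambda>x. \<phi> x \<bullet> b))"


section \<open>Test fields and distributions\<close>

primrec times_continuously_differentiable ::
  "nat \<Rightarrow> ('a::euclidean_space \<Rightarrow> 'b::euclidean_space) \<Rightarrow> bool" where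
  "times_continuously_differentiable 0 f \<longleftrightarrow> continuous_on UNIV f"
| "times_continuously_differentiable (Suc k) f \<longleftrightarrow>
     (\<forall>x. f differentiable at x) \<and>
     (\<forall>v. times_continuously_differentiable k (\<lambda>x. frechet_derivative f (at x) v))"

text \<open>
  A field with compact support in \<open>\<Omega>\<close> is identified with its extension by \<open>0\<close> to the whole space.
\<close>

definition test_fields :: "'a::euclidean_space set \<Rightarrow> ('a \<Rightarrow> 'a) set" where
  "test_fields \<Omega> =
     {\<phi>. (\<forall>k. times_continuously_differentiable k \<phi>) \<and>
         compact (closure {x. \<phi> x \<noteq> 0}) \<and> closure {x. \<phi> x \<noteq> 0} \<subseteq> \<Omega>}"

definition divergence :: "('a::euclidean_space \<Rightarrow> 'a) \<Rightarrow> 'a \<Rightarrow> real" where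
  "divergence \<phi> x = (\<Sum>b\<in>Basis. frechet_derivative \<phi> (at x) b \<bullet> b)"

text \<open>
  Vector-valued distributions are functionals on test fields; only their values on
  \<open>test_fields \<Omega>\<close> matter.
\<close>

definition weak_gradient ::
  "'a::euclidean_space set \<Rightarrow> ('a \<Rightarrow> real) \<Rightarrow> ('a \<Rightarrow> 'a) \<Rightarrow> real" where
  "weak_gradient \<Omega> u \<phi> = - integral\<^sup>L (lebesgue_on \<Omega>) (\<lambda>x. u x * divergence \<phi> x)"

definition represents ::
  "'a::euclidean_space set \<Rightarrow> ('a set \<Rightarrow> 'a) \<Rightarrow> (('a \<Rightarrow> 'a) \<Rightarrow> real) \<Rightarrow> bool" where
  "represents \<Omega> h T \<longleftrightarrow>
     h \<in> radon_measures \<Omega> \<and> (\<forall>\<phi> \<in> test_fields \<Omega>. T \<phi> = vector_integral \<Omega> h \<phi>)"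

text \<open>
  The Radon norm of a distribution is the total variation of the finite Radon measure representing
  it (unique for open \<open>\<Omega>\<close>), and \<open>\<infinity>\<close> if there is no such measure.
\<close>

definition radon_norm ::
  "'a::euclidean_space set \<Rightarrow> (('a \<Rightarrow> 'a) \<Rightarrow> real) \<Rightarrow> ennreal" where
  "radon_norm \<Omega> T =
     (if \<exists>h. represents \<Omega> h T then variation \<Omega> (THE h. represents \<Omega> h T) \<Omega> else \<infinity>)"


section \<open>Piecewise Lipschitz total variation\<close>

definition TV_pwL ::
  "'a::euclidean_space set \<Rightarrow> 'a measure \<Rightarrow> ('a \<Rightarrow> real) \<Rightarrow> ennreal" where
  "TV_pwL \<Omega> \<gamma> u =
     (INF g \<in> {g \<in> radon_measures \<Omega>.
                \<forall>E \<in> sets (restrict_space borel \<Omega>). variation \<Omega> g E \<le> emeasure \<gamma> E}.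
        radon_norm \<Omega> (\<lambda>\<phi>. weak_gradient \<Omega> u \<phi> - vector_integral \<Omega> g \<phi>))"

end

theory Submission
  imports Defs
begin

text \<open>
  Weak duality pairs a test field with the measures \<open>g\<close> and \<open>Du - g\<close>, each of which has a density
  bounded by \<open>1\<close> with respect to \<open>\<gamma>\<close> and to its own variation.

  Conversely, if the supremum is a finite number \<open>s\<close>, then \<open>Du\<close> is bounded by \<open>s + \<gamma>(\<Omega>)\<close> on test
  fields of norm at most \<open>1\<close>, so the outer measure generated by its values on open sets is a finite
  Borel measure \<open>\<mu>\<close>, and \<open>Du\<close> has a density \<open>f\<close> with respect to \<open>\<nu> = \<mu> + \<gamma>\<close>.  Write
  \<open>\<gamma> = c \<nu>\<close>.  The optimal \<open>g\<close> has as density the pointwise projection of \<open>f\<close> onto the ball of radius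
  \<open>c\<close>, so that the total variation of \<open>Du - g\<close> is the \<open>\<nu>\<close>-integral of the positive part of
  \<open>|f| - c\<close>.  This is \<open>\<integral> \<theta> \<bullet> f - c |\<theta>| d\<nu>\<close> for the field \<open>\<theta> = f / |f|\<close> on \<open>{|f| > c}\<close>, zero elsewhere, and
  approximating \<open>\<theta>\<close> by test fields in \<open>L\<^sup>1(\<nu>)\<close> bounds it by \<open>s\<close>.  No Hahn--Banach argument is needed.
\<close>

section \<open>Smooth functions\<close>

text \<open>A gradient known only by its values on test fields offers nothing to project pointwise,
  which is why it must first become a density. A bound on the unit ball is a bound in supremum norm,
  too weak to reach discontinuous fields such as \<theta>. The outer measure sharpens it to
  \<open>Du(\<phi>) <= \<integral> |\<phi>| d\<mu>\<close>, that is, to continuity in L1, and under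
  L1 continuity a field approximated by test fields is as good as a test field. The measure \<gamma>
  is added to \<mu> so that one reference measure carries both the gradient and the constraint: then
  \<open>|g| <= \<gamma>\<close> follows from a pointwise bound on densities, and the minimisation
  decouples over the points of \<Omega>.

  Approximation rests on smooth cutoffs between a compact and an open set, combined with convex
  combinations; these keep the norm at most 1, where a later truncation would destroy smoothness.
  The Radon norm is a definite description, so uniqueness of the representing measure belongs to the
  proof; it comes from the same approximation, by testing a difference of densities with
  itself.\<close>

abbreviation smooth :: "('a::euclidean_space \<Rightarrow> 'b::euclidean_space) \<Rightarrow> bool" where
  "smooth f \<equiv> \<forall>k. times_continuously_differentiable k f"

text \<open>Derivatives are unique, so any explicit formula \<open>f'\<close> may replace
  \<open>frechet_derivative\<close>. The inductive closure properties below establish their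
  successor case through this rule.\<close>

lemma times_continuously_differentiable_SucI:
  assumes "\<And>x. (f has_derivative f' x) (at x)"
    and "\<And>v. times_continuously_differentiable k (\<lambda>x. f' x v)"
  shows "times_continuously_differentiable (Suc k) f"
proof -
  have "frechet_derivative f (at x) = f' x" for x
    using frechet_derivative_at[OF assms(1)] by simp
  then show ?thesis
    using assms by (auto simp: differentiable_def)
qed

lemma times_continuously_differentiable_SucD:
  assumes "times_continuously_differentiable (Suc k) f"
  shows "(f has_derivative frechet_derivative f (at x)) (at x)"
    and "times_continuously_differentiable k (\<lambda>x. frechet_derivative f (at x) v)"
  using assms by (auto simp: frechet_derivative_works)

text \<open>A Leibniz formula mixes derivatives of class \<open>k\<close> with undifferentiated
  factors of class \<open>Suc k\<close>; the latter have to be lowered before an induction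
  hypothesis applies.\<close>

lemma times_continuously_differentiable_Suc_imp:
  "times_continuously_differentiable (Suc k) f \<Longrightarrow> times_continuously_differentiable k f"
proof (induction k arbitrary: f)
  case 0
  then show ?case
    by (auto intro!: differentiable_imp_continuous_on simp: differentiable_on_def
        intro: differentiable_at_withinI)
next
  case (Suc k)
  from Suc.prems have "\<forall>x. f differentiable at x"
    and *: "\<And>v. times_continuously_differentiable (Suc k) (\<lambda>x. frechet_derivative f (at x) v)"
    by auto
  with Suc.IH[OF *] show ?case
    by auto
qed

lemma times_continuously_differentiable_bounded_linear:
  assumes "bounded_linear h"
  shows "times_continuously_differentiable k f \<Longrightarrow> times_continuously_differentiable k (\<lambda>x. h (f x))"
proof (induction k arbitrary: f)
  case 0
  then show ?case
    using continuous_on_compose2[OF linear_continuous_on[OF assms, of UNIV]] by auto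
next
  case (Suc k)
  note f = times_continuously_differentiable_SucD[OF Suc.prems]
  show ?case
    by (rule times_continuously_differentiable_SucI[OF bounded_linear.has_derivative[OF assms f(1)]])
      (rule Suc.IH[OF f(2)])
qed

lemma times_continuously_differentiable_const [simp]:
  "times_continuously_differentiable k (\<lambda>x. c)"
proof (induction k arbitrary: c)
  case (Suc k)
  then show ?case
    by (intro times_continuously_differentiable_SucI[where f' = "\<lambda>x v. 0"]) auto
qed simp

lemma times_continuously_differentiable_linear:
  assumes "bounded_linear f"
  shows "times_continuously_differentiable k f"
proof (cases k)
  case 0
  then show ?thesis
    using assms by (simp add: linear_continuous_on)
next
  case (Suc l)
  then show ?thesis
    using times_continuously_differentiable_SucI[OF bounded_linear_imp_has_derivative[OF assms]]
    by simp
qed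

lemma times_continuously_differentiable_add:
  "times_continuously_differentiable k f \<Longrightarrow> times_continuously_differentiable k g \<Longrightarrow>
    times_continuously_differentiable k (\<lambda>x. f x + g x)"
proof (induction k arbitrary: f g)
  case (Suc k)
  show ?case
    by (rule times_continuously_differentiable_SucI)
      (auto intro!: has_derivative_add times_continuously_differentiable_SucD[OF Suc.prems(1)]
        times_continuously_differentiable_SucD[OF Suc.prems(2)] Suc.IH)
qed (auto intro: continuous_intros)

lemma times_continuously_differentiable_scaleR:
  "times_continuously_differentiable k a \<Longrightarrow> times_continuously_differentiable k f \<Longrightarrow>
    times_continuously_differentiable k (\<lambda>x. a x *\<^sub>R f x)"
proof (induction k arbitrary: a f)
  case (Suc k)
  note a = times_continuously_differentiable_SucD[OF Suc.prems(1)]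
    and f = times_continuously_differentiable_SucD[OF Suc.prems(2)]
  show ?case
    by (rule times_continuously_differentiable_SucI[OF has_derivative_scaleR[OF a(1) f(1)]])
      (auto intro!: times_continuously_differentiable_add Suc.IH a(2) f(2)
        intro: times_continuously_differentiable_Suc_imp Suc.prems)
qed (auto intro: continuous_intros)

lemma times_continuously_differentiable_mult:
  fixes a f :: "'a::euclidean_space \<Rightarrow> real"
  shows "times_continuously_differentiable k a \<Longrightarrow> times_continuously_differentiable k f \<Longrightarrow>
    times_continuously_differentiable k (\<lambda>x. a x * f x)"
  using times_continuously_differentiable_scaleR[of k a f] by simp

lemma times_continuously_differentiable_sum:
  "(\<And>i. i \<in> I \<Longrightarrow> times_continuously_differentiable k (f i)) \<Longrightarrow>
    times_continuously_differentiable k (\<lambda>x. \<Sum>i\<in>I. f i x)"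
  by (induction I rule: infinite_finite_induct) (auto intro: times_continuously_differentiable_add)

lemma times_continuously_differentiable_diff:
  assumes "times_continuously_differentiable k f" "times_continuously_differentiable k g"
  shows "times_continuously_differentiable k (\<lambda>x. f x - g x)"
  using times_continuously_differentiable_add[OF assms(1)
      times_continuously_differentiable_scaleR[OF times_continuously_differentiable_const[of k "-1"]
        assms(2)]]
  by simp

text \<open>\<open>H\<close> lists a scalar function with all its derivatives. The induction leaves
  \<open>n\<close> arbitrary because differentiating \<open>H n (f x)\<close> produces
  \<open>H (Suc n) (f x)\<close>.\<close>

lemma times_continuously_differentiable_compose:
  fixes f :: "'a::euclidean_space \<Rightarrow> real"
  assumes "\<And>n t. (H n has_real_derivative H (Suc n) t) (at t)"
  shows "times_continuously_differentiable k f \<Longrightarrow>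
    times_continuously_differentiable k (\<lambda>x. H n (f x))"
proof (induction k arbitrary: n)
  case 0
  have "continuous_on UNIV (H n)"
    using assms DERIV_isCont by (blast intro: continuous_at_imp_continuous_on)
  with 0 show ?case
    by (auto intro: continuous_on_compose2)
next
  case (Suc k)
  note f = times_continuously_differentiable_SucD[OF Suc.prems]
  have "((\<lambda>x. H n (f x)) has_derivative (\<lambda>v. frechet_derivative f (at x) v * H (Suc n) (f x))) (at x)"
    for x
    using has_derivative_compose[OF f(1) assms[unfolded has_field_derivative_def]]
    by (simp add: mult.commute)
  then show ?case
    by (rule times_continuously_differentiable_SucI)
      (auto intro!: times_continuously_differentiable_mult Suc.IH f(2)
        intro: times_continuously_differentiable_Suc_imp Suc.prems)
qed

text \<open>The derivative of a reciprocal is a polynomial in the reciprocal and the derivative of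
  \<open>f\<close>, so class \<open>k\<close> of the reciprocal itself feeds the step to
  \<open>Suc k\<close>.\<close>

lemma times_continuously_differentiable_inverse:
  fixes f :: "'a::euclidean_space \<Rightarrow> real"
  assumes "\<And>x. f x \<noteq> 0"
  shows "times_continuously_differentiable k f \<Longrightarrow>
    times_continuously_differentiable k (\<lambda>x. inverse (f x))"
proof (induction k)
  case (Suc k)
  note f = times_continuously_differentiable_SucD[OF Suc.prems]
  have k: "times_continuously_differentiable k (\<lambda>x. inverse (f x))"
    using Suc times_continuously_differentiable_Suc_imp by blast
  have "((\<lambda>x. inverse (f x)) has_derivative
      (\<lambda>v. (-1) * (inverse (f x) * (frechet_derivative f (at x) v * inverse (f x))))) (at x)" for x
    using Deriv.has_derivative_inverse[OF assms f(1)] by (simp add: mult.assoc)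
  then show ?case
    by (rule times_continuously_differentiable_SucI)
      (intro times_continuously_differentiable_mult f(2) k times_continuously_differentiable_const)
qed (use assms in \<open>auto intro: continuous_intros\<close>)

text \<open>
  The polynomial factor makes this family around \<open>exp (-1/t)\<close> closed under differentiation.
\<close>

definition flat :: "real poly \<Rightarrow> real \<Rightarrow> real" where
  "flat p t = (if t \<le> 0 then 0 else poly p (1 / t) * exp (- (1 / t)))"

lemma tendsto_poly_exp_0: "((\<lambda>y. poly p y * exp (- y)) \<longlongrightarrow> (0::real)) at_top"
proof -
  have "((\<lambda>y. \<Sum>i\<le>degree p. coeff p i * (y ^ i / exp y)) \<longlongrightarrow> (\<Sum>i\<le>degree p. coeff p i * 0)) at_top"
    by (intro tendsto_sum tendsto_mult tendsto_const tendsto_power_div_exp_0)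
  then show ?thesis
    by (simp add: poly_altdef exp_minus divide_inverse sum_distrib_right mult.assoc)
qed

lemma flat_tendsto_0: "(flat p \<longlongrightarrow> 0) (at 0)"
proof -
  have "((\<lambda>t. poly p (1 / t) * exp (- (1 / t))) \<longlongrightarrow> 0) (at_right 0)"
    using filterlim_compose[OF tendsto_poly_exp_0 filterlim_inverse_at_top_right]
    by (simp add: inverse_eq_divide)
  then have "(flat p \<longlongrightarrow> 0) (at_right 0)"
    by (rule Lim_transform_eventually)
      (auto simp: eventually_at flat_def intro!: exI[of _ 1])
  moreover have "(flat p \<longlongrightarrow> 0) (at_left 0)"
    by (rule Lim_transform_eventually[OF tendsto_const])
      (auto simp: eventually_at flat_def intro!: exI[of _ 1])
  ultimately show ?thesis
    by (simp add: filterlim_at_split)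
qed

text \<open>For positive \<open>t\<close>, the product and chain rules give the factor
  \<open>(1/t)^2\<close> times \<open>p - p'\<close> at \<open>1/t\<close>; the coefficient list
  \<open>[:0, 0, 1:]\<close> is the square of the variable.\<close>

lemma flat_has_real_derivative:
  "(flat p has_real_derivative flat ([:0, 0, 1:] * (p - pderiv p)) t) (at t)"
proof -
  consider "t < 0" | "t = 0" | "t > 0" by linarith
  then show ?thesis
  proof cases
    case 1
    have "((\<lambda>t. 0) has_real_derivative flat ([:0, 0, 1:] * (p - pderiv p)) t) (at t)"
      using 1 by (simp add: flat_def)
    then show ?thesis
      by (rule has_field_derivative_transform_within_open[where S = "{..<0}"])
        (use 1 in \<open>auto simp: flat_def\<close>)
  next
    case 2
    \<comment> \<open>The difference quotient at 0 is again a flat function: division by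
      \<open>h\<close> multiplies the polynomial in \<open>1/h\<close> by its variable.\<close>
    have "((\<lambda>h. (flat p (0 + h) - flat p 0) / h) \<longlongrightarrow> 0) (at 0)"
      by (rule Lim_transform_eventually[OF flat_tendsto_0[of "[:0, 1:] * p"]])
        (auto simp: flat_def eventually_at intro!: exI[of _ 1])
    then show ?thesis
      using 2 by (simp add: DERIV_def flat_def)
  next
    case 3
    have "((\<lambda>t. poly p (1 / t) * exp (- (1 / t))) has_real_derivative
        flat ([:0, 0, 1:] * (p - pderiv p)) t) (at t)"
      using 3
      by (auto intro!: derivative_eq_intros simp: flat_def field_simps power2_eq_square)
    then show ?thesis
      by (rule has_field_derivative_transform_within_open[where S = "{0<..}"])
        (use 3 in \<open>auto simp: flat_def\<close>)
  qed
qed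

lemma smooth_flat_compose:
  fixes f :: "'a::euclidean_space \<Rightarrow> real"
  assumes "smooth f"
  shows "smooth (\<lambda>x. flat 1 (f x))"
proof
  fix k
  \<comment> \<open>Iterating the derivative map on polynomials, starting from 1, lists all
    derivatives of \<open>flat 1\<close>.\<close>
  define H where "H n = flat (((\<lambda>p. [:0, 0, 1:] * (p - pderiv p)) ^^ n) 1)" for n :: nat
  have "times_continuously_differentiable k (\<lambda>x. H 0 (f x))"
    by (rule times_continuously_differentiable_compose)
      (use assms in \<open>auto simp: H_def simp del: mult_pCons_left intro!: flat_has_real_derivative\<close>)
  then show "times_continuously_differentiable k (\<lambda>x. flat 1 (f x))"
    by (simp add: H_def)
qed

lemma flat_1_pos_iff: "flat 1 t > 0 \<longleftrightarrow> t > 0" and flat_1_nonneg: "flat 1 t \<ge> 0"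
  and flat_1_eq_0_iff: "flat 1 t = 0 \<longleftrightarrow> t \<le> 0"
  by (auto simp: flat_def)

section \<open>Smooth bumps and cutoffs between a compact and an open set\<close>

lemma smooth_norm_square: "smooth (\<lambda>x::'a::euclidean_space. (norm (x - a))\<^sup>2)"
proof
  fix k
  have eq: "(norm (x - a))\<^sup>2 = (\<Sum>b\<in>Basis. (x \<bullet> b - a \<bullet> b) * (x \<bullet> b - a \<bullet> b))" for x
    unfolding power2_norm_eq_inner
    by (subst euclidean_inner) (simp add: inner_diff_left)
  show "times_continuously_differentiable k (\<lambda>x. (norm (x - a))\<^sup>2)"
    unfolding eq
    by (intro times_continuously_differentiable_sum times_continuously_differentiable_mult
        times_continuously_differentiable_diff times_continuously_differentiable_const
        times_continuously_differentiable_linear bounded_linear_inner_left)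
qed

lemma smooth_imp_continuous: "smooth f \<Longrightarrow> continuous_on UNIV f"
  by (drule spec[of _ 0]) simp

text \<open>A finite sum \<open>s\<close> of bumps is positive on \<open>K\<close> and supported in
  finitely many closed balls inside \<open>U\<close>. The quotient of \<open>flat 1 (s y)\<close> by
  \<open>flat 1 (s y) + flat 1 (c - s y)\<close> vanishes where \<open>s\<close> does and is exactly
  1 once \<open>s\<close> exceeds \<open>c\<close>, so it equals 1 on a whole neighbourhood of
  \<open>K\<close>.\<close>

lemma smooth_urysohn:
  fixes K U :: "'a::euclidean_space set"
  assumes "compact K" "open U" "K \<subseteq> U"
  obtains \<eta> :: "'a \<Rightarrow> real" and W where "smooth \<eta>" "\<And>x. 0 \<le> \<eta> x" "\<And>x. \<eta> x \<le> 1"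
    "open W" "K \<subseteq> W" "\<And>x. x \<in> W \<Longrightarrow> \<eta> x = 1"
    "compact (closure {x. \<eta> x \<noteq> 0})" "closure {x. \<eta> x \<noteq> 0} \<subseteq> U"
proof -
  have "\<forall>x\<in>K. \<exists>r>0. cball x r \<subseteq> U"
    using assms open_contains_cball by blast
  then obtain r where r: "\<And>x. x \<in> K \<Longrightarrow> r x > 0" "\<And>x. x \<in> K \<Longrightarrow> cball x (r x) \<subseteq> U"
    by metis
  have "K \<subseteq> (\<Union>x\<in>K. ball x (r x))"
    using r(1) by force
  then obtain D where D: "D \<subseteq> K" "finite D" "K \<subseteq> (\<Union>x\<in>D. ball x (r x))"
    using compactE_image[OF assms(1), of K "\<lambda>x. ball x (r x)"] by auto
  define s where "s y = (\<Sum>x\<in>D. flat 1 ((r x)\<^sup>2 - (norm (y - x))\<^sup>2))" for y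
  have "smooth s"
    unfolding s_def
    by (intro allI times_continuously_differentiable_sum smooth_flat_compose[rule_format]
        times_continuously_differentiable_diff times_continuously_differentiable_const
        smooth_norm_square[rule_format])
  have s_nonneg: "s y \<ge> 0" for y
    unfolding s_def by (intro sum_nonneg flat_1_nonneg)
  have s_pos: "s y > 0" if "y \<in> K" for y
  proof -
    from that D obtain x where x: "x \<in> D" "y \<in> ball x (r x)" by blast
    have "(norm (y - x))\<^sup>2 < (r x)\<^sup>2"
      using x(2) by (intro power_strict_mono) (auto simp: dist_norm norm_minus_commute)
    with x(1) D(2) show ?thesis
      unfolding s_def by (intro sum_pos2[of D x]) (auto simp: flat_1_pos_iff flat_1_nonneg)
  qed
  have s_supp: "{y. s y \<noteq> 0} \<subseteq> (\<Union>x\<in>D. cball x (r x))"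
  proof
    fix y assume "y \<in> {y. s y \<noteq> 0}"
    then obtain x where x: "x \<in> D" "flat 1 ((r x)\<^sup>2 - (norm (y - x))\<^sup>2) \<noteq> 0"
      by (auto simp: s_def elim: sum.not_neutral_contains_not_neutral)
    then have "(norm (y - x))\<^sup>2 < (r x)\<^sup>2"
      by (auto simp: flat_1_eq_0_iff)
    then have "norm (y - x) < r x"
      using x(1) D(1) r(1) by (meson power2_less_imp_less less_imp_le subsetD)
    with x(1) show "y \<in> (\<Union>x\<in>D. cball x (r x))"
      by (auto simp: dist_norm norm_minus_commute intro!: bexI[of _ x])
  qed
  \<comment> \<open>Half the minimum of \<open>s\<close> on \<open>K\<close> leaves the strict
    inequality that puts \<open>K\<close> inside the open set where \<open>s\<close> exceeds
    \<open>c\<close>.\<close>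
  obtain c where c: "c > 0" "\<And>y. y \<in> K \<Longrightarrow> c < s y"
  proof (cases "K = {}")
    case False
    have "continuous_on K s"
      using smooth_imp_continuous[OF \<open>smooth s\<close>] continuous_on_subset by blast
    from continuous_attains_inf[OF assms(1) False this]
    obtain z where "z \<in> K" "\<And>y. y \<in> K \<Longrightarrow> s z \<le> s y" by blast
    then show ?thesis
      using that[of "s z / 2"] s_pos by fastforce
  qed (use that[of 1] in auto)
  define d where "d y = flat 1 (s y) + flat 1 (c - s y)" for y
  \<comment> \<open>Since \<open>c\<close> is positive, \<open>s y\<close> and
    \<open>c - s y\<close> cannot both be nonpositive.\<close>
  have d: "d y > 0" for y
    using c(1) flat_1_nonneg[of "s y"] flat_1_nonneg[of "c - s y"]
      flat_1_pos_iff[of "s y"] flat_1_pos_iff[of "c - s y"]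
    by (cases "s y > 0") (auto simp: d_def intro: add_pos_nonneg add_nonneg_pos)
  define \<eta> where "\<eta> y = flat 1 (s y) * inverse (d y)" for y
  have supp: "closure {y. \<eta> y \<noteq> 0} \<subseteq> (\<Union>x\<in>D. cball x (r x))"
  proof (rule closure_minimal)
    show "{y. \<eta> y \<noteq> 0} \<subseteq> (\<Union>x\<in>D. cball x (r x))"
      using s_supp by (auto simp: \<eta>_def flat_1_eq_0_iff)
    show "closed (\<Union>x\<in>D. cball x (r x))"
      using D(2) by auto
  qed
  show thesis
  proof (rule that[of \<eta> "{y. c < s y}"])
    have "smooth d"
      unfolding d_def using \<open>smooth s\<close>
      by (intro allI times_continuously_differentiable_add smooth_flat_compose[rule_format]
          times_continuously_differentiable_diff times_continuously_differentiable_const) auto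
    then show "smooth \<eta>"
      unfolding \<eta>_def using d \<open>smooth s\<close>
      by (intro allI times_continuously_differentiable_mult smooth_flat_compose[rule_format]
          times_continuously_differentiable_inverse) (auto simp: less_imp_neq[symmetric])
    show "0 \<le> \<eta> x" "\<eta> x \<le> 1" for x
      using d[of x] flat_1_nonneg[of "s x"] flat_1_nonneg[of "c - s x"]
      by (auto simp: \<eta>_def d_def field_simps)
    show "open {y. c < s y}"
      using smooth_imp_continuous[OF \<open>smooth s\<close>] by (intro open_Collect_less continuous_intros)
    show "K \<subseteq> {y. c < s y}"
      using c by auto
    show "\<eta> x = 1" if "x \<in> {y. c < s y}" for x
    proof -
      have "flat 1 (c - s x) = 0"
        using that by (simp add: flat_1_eq_0_iff)
      then have "d x = flat 1 (s x)"
        by (simp add: d_def)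
      then show ?thesis
        using d[of x] by (simp add: \<eta>_def)
    qed
    show "compact (closure {x. \<eta> x \<noteq> 0})"
      using supp D(2) by (auto intro!: compact_closure[THEN iffD2] bounded_subset[OF _ order_trans[OF closure_subset supp]])
    show "closure {x. \<eta> x \<noteq> 0} \<subseteq> U"
      using supp D(1) r(2) by blast
  qed
qed

section \<open>Approximation by test fields\<close>

lemma test_fieldsI:
  assumes "smooth \<phi>" "compact C" "C \<subseteq> U" "{x. \<phi> x \<noteq> 0} \<subseteq> C"
  shows "\<phi> \<in> test_fields U"
proof -
  have *: "closure {x. \<phi> x \<noteq> 0} \<subseteq> C"
    using assms by (simp add: closure_minimal compact_imp_closed)
  then have "compact (closure {x. \<phi> x \<noteq> 0})"
    using assms(2) compact_Int_closed[OF assms(2) closed_closure] by (metis inf.absorb2)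
  with * assms show ?thesis
    by (auto simp: test_fields_def)
qed

lemma test_fieldsD:
  assumes "\<phi> \<in> test_fields U"
  shows "smooth \<phi>" "compact (closure {x. \<phi> x \<noteq> 0})" "closure {x. \<phi> x \<noteq> 0} \<subseteq> U"
    "{x. \<phi> x \<noteq> 0} \<subseteq> closure {x. \<phi> x \<noteq> 0}" "\<And>x. x \<notin> U \<Longrightarrow> \<phi> x = 0"
  using assms closure_subset[of "{x. \<phi> x \<noteq> 0}"] by (auto simp: test_fields_def)

lemma test_fields_mono: "U \<subseteq> V \<Longrightarrow> \<phi> \<in> test_fields U \<Longrightarrow> \<phi> \<in> test_fields V"
  by (auto simp: test_fields_def)

lemma zero_test_field [simp]: "(\<lambda>x. 0) \<in> test_fields U"
  by (rule test_fieldsI[of _ "{}"]) auto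

lemma test_fields_add:
  assumes "\<phi> \<in> test_fields U" "\<psi> \<in> test_fields U"
  shows "(\<lambda>x. \<phi> x + \<psi> x) \<in> test_fields U"
proof (rule test_fieldsI)
  show "smooth (\<lambda>x. \<phi> x + \<psi> x)"
    using test_fieldsD(1)[OF assms(1)] test_fieldsD(1)[OF assms(2)]
    by (simp add: times_continuously_differentiable_add)
  show "compact (closure {x. \<phi> x \<noteq> 0} \<union> closure {x. \<psi> x \<noteq> 0})"
    "closure {x. \<phi> x \<noteq> 0} \<union> closure {x. \<psi> x \<noteq> 0} \<subseteq> U"
    using test_fieldsD(2,3)[OF assms(1)] test_fieldsD(2,3)[OF assms(2)] by (simp_all add: compact_Un)
  show "{x. \<phi> x + \<psi> x \<noteq> 0} \<subseteq> closure {x. \<phi> x \<noteq> 0} \<union> closure {x. \<psi> x \<noteq> 0}"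
    using test_fieldsD(4)[OF assms(1)] test_fieldsD(4)[OF assms(2)] by fastforce
qed

lemma test_fields_smooth_scaleR:
  assumes "\<phi> \<in> test_fields U" "smooth a"
  shows "(\<lambda>x. a x *\<^sub>R \<phi> x) \<in> test_fields U"
  using test_fieldsD[OF assms(1)] assms(2)
  by (intro test_fieldsI[of _ "closure {x. \<phi> x \<noteq> 0}"])
    (auto intro!: times_continuously_differentiable_scaleR)

lemma test_fields_scaleR:
  assumes "\<phi> \<in> test_fields U"
  shows "(\<lambda>x. c *\<^sub>R \<phi> x) \<in> test_fields U"
  using test_fields_smooth_scaleR[OF assms, of "\<lambda>x. c"] by simp

lemma test_fields_uminus:
  assumes "\<phi> \<in> test_fields U"
  shows "(\<lambda>x. - \<phi> x) \<in> test_fields U"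
  using test_fields_scaleR[OF assms, of "-1"] by simp

lemma test_fields_diff:
  assumes "\<phi> \<in> test_fields U" "\<psi> \<in> test_fields U"
  shows "(\<lambda>x. \<phi> x - \<psi> x) \<in> test_fields U"
  using test_fields_add[OF assms(1) test_fields_uminus[OF assms(2)]] by simp

lemma test_fields_continuous: "\<phi> \<in> test_fields U \<Longrightarrow> continuous_on UNIV \<phi>"
  using test_fieldsD(1) smooth_imp_continuous by blast

lemma test_fields_bounded:
  assumes "\<phi> \<in> test_fields U"
  obtains M where "M > 0" "\<And>x. norm (\<phi> x) \<le> M"
proof -
  have "bounded (\<phi> ` closure {x. \<phi> x \<noteq> 0})"
    using test_fieldsD(2)[OF assms] test_fields_continuous[OF assms]
    by (meson compact_continuous_image compact_imp_bounded continuous_on_subset top_greatest)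
  then obtain M where M: "M > 0" "\<And>x. x \<in> closure {x. \<phi> x \<noteq> 0} \<Longrightarrow> norm (\<phi> x) \<le> M"
    by (auto simp: bounded_pos)
  have "norm (\<phi> x) \<le> M" for x
    using M test_fieldsD(4)[OF assms] by (cases "\<phi> x = 0") auto
  with M(1) show ?thesis
    using that by blast
qed

section \<open>Scalar cutoffs with compact support\<close>

definition cutoffs :: "'a::euclidean_space set \<Rightarrow> ('a \<Rightarrow> real) set" where
  "cutoffs U = {\<eta>. smooth \<eta> \<and> (\<forall>x. 0 \<le> \<eta> x \<and> \<eta> x \<le> 1) \<and>
     compact (closure {x. \<eta> x \<noteq> 0}) \<and> closure {x. \<eta> x \<noteq> 0} \<subseteq> U}"

lemma cutoff_scaleR_test_field:
  assumes "\<eta> \<in> cutoffs U" "smooth \<phi>"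
  shows "(\<lambda>x. \<eta> x *\<^sub>R \<phi> x) \<in> test_fields U"
  using assms closure_subset[of "{x. \<eta> x \<noteq> 0}"] unfolding cutoffs_def
  by (intro test_fieldsI[of _ "closure {x. \<eta> x \<noteq> 0}"])
    (auto intro!: times_continuously_differentiable_scaleR)

text \<open>The value 1 on a neighbourhood, rather than on \<open>K\<close> alone, keeps the support
  of \<open>(1 - \<eta>) \<psi>\<close> away from \<open>K\<close>; the splitting in
  \<open>le_size_cover\<close> depends on it.\<close>

lemma cutoff_exists:
  fixes K U :: "'a::euclidean_space set"
  assumes "compact K" "open U" "K \<subseteq> U"
  shows "\<exists>\<eta>\<in>cutoffs U. \<exists>W. open W \<and> K \<subseteq> W \<and> (\<forall>x\<in>W. \<eta> x = 1)"
proof (rule smooth_urysohn[OF assms])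
  fix \<eta> :: "'a \<Rightarrow> real" and W
  assume "smooth \<eta>" "\<And>x. 0 \<le> \<eta> x" "\<And>x. \<eta> x \<le> 1" "open W" "K \<subseteq> W" "\<And>x. x \<in> W \<Longrightarrow> \<eta> x = 1"
    "compact (closure {x. \<eta> x \<noteq> 0})" "closure {x. \<eta> x \<noteq> 0} \<subseteq> U"
  then show ?thesis
    unfolding cutoffs_def by (intro bexI[of _ \<eta>] exI[of _ W]) simp_all
qed

lemma cutoff_eq_0: "\<eta> \<in> cutoffs U \<Longrightarrow> x \<notin> U \<Longrightarrow> \<eta> x = 0"
  using closure_subset[of "{x. \<eta> x \<noteq> 0}"] by (auto simp: cutoffs_def)

lemma cutoffD:
  assumes "\<eta> \<in> cutoffs U"
  shows "smooth \<eta>" "\<And>x. 0 \<le> \<eta> x" "\<And>x. \<eta> x \<le> 1"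
  using assms by (auto simp: cutoffs_def)

lemma cutoffs_mono: "U \<subseteq> V \<Longrightarrow> \<eta> \<in> cutoffs U \<Longrightarrow> \<eta> \<in> cutoffs V"
  by (auto simp: cutoffs_def)

lemma smooth_one_minus: "smooth (\<eta> :: 'a::euclidean_space \<Rightarrow> real) \<Longrightarrow> smooth (\<lambda>x. 1 - \<eta> x)"
  by (auto intro: times_continuously_differentiable_diff)

section \<open>Finite Borel measures on an open set and their regularity\<close>

lemma space_eq_if_sets_restrict_borel:
  "sets N = sets (restrict_space borel \<Omega>) \<Longrightarrow> space N = \<Omega>"
  by (drule sets_eq_imp_space_eq) (simp add: space_restrict_space)

lemma continuous_imp_measurable_restrict:
  assumes "sets N = sets (restrict_space borel \<Omega>)" "continuous_on UNIV f"
  shows "f \<in> borel_measurable N"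
  using assms(2) measurable_cong_sets[OF assms(1) refl]
  by (auto intro: measurable_restrict_space1 borel_measurable_continuous_onI)

lemma sets_restrict_borel_open:
  "open \<Omega> \<Longrightarrow> E \<in> sets (restrict_space borel \<Omega>) \<longleftrightarrow> E \<subseteq> \<Omega> \<and> E \<in> sets borel"
  by (subst sets_restrict_space_iff) auto

lemma finite_measure_regular_on_open:
  fixes \<Omega> :: "'a::euclidean_space set"
  assumes "open \<Omega>" and sets: "sets N = sets (restrict_space borel \<Omega>)" and "finite_measure N"
    and E: "E \<in> sets N" and "e > 0"
  obtains K U where "compact K" "open U" "K \<subseteq> E" "E \<subseteq> U" "U \<subseteq> \<Omega>" "measure N (U - K) < e"
proof -
  interpret finite_measure N by fact
  have sp: "space N = \<Omega>"
    using sets by (rule space_eq_if_sets_restrict_borel)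
  have E': "E \<subseteq> \<Omega>" "E \<in> sets borel"
    using E sets_restrict_borel_open[OF \<open>open \<Omega>\<close>] by (auto simp: sets)
  have id [measurable]: "(\<lambda>x. x) \<in> borel_measurable N"
    by (rule continuous_imp_measurable_restrict[OF sets continuous_on_id])
  \<comment> \<open>The push-forward under inclusion is a finite Borel measure on the whole space,
    where inner and outer regularity apply. Intersecting with the open set \<Omega> brings the outer
    approximation back.\<close>
  define M where "M = distr N borel (\<lambda>x. x)"
  have sM: "sets M = sets borel"
    by (simp add: M_def)
  have M: "emeasure M A = emeasure N (A \<inter> \<Omega>)" if "A \<in> sets borel" for A
    using that by (simp add: M_def emeasure_distr sp)
  have fM: "emeasure M A \<noteq> \<infinity>" for A
    using emeasure_finite by (cases "A \<in> sets borel") (auto simp: M emeasure_notin_sets sM)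
  have "e / 2 > 0"
    using \<open>e > 0\<close> by simp
  have "\<exists>K\<in>{K. K \<subseteq> E \<and> compact K}. emeasure M E < emeasure M K + ennreal (e / 2)"
    by (rule SUP_approx_ennreal[OF \<open>e / 2 > 0\<close> _ inner_regular[OF sM fM E'(2)] fM]) auto
  then obtain K where K: "compact K" "K \<subseteq> E" "emeasure M E < emeasure M K + ennreal (e / 2)"
    by blast
  have "\<exists>V\<in>{V. E \<subseteq> V \<and> open V}. emeasure M V < emeasure M E + ennreal (e / 2)"
    by (rule INF_approx_ennreal[OF \<open>e / 2 > 0\<close> outer_regular[OF sM fM E'(2)] fM])
  then obtain V where V: "open V" "E \<subseteq> V" "emeasure M V < emeasure M E + ennreal (e / 2)"
    by blast
  define U where "U = V \<inter> \<Omega>"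
  have U: "open U" "E \<subseteq> U" "U \<subseteq> \<Omega>"
    using V E' \<open>open \<Omega>\<close> by (auto simp: U_def)
  have sK: "K \<in> sets N" and sU: "U \<in> sets N"
    using K U E' by (auto simp: sets sets_restrict_borel_open[OF \<open>open \<Omega>\<close>] compact_imp_closed)
  have "K \<inter> \<Omega> = K" "E \<inter> \<Omega> = E"
    using K E' by auto
  then have "emeasure M E = ennreal (measure N E)" "emeasure M K = ennreal (measure N K)"
    "emeasure M V = ennreal (measure N U)"
    using M[OF E'(2)] M[of K] M[of V] K(1) V(1)
    by (simp_all add: emeasure_eq_measure U_def compact_imp_closed)
  with K(3) V(3) have "ennreal (measure N E) < ennreal (measure N K + e / 2)"
    "ennreal (measure N U) < ennreal (measure N E + e / 2)"
    using \<open>e > 0\<close> by (simp_all add: ennreal_plus)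
  then have "measure N E < measure N K + e / 2" "measure N U < measure N E + e / 2"
    by (simp_all add: ennreal_less_iff)
  then have "measure N (U - K) < e"
    using finite_measure_Diff[OF sU sK] K(2) U(2) by auto
  with K U that show ?thesis
    by blast
qed

section \<open>Density of test fields in L1 of a finite measure\<close>

lemma norm_diff_le_2:
  fixes a b :: "'a::real_normed_vector"
  shows "norm a \<le> 1 \<Longrightarrow> norm b \<le> 1 \<Longrightarrow> norm (a - b) \<le> 2"
  using norm_triangle_ineq4[of a b] by linarith

lemma (in finite_measure) integrable_norm_diff:
  fixes a b :: "'a \<Rightarrow> 'b::euclidean_space"
  assumes [measurable]: "a \<in> borel_measurable M" "b \<in> borel_measurable M"
    and "\<And>x. x \<in> space M \<Longrightarrow> norm (a x) \<le> 1" "\<And>x. x \<in> space M \<Longrightarrow> norm (b x) \<le> 1"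
  shows "integrable M (\<lambda>x. norm (a x - b x))"
  by (rule integrable_const_bound[where B = 2]) (auto intro!: AE_I2 norm_diff_le_2 assms(3,4))

text \<open>A cutoff that is 1 on \<open>K\<close> and 0 off \<open>U\<close> agrees with the
  indicator of \<open>E\<close> outside \<open>U - K\<close>, and there the error is at most 1.
  Regularity makes that set small.\<close>

lemma cutoff_approx_indicator:
  fixes \<Omega> :: "'a::euclidean_space set"
  assumes "open \<Omega>" and sets: "sets N = sets (restrict_space borel \<Omega>)" and "finite_measure N"
    and E: "E \<in> sets N" and "e > 0"
  obtains \<eta> where "\<eta> \<in> cutoffs \<Omega>" "(\<integral>x. \<bar>\<eta> x - indicator E x\<bar> \<partial>N) < e"
proof -
  interpret finite_measure N by fact
  obtain K U where KU: "compact K" "open U" "K \<subseteq> E" "E \<subseteq> U" "U \<subseteq> \<Omega>" "measure N (U - K) < e"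
    by (rule finite_measure_regular_on_open[OF assms])
  have "K \<subseteq> U"
    using KU(3,4) by simp
  then obtain \<eta> where \<eta>: "\<eta> \<in> cutoffs U" "\<And>x. x \<in> K \<Longrightarrow> \<eta> x = 1"
    using cutoff_exists[OF KU(1,2)] by blast
  have "U - K \<in> sets N"
    using KU by (auto simp: sets sets_restrict_borel_open[OF \<open>open \<Omega>\<close>] compact_imp_closed)
  have [measurable]: "\<eta> \<in> borel_measurable N" "E \<in> sets N"
    using continuous_imp_measurable_restrict[OF sets smooth_imp_continuous[OF cutoffD(1)[OF \<eta>(1)]]] E
    by auto
  have le: "\<bar>\<eta> x - indicator E x\<bar> \<le> indicator (U - K) x" for x
  proof (cases "x \<in> U - K")
    case True
    then show ?thesis
      using cutoffD(2,3)[OF \<eta>(1), of x] by (auto simp: indicator_def)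
  next
    case False
    then consider "x \<in> K" | "x \<notin> U" by blast
    then show ?thesis
    proof cases
      case 1
      then show ?thesis using \<eta>(2) KU(3) by (auto simp: indicator_def)
    next
      case 2
      then have "\<eta> x = 0"
        by (rule cutoff_eq_0[OF \<eta>(1)])
      then show ?thesis using 2 KU(4) by (auto simp: indicator_def)
    qed
  qed
  have "(\<integral>x. \<bar>\<eta> x - indicator E x\<bar> \<partial>N) \<le> (\<integral>x. indicator (U - K) x \<partial>N)"
  proof (rule integral_mono[OF _ _ le])
    show "integrable N (\<lambda>x. indicator (U - K) x :: real)"
      using \<open>U - K \<in> sets N\<close> by (simp add: integrable_indicator_iff emeasure_eq_measure)
    show "integrable N (\<lambda>x. \<bar>\<eta> x - indicator E x\<bar>)"
      using cutoffD(2,3)[OF \<eta>(1)]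
      by (intro integrable_norm_diff[where 'b = real, simplified]) (auto simp: indicator_def)
  qed
  also have "\<dots> < e"
    using KU(6) \<open>U - K \<in> sets N\<close> sets.sets_into_space by (simp add: Int_absorb2)
  finally show ?thesis
    using that[OF cutoffs_mono[OF KU(5) \<eta>(1)]] by simp
qed

lemma test_field_approx_finite_range:
  fixes \<theta> :: "'a::euclidean_space \<Rightarrow> 'a"
  assumes "open \<Omega>" and sets: "sets N = sets (restrict_space borel \<Omega>)" and fin: "finite_measure N"
    and \<theta>: "\<theta> \<in> borel_measurable N" and "finite S"
  shows "\<lbrakk>\<And>c. c \<in> S \<Longrightarrow> norm c \<le> 1; e > 0\<rbrakk> \<Longrightarrow> \<exists>\<phi>\<in>test_fields \<Omega>. (\<forall>x. norm (\<phi> x) \<le> 1) \<and>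
    (\<integral>x. norm (\<phi> x - (if \<theta> x \<in> S then \<theta> x else 0)) \<partial>N) < e"
  using \<open>finite S\<close>
proof (induction S arbitrary: e)
  case empty
  then show ?case
    by (intro bexI[of _ "\<lambda>x. 0"]) auto
next
  case (insert c S)
  interpret finite_measure N by fact
  let ?\<theta> = "\<lambda>S x. if \<theta> x \<in> S then \<theta> x else 0"
  obtain \<phi> where \<phi>: "\<phi> \<in> test_fields \<Omega>" "\<And>x. norm (\<phi> x) \<le> 1"
    "(\<integral>x. norm (\<phi> x - ?\<theta> S x) \<partial>N) < e / 2"
    using insert.IH[of "e / 2"] insert.prems by force
  define E where "E = {x \<in> space N. \<theta> x = c}"
  note \<theta>[measurable]
  have E: "E \<in> sets N"
    unfolding E_def by measurable
  \<comment> \<open>Vectors in the unit ball differ by at most 2, so the cutoff error counts twice: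
    \<open>2 * (e / 4) + e / 2 = e\<close>.\<close>
  have "e / 4 > 0"
    using insert.prems by simp
  from cutoff_approx_indicator[OF \<open>open \<Omega>\<close> sets fin E this]
  obtain \<eta> where \<eta>: "\<eta> \<in> cutoffs \<Omega>" "(\<integral>x. \<bar>\<eta> x - indicator E x\<bar> \<partial>N) < e / 4"
    by blast
  have \<eta>': "smooth \<eta>" "\<And>x. 0 \<le> \<eta> x" "\<And>x. \<eta> x \<le> 1"
    using cutoffD[OF \<eta>(1)] .
  \<comment> \<open>a convex combination, which keeps the constraint \<open>norm (\<psi> x) \<le> 1\<close> without any truncation\<close>
  define \<psi> where "\<psi> x = \<eta> x *\<^sub>R c + (1 - \<eta> x) *\<^sub>R \<phi> x" for x
  have \<psi>: "\<psi> \<in> test_fields \<Omega>"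
    unfolding \<psi>_def
    by (intro test_fields_add cutoff_scaleR_test_field \<eta> test_fields_smooth_scaleR \<phi>
        smooth_one_minus \<eta>') simp
  have \<psi>_le: "norm (\<psi> x) \<le> 1" for x
  proof -
    have "norm (\<psi> x) \<le> \<eta> x * norm c + (1 - \<eta> x) * norm (\<phi> x)"
      unfolding \<psi>_def using \<eta>'(2,3)[of x] by (intro norm_triangle_le) simp
    also have "\<dots> \<le> 1"
      using \<eta>'(2,3)[of x] \<phi>(2)[of x] insert.prems(1)[of c] by (intro convex_bound_le) auto
    finally show ?thesis .
  qed
  have le: "norm (\<psi> x - ?\<theta> (insert c S) x) \<le> 2 * \<bar>\<eta> x - indicator E x\<bar> + norm (\<phi> x - ?\<theta> S x)"
    if "x \<in> space N" for x
  proof -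
    have *: "?\<theta> (insert c S) x = indicator E x *\<^sub>R c + (1 - indicator E x) *\<^sub>R ?\<theta> S x"
      using that insert.hyps by (auto simp: E_def indicator_def)
    have "\<psi> x - ?\<theta> (insert c S) x =
        (\<eta> x - indicator E x) *\<^sub>R (c - \<phi> x) + (1 - indicator E x) *\<^sub>R (\<phi> x - ?\<theta> S x)"
      unfolding * \<psi>_def by (simp add: algebra_simps)
    also have "norm \<dots> \<le> \<bar>\<eta> x - indicator E x\<bar> * norm (c - \<phi> x)
        + \<bar>1 - indicator E x\<bar> * norm (\<phi> x - ?\<theta> S x)"
      by (intro norm_triangle_le) simp
    also have "\<dots> \<le> \<bar>\<eta> x - indicator E x\<bar> * 2 + 1 * norm (\<phi> x - ?\<theta> S x)"
      using insert.prems(1)[of c] \<phi>(2)[of x]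
      by (intro add_mono mult_left_mono mult_right_mono norm_diff_le_2)
        (simp_all add: indicator_def)
    finally show ?thesis
      by (simp only: mult.commute mult_1)
  qed
  have m [measurable]: "\<phi> \<in> borel_measurable N" "\<psi> \<in> borel_measurable N" "\<eta> \<in> borel_measurable N"
    "E \<in> sets N"
    by (intro continuous_imp_measurable_restrict[OF sets] test_fields_continuous[OF \<phi>(1)]
        test_fields_continuous[OF \<psi>] smooth_imp_continuous[OF \<eta>'(1)] E)+
  have m\<theta> [measurable]: "?\<theta> T \<in> borel_measurable N" if "finite T" for T
  proof -
    have "T \<in> sets borel"
      using that by (intro borel_closed finite_imp_closed)
    then show "?\<theta> T \<in> borel_measurable N"
      by measurable
  qed
  have T: "norm (?\<theta> T x) \<le> 1" if "T \<subseteq> insert c S" for T x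
    using insert.prems(1) that by auto
  have i: "integrable N (\<lambda>x. \<bar>\<eta> x - indicator E x\<bar>)"
    "integrable N (\<lambda>x. norm (\<phi> x - ?\<theta> S x))" "integrable N (\<lambda>x. norm (\<psi> x - ?\<theta> (insert c S) x))"
  proof -
    show "integrable N (\<lambda>x. \<bar>\<eta> x - indicator E x\<bar>)"
      using \<eta>'(2,3) by (intro integrable_norm_diff[where 'b = real, simplified]) (auto simp: indicator_def)
    show "integrable N (\<lambda>x. norm (\<phi> x - ?\<theta> S x))"
      by (rule integrable_norm_diff[OF m(1) m\<theta> \<phi>(2) T]) (use insert.hyps in auto)
    show "integrable N (\<lambda>x. norm (\<psi> x - ?\<theta> (insert c S) x))"
      by (rule integrable_norm_diff[OF m(2) m\<theta> \<psi>_le T]) (use insert.hyps in auto)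
  qed
  have "(\<integral>x. norm (\<psi> x - ?\<theta> (insert c S) x) \<partial>N)
      \<le> (\<integral>x. 2 * \<bar>\<eta> x - indicator E x\<bar> + norm (\<phi> x - ?\<theta> S x) \<partial>N)"
    using i le by (intro integral_mono) auto
  also have "\<dots> = 2 * (\<integral>x. \<bar>\<eta> x - indicator E x\<bar> \<partial>N) + (\<integral>x. norm (\<phi> x - ?\<theta> S x) \<partial>N)"
    using i by simp
  also have "\<dots> < e"
    using \<eta>(2) \<phi>(3) by simp
  finally show ?case
    using \<psi> \<psi>_le by blast
qed

lemma test_field_approx:
  fixes \<theta> :: "'a::euclidean_space \<Rightarrow> 'a"
  assumes "open \<Omega>" and sets: "sets N = sets (restrict_space borel \<Omega>)" and fin: "finite_measure N"
    and \<theta> [measurable]: "\<theta> \<in> borel_measurable N" and le: "\<And>x. x \<in> \<Omega> \<Longrightarrow> norm (\<theta> x) \<le> 1" and "e > 0"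
  obtains \<phi> where "\<phi> \<in> test_fields \<Omega>" "\<And>x. norm (\<phi> x) \<le> 1" "(\<integral>x. norm (\<phi> x - \<theta> x) \<partial>N) < e"
proof -
  interpret finite_measure N by fact
  have sp: "space N = \<Omega>"
    using sets by (rule space_eq_if_sets_restrict_borel)
  obtain F where F: "\<And>i. simple_function N (F i)" "\<And>x. x \<in> \<Omega> \<Longrightarrow> (\<lambda>i. F i x) \<longlonglongrightarrow> \<theta> x"
    using borel_measurable_implies_sequence_metric[OF \<theta>, of 0] unfolding sp by blast
  \<comment> \<open>Radial projection onto the unit ball: continuous and the identity on that ball,
    it makes the simple functions admissible without moving their limit.\<close>
  define P where "P z = inverse (max 1 (norm z)) *\<^sub>R z" for z :: 'a
  have P_le: "norm (P z) \<le> 1" for z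
    by (auto simp: P_def field_simps max_def)
  have P_\<theta>: "P (\<theta> x) = \<theta> x" if "x \<in> \<Omega>" for x
    using le[OF that] by (simp add: P_def max_def)
  define s where "s i x = P (F i x)" for i x
  have s: "simple_function N (s i)" for i
    using simple_function_compose[OF F(1)[of i], of P] by (simp add: s_def[abs_def] comp_def)
  have s_lim: "(\<lambda>i. s i x) \<longlonglongrightarrow> \<theta> x" if "x \<in> \<Omega>" for x
  proof -
    have "(\<lambda>i. P (F i x)) \<longlonglongrightarrow> P (\<theta> x)"
      unfolding P_def by (intro tendsto_intros F(2) that) (auto simp: max_def)
    then show ?thesis
      using P_\<theta>[OF that] by (simp add: s_def)
  qed
  have [measurable]: "s i \<in> borel_measurable N" for i
    using s by (rule borel_measurable_simple_function)
  have "(\<lambda>i. \<integral>x. norm (s i x - \<theta> x) \<partial>N) \<longlonglongrightarrow> (\<integral>x. 0 \<partial>N)"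
  proof (rule integral_dominated_convergence[where w = "\<lambda>x. 2"])
    show "AE x in N. (\<lambda>i. norm (s i x - \<theta> x)) \<longlonglongrightarrow> 0"
      using s_lim by (intro AE_I2) (simp add: sp LIM_zero tendsto_norm_zero)
    show "AE x in N. norm (norm (s i x - \<theta> x)) \<le> 2" for i
      using le P_le by (intro AE_I2) (simp add: sp s_def norm_diff_le_2)
  qed auto
  then have "eventually (\<lambda>i. (\<integral>x. norm (s i x - \<theta> x) \<partial>N) < e / 2) sequentially"
    using \<open>e > 0\<close> by (intro order_tendstoD) auto
  then obtain i where i: "(\<integral>x. norm (s i x - \<theta> x) \<partial>N) < e / 2"
    by (auto simp: eventually_sequentially)
  define S where "S = s i ` \<Omega>"
  have "finite S" "\<And>c. c \<in> S \<Longrightarrow> norm c \<le> 1"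
    using simple_functionD(1)[OF s[of i]] P_le by (auto simp: S_def sp s_def)
  from test_field_approx_finite_range[OF assms(1-3) \<open>s i \<in> borel_measurable N\<close> this, of "e / 2"] \<open>e > 0\<close>
  obtain \<phi> where \<phi>: "\<phi> \<in> test_fields \<Omega>" "\<And>x. norm (\<phi> x) \<le> 1"
    "(\<integral>x. norm (\<phi> x - (if s i x \<in> S then s i x else 0)) \<partial>N) < e / 2"
    by auto
  have [measurable]: "\<phi> \<in> borel_measurable N"
    by (intro continuous_imp_measurable_restrict[OF sets] test_fields_continuous[OF \<phi>(1)])
  have "(\<integral>x. norm (\<phi> x - (if s i x \<in> S then s i x else 0)) \<partial>N) = (\<integral>x. norm (\<phi> x - s i x) \<partial>N)"
    by (rule Bochner_Integration.integral_cong) (auto simp: S_def sp)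
  have s_le: "norm (s i x) \<le> 1" for x
    by (simp add: s_def P_le)
  have le': "norm (\<theta> x) \<le> 1" if "x \<in> space N" for x
    using le that by (simp add: sp)
  have int: "integrable N (\<lambda>x. norm (\<phi> x - s i x))" "integrable N (\<lambda>x. norm (s i x - \<theta> x))"
    "integrable N (\<lambda>x. norm (\<phi> x - \<theta> x))"
    by (intro integrable_norm_diff \<phi>(2) s_le le'; measurable)+
  have "(\<integral>x. norm (\<phi> x - \<theta> x) \<partial>N) \<le> (\<integral>x. norm (\<phi> x - s i x) + norm (s i x - \<theta> x) \<partial>N)"
    using int by (intro integral_mono) (auto intro: norm_diff_triangle_le)
  also have "\<dots> < e"
    using int i \<phi>(3) \<open>_ = (\<integral>x. norm (\<phi> x - s i x) \<partial>N)\<close> by simp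
  finally show ?thesis
    using that \<phi> by blast
qed

section \<open>Vector measures and densities\<close>

text \<open>Domination by a finite measure turns finite into countable additivity: along a
  decreasing sequence with empty intersection the dominating values, hence those of \<mu>, tend to
  0.\<close>

lemma finite_measure_of_additive:
  fixes \<mu> :: "'a set \<Rightarrow> real"
  assumes "finite_measure N" and nonneg: "\<And>A. A \<in> sets N \<Longrightarrow> 0 \<le> \<mu> A"
    and le: "\<And>A. A \<in> sets N \<Longrightarrow> \<mu> A \<le> c * measure N A"
    and add: "\<And>A B. A \<in> sets N \<Longrightarrow> B \<in> sets N \<Longrightarrow> A \<inter> B = {} \<Longrightarrow> \<mu> (A \<union> B) = \<mu> A + \<mu> B"
  obtains M where "sets M = sets N" "\<And>A. A \<in> sets N \<Longrightarrow> emeasure M A = ennreal (\<mu> A)"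
proof -
  interpret finite_measure N by fact
  define M where "M = measure_of (space N) (sets N) (\<lambda>A. ennreal (\<mu> A))"
  have "\<mu> {} = 0"
    using nonneg[of "{}"] le[of "{}"] by simp
  then have pos: "positive (sets N) (\<lambda>A. ennreal (\<mu> A))"
    by (simp add: positive_def)
  have "countably_additive (sets N) (\<lambda>A. ennreal (\<mu> A))"
  proof (rule sets.empty_continuous_imp_countably_additive[OF pos])
    show "additive (sets N) (\<lambda>A. ennreal (\<mu> A))"
      using nonneg by (auto simp: additive_def add)
    show "\<forall>A\<in>sets N. ennreal (\<mu> A) \<noteq> \<infinity>"
      by simp
  next
    fix A :: "nat \<Rightarrow> 'a set"
    assume A: "range A \<subseteq> sets N" "decseq A" "(\<Inter>i. A i) = {}"
    have "(\<lambda>i. c * measure N (A i)) \<longlonglongrightarrow> c * measure N (\<Inter>i. A i)"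
      by (intro tendsto_mult tendsto_const finite_Lim_measure_decseq A)
    then have lim: "(\<lambda>i. c * measure N (A i)) \<longlonglongrightarrow> 0"
      using A(3) by simp
    have "(\<lambda>i. \<mu> (A i)) \<longlonglongrightarrow> 0"
      by (rule tendsto_sandwich[OF _ _ tendsto_const lim])
        (use A(1) nonneg le in \<open>auto intro!: always_eventually\<close>)
    then show "(\<lambda>i. ennreal (\<mu> (A i))) \<longlonglongrightarrow> 0"
      using tendsto_ennrealI by fastforce
  qed
  then have "emeasure M A = ennreal (\<mu> A)" if "A \<in> sets N" for A
    unfolding M_def by (rule emeasure_measure_of_sigma[OF sets.sigma_algebra_axioms pos _ that])
  moreover have "sets M = sets N"
    by (simp add: M_def)
  ultimately show ?thesis
    using that by blast
qed

lemma finite_measure_sum: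
  assumes "sets M = sets N" "finite_measure M" "finite_measure N"
  obtains R where "sets R = sets N" "finite_measure R"
    "\<And>A. A \<in> sets N \<Longrightarrow> emeasure R A = emeasure M A + emeasure N A"
proof -
  define R where "R = measure_of (space N) (sets N) (\<lambda>A. emeasure M A + emeasure N A)"
  have sR: "sets R = sets N"
    by (simp add: R_def)
  have e: "emeasure R A = emeasure M A + emeasure N A" if "A \<in> sets N" for A
    unfolding R_def
  proof (rule emeasure_measure_of_sigma[OF sets.sigma_algebra_axioms _ _ that])
    show "positive (sets N) (\<lambda>A. emeasure M A + emeasure N A)"
      by (simp add: positive_def)
    show "countably_additive (sets N) (\<lambda>A. emeasure M A + emeasure N A)"
      by (auto simp: countably_additive_def assms(1) suminf_add[symmetric] suminf_emeasure)
  qed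
  have "space R = space N" "space M = space N"
    using sR assms(1) by (auto dest: sets_eq_imp_space_eq)
  then have "finite_measure R"
    using assms(2,3) e[of "space N"] finite_measure.emeasure_finite[of M] finite_measure.emeasure_finite[of N]
    by (intro finite_measureI) auto
  with sR e that show ?thesis
    by blast
qed

lemma integral_dominated_measure:
  fixes f :: "'a \<Rightarrow> real"
  assumes sets: "sets M = sets N" and le: "\<And>A. A \<in> sets N \<Longrightarrow> emeasure M A \<le> emeasure N A"
    and f: "integrable N f" "\<And>x. 0 \<le> f x"
  shows "integrable M f" "integral\<^sup>L M f \<le> integral\<^sup>L N f"
proof -
  have meas: "f \<in> borel_measurable M"
    using f(1) measurable_cong_sets[OF sets refl] by auto
  have "(\<integral>\<^sup>+x. ennreal (f x) \<partial>M) \<le> (\<integral>\<^sup>+x. ennreal (f x) \<partial>N)"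
    by (rule nn_integral_mono_measure[OF sets]) (use le sets in \<open>simp add: le_measure\<close>)
  also have *: "\<dots> = ennreal (integral\<^sup>L N f)"
    using f by (intro nn_integral_eq_integral) auto
  finally have le: "(\<integral>\<^sup>+x. ennreal (f x) \<partial>M) \<le> ennreal (integral\<^sup>L N f)" .
  then show int: "integrable M f"
    using meas f(2) by (auto simp: integrable_iff_bounded less_top[symmetric] top_unique)
  have "(\<integral>\<^sup>+x. ennreal (f x) \<partial>M) = ennreal (integral\<^sup>L M f)"
    using int f by (intro nn_integral_eq_integral) auto
  with le show "integral\<^sup>L M f \<le> integral\<^sup>L N f"
    using f(2) by (simp add: ennreal_le_iff)
qed

text \<open>For a fixed direction \<open>e\<close>, integrating over the set where
  \<open>F x \<bullet> e > norm e\<close> contradicts the bound unless that set is null. A countable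
  dense set of directions leaves one null set for all of them.\<close>

lemma AE_norm_le_1_of_set_integral_le:
  fixes F :: "'a \<Rightarrow> 'b::euclidean_space"
  assumes "finite_measure N" and int: "integrable N F"
    and le: "\<And>A. A \<in> sets N \<Longrightarrow> norm (LINT x:A|N. F x) \<le> measure N A"
  shows "AE x in N. norm (F x) \<le> 1"
proof -
  interpret finite_measure N by fact
  have [measurable]: "F \<in> borel_measurable N"
    using int by simp
  obtain D :: "'b set" where D: "countable D" "\<And>X. open X \<Longrightarrow> X \<noteq> {} \<Longrightarrow> \<exists>d\<in>D. d \<in> X"
    by (erule countable_dense_setE)
  have "AE x in N. F x \<bullet> e \<le> norm e" for e
  proof -
    define A where "A = {x \<in> space N. F x \<bullet> e > norm e}"
    have A [measurable]: "A \<in> sets N"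
      unfolding A_def by measurable
    have iF: "integrable N (\<lambda>x. indicator A x *\<^sub>R F x)"
      using int by (intro integrable_mult_indicator) auto
    have i1: "integrable N (\<lambda>x. indicator A x :: real)"
      using A by (simp add: integrable_indicator_iff emeasure_eq_measure)
    have eq: "indicator A x * (F x \<bullet> e - norm e) = (indicator A x *\<^sub>R F x) \<bullet> e - norm e * indicator A x" for x
      by (auto simp: indicator_def)
    have i: "integrable N (\<lambda>x. indicator A x * (F x \<bullet> e - norm e))"
      unfolding eq
      by (intro Bochner_Integration.integrable_diff integrable_inner_left integrable_mult_right iF i1)
    have "(\<integral>x. indicator A x * (F x \<bullet> e - norm e) \<partial>N) = (LINT x:A|N. F x) \<bullet> e - norm e * measure N A"
      unfolding eq set_lebesgue_integral_def
      using integral_inner_left[OF iF, of e] integrable_inner_left[OF iF, of e] i1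
        sets.sets_into_space[OF A]
      by (simp del: inner_scaleR_left add: Int_absorb2)
    also have "\<dots> \<le> 0"
      using norm_cauchy_schwarz[of "LINT x:A|N. F x" e] mult_right_mono[OF le[OF A], of "norm e"]
      by (simp add: mult.commute)
    finally have "(\<integral>x. indicator A x * (F x \<bullet> e - norm e) \<partial>N) = 0"
      by (intro antisym integral_nonneg_AE) (auto simp: A_def indicator_def)
    then have "AE x in N. indicator A x * (F x \<bullet> e - norm e) = 0"
      by (subst (asm) integral_nonneg_eq_0_iff_AE[OF i]) (auto simp: A_def indicator_def)
    then show ?thesis
      by (rule AE_mp) (auto simp: A_def indicator_def intro!: AE_I2)
  qed
  then have "AE x in N. \<forall>e\<in>D. F x \<bullet> e \<le> norm e"
    using D(1) by (simp add: AE_ball_countable)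
  then show ?thesis
  proof (rule AE_mp, intro AE_I2 impI)
    fix x assume *: "\<forall>e\<in>D. F x \<bullet> e \<le> norm e"
    show "norm (F x) \<le> 1"
    proof (rule ccontr)
      assume "\<not> norm (F x) \<le> 1"
      \<comment> \<open>The vector \<open>F x\<close> itself then violates the inequality strictly.
        The violating vectors form an open set, so one of them lies in \<open>D\<close>.\<close>
      then have "norm (F x) * 1 < norm (F x) * norm (F x)"
        by (intro mult_strict_left_mono) auto
      then have "F x \<in> {e. norm e < F x \<bullet> e}"
        by (simp add: power2_norm_eq_inner[symmetric] power2_eq_square)
      moreover have "open {e. norm e < F x \<bullet> e}"
        by (intro open_Collect_less continuous_intros)
      ultimately show False
        using D(2) * by fastforce
    qed
  qed
qed

text \<open>A Radon-Nikodym theorem that assumes only finite additivity and domination. Densities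
  are found coordinatewise; the bound on the whole vector is recovered afterwards from the bound on
  \<open>m\<close>, so no dimensional constant enters.\<close>

lemma dominated_additive_density:
  fixes m :: "'a set \<Rightarrow> 'b::euclidean_space"
  assumes fin: "finite_measure N"
    and add: "\<And>A B. A \<in> sets N \<Longrightarrow> B \<in> sets N \<Longrightarrow> A \<inter> B = {} \<Longrightarrow> m (A \<union> B) = m A + m B"
    and le: "\<And>A. A \<in> sets N \<Longrightarrow> norm (m A) \<le> measure N A"
  obtains f where "f \<in> borel_measurable N" "\<And>x. norm (f x) \<le> 1"
    "\<And>A. A \<in> sets N \<Longrightarrow> m A = (LINT x:A|N. f x)"
proof -
  interpret finite_measure N by fact
  have "\<exists>h. integrable N h \<and> (\<forall>A\<in>sets N. m A \<bullet> b = (LINT x:A|N. h x))" if "b \<in> Basis" for b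
  proof -
    \<comment> \<open>Adding \<open>N\<close> makes the coordinate nonnegative and at most twice
      \<open>N\<close>. The density of \<open>N\<close>, which is 1, is subtracted again at the
      end.\<close>
    define \<mu> where "\<mu> A = m A \<bullet> b + measure N A" for A
    have b: "\<bar>m A \<bullet> b\<bar> \<le> measure N A" if "A \<in> sets N" for A
      using Basis_le_norm[OF \<open>b \<in> Basis\<close>, of "m A"] le[OF that] by simp
    have \<mu>: "0 \<le> \<mu> A" "\<mu> A \<le> 2 * measure N A" if "A \<in> sets N" for A
      using b[OF that] by (auto simp: \<mu>_def)
    have "\<mu> (A \<union> B) = \<mu> A + \<mu> B" if "A \<in> sets N" "B \<in> sets N" "A \<inter> B = {}" for A B
      using that by (simp add: \<mu>_def add inner_add_left finite_measure_Union)
    with finite_measure_of_additive[OF fin, of \<mu> 2] \<mu>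
    obtain M where M: "sets M = sets N" "\<And>A. A \<in> sets N \<Longrightarrow> emeasure M A = ennreal (\<mu> A)"
      by metis
    have "absolutely_continuous N M"
    proof (unfold absolutely_continuous_def, rule subsetI)
      fix A assume "A \<in> null_sets N"
      then have "A \<in> sets N" "measure N A = 0"
        by (auto simp: null_sets_def measure_def)
      then show "A \<in> null_sets M"
        using b[of A] by (auto simp: null_sets_def M \<mu>_def)
    qed
    from Radon_Nikodym[OF this M(1)] obtain D
      where D [measurable]: "D \<in> borel_measurable N" and dens: "density N D = M" by blast
    have D_int: "(\<integral>\<^sup>+x. D x * indicator A x \<partial>N) = ennreal (\<mu> A)" if "A \<in> sets N" for A
      using that by (simp add: M(2)[symmetric] dens[symmetric] emeasure_density)
    have "(\<integral>\<^sup>+x. D x \<partial>N) = (\<integral>\<^sup>+x. D x * indicator (space N) x \<partial>N)"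
      by (intro nn_integral_cong) auto
    then have fin_D: "(\<integral>\<^sup>+x. D x \<partial>N) \<noteq> \<infinity>"
      using D_int[of "space N"] by simp
    have "AE x in N. D x \<noteq> \<infinity>"
      using nn_integral_PInf_AE[OF D fin_D] by simp
    then have ae: "AE x in N. ennreal (enn2real (D x)) = D x"
      by (rule AE_mp) (auto intro!: AE_I2 simp: less_top[symmetric])
    have "(\<integral>\<^sup>+x. ennreal (enn2real (D x)) \<partial>N) = (\<integral>\<^sup>+x. D x \<partial>N)"
      using ae by (intro nn_integral_cong_AE) auto
    then have int: "integrable N (\<lambda>x. enn2real (D x))"
      using fin_D by (intro integrableI_bounded) (auto simp: less_top[symmetric])
    have "m A \<bullet> b = (LINT x:A|N. enn2real (D x) - 1)" if A: "A \<in> sets N" for A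
    proof -
      have i: "set_integrable N A (\<lambda>x. enn2real (D x))" "set_integrable N A (\<lambda>x. 1 :: real)"
        using A int by (auto simp: set_integrable_def intro!: integrable_mult_indicator
            simp: integrable_indicator_iff emeasure_eq_measure
            simp del: real_scaleR_def)
      have "ennreal (LINT x:A|N. enn2real (D x)) = (\<integral>\<^sup>+x. ennreal (indicator A x * enn2real (D x)) \<partial>N)"
        unfolding set_lebesgue_integral_def using i
        by (subst nn_integral_eq_integral) (auto simp: set_integrable_def)
      also have "\<dots> = (\<integral>\<^sup>+x. D x * indicator A x \<partial>N)"
        using ae by (intro nn_integral_cong_AE) (auto simp: indicator_def)
      finally have "(LINT x:A|N. enn2real (D x)) = \<mu> A"
        using b[OF A] by (subst (asm) D_int[OF A])
          (auto simp: set_lebesgue_integral_def \<mu>_def intro!: integral_nonneg_AE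
            dest!: ennreal_inj[THEN iffD1, rotated -1])
      moreover have "(LINT x:A|N. 1 :: real) = measure N A"
        using A sets.sets_into_space[OF A] by (simp add: set_lebesgue_integral_def Int_absorb2)
      ultimately show ?thesis
        using i by (simp add: set_integral_diff \<mu>_def)
    qed
    then show ?thesis
      using int by (intro exI[of _ "\<lambda>x. enn2real (D x) - 1"]) auto
  qed
  then obtain h where h: "\<And>b. b \<in> Basis \<Longrightarrow> integrable N (h b)"
    "\<And>b A. b \<in> Basis \<Longrightarrow> A \<in> sets N \<Longrightarrow> m A \<bullet> b = (LINT x:A|N. h b x)"
    by metis
  define F where "F x = (\<Sum>b\<in>Basis. h b x *\<^sub>R b)" for x
  have F: "integrable N F"
    unfolding F_def using h by auto
  have mF: "m A = (LINT x:A|N. F x)" if "A \<in> sets N" for A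
  proof (rule euclidean_eqI)
    fix b :: 'b assume b: "b \<in> Basis"
    have "integrable N (\<lambda>x. indicator A x *\<^sub>R F x)"
      using F that by (intro integrable_mult_indicator)
    then have "(LINT x:A|N. F x) \<bullet> b = (LINT x:A|N. F x \<bullet> b)"
      using integral_inner_left[of b N "\<lambda>x. indicator A x *\<^sub>R F x"]
      by (simp add: set_lebesgue_integral_def)
    also have "\<dots> = m A \<bullet> b"
      using h(2)[OF b that] b by (simp add: F_def inner_sum_left inner_Basis if_distrib cong: if_cong)
    finally show "m A \<bullet> b = (LINT x:A|N. F x) \<bullet> b" ..
  qed
  have ae: "AE x in N. norm (F x) \<le> 1"
    using le mF by (intro AE_norm_le_1_of_set_integral_le[OF fin F]) simp
  \<comment> \<open>Replacing \<open>F\<close> by 0 on a null set makes the bound hold everywhere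
    without changing any integral.\<close>
  define f where "f x = (if norm (F x) \<le> 1 then F x else 0)" for x
  have [measurable]: "F \<in> borel_measurable N"
    using F by simp
  have f: "f \<in> borel_measurable N"
    unfolding f_def by measurable
  show thesis
  proof (rule that[OF f])
    show "norm (f x) \<le> 1" for x
      by (simp add: f_def)
    show "m A = (LINT x:A|N. f x)" if "A \<in> sets N" for A
      unfolding mF[OF that] set_lebesgue_integral_def using ae f that
      by (intro integral_cong_AE) (auto simp: f_def)
  qed
qed

section \<open>Vector measures given by densities\<close>

lemma set_integral_sums:
  fixes f :: "'a \<Rightarrow> 'b::{banach, second_countable_topology}"
  assumes f: "integrable N f" and A: "range A \<subseteq> sets N" "disjoint_family A"
  shows "(\<lambda>i. LINT x:A i|N. f x) sums (LINT x:(\<Union>i. A i)|N. f x)"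
proof -
  have i: "set_integrable N B f" if "B \<in> sets N" for B
    using f that unfolding set_integrable_def by (intro integrable_mult_indicator)
  have "(LINT x:(\<Union>i<n. A i)|N. f x) = (\<Sum>i<n. LINT x:A i|N. f x)" for n
    using A by (intro set_integral_finite_Union i) (auto simp: disjoint_family_on_def)
  moreover have "(\<lambda>n. LINT x:(\<Union>i<n. A i)|N. f x) \<longlonglongrightarrow> (LINT x:(\<Union>n. \<Union>i<n. A i)|N. f x)"
    using A by (intro set_integral_cont_up i) (auto simp: incseq_def, fastforce intro: less_le_trans)
  moreover have "(\<Union>n. \<Union>i<n. A i) = (\<Union>i. A i)"
    by auto
  ultimately show ?thesis
    by (simp add: sums_def)
qed

text \<open>Each term of a partition sum is at most the mass that the density
  \<open>norm (f x)\<close> gives to the piece; countable additivity of that scalar measure removes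
  the dependence on the partition.\<close>

lemma variation_density_le:
  fixes g :: "'a::euclidean_space set \<Rightarrow> 'b::euclidean_space"
  assumes sets: "sets N = sets (restrict_space borel \<Omega>)" and f: "integrable N f"
    and g: "\<And>A. A \<in> sets N \<Longrightarrow> g A = (LINT x:A|N. f x)"
  shows "variation \<Omega> g E \<le> (\<integral>\<^sup>+x\<in>E. norm (f x) \<partial>N)"
  unfolding variation_def
proof (rule SUP_least)
  fix A assume "A \<in> {A :: nat \<Rightarrow> 'a set. range A \<subseteq> sets (restrict_space borel \<Omega>) \<and>
                 disjoint_family A \<and> (\<Union>i. A i) = E}"
  then have A: "range A \<subseteq> sets N" "disjoint_family A" "(\<Union>i. A i) = E"
    by (auto simp: sets)
  have [measurable]: "f \<in> borel_measurable N"
    using f by simp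
  define M where "M = density N (\<lambda>x. ennreal (norm (f x)))"
  have "ennreal (norm (g (A i))) \<le> emeasure M (A i)" for i
  proof -
    have Ai: "A i \<in> sets N"
      using A by auto
    have "ennreal (norm (g (A i))) \<le> (\<integral>\<^sup>+x. norm (indicator (A i) x *\<^sub>R f x) \<partial>N)"
      unfolding g[OF Ai] set_lebesgue_integral_def
      using f Ai by (intro integral_norm_bound_ennreal integrable_mult_indicator)
    also have "\<dots> = emeasure M (A i)"
      using Ai by (simp add: M_def emeasure_density)
        (auto intro!: nn_integral_cong simp: indicator_def)
    finally show ?thesis .
  qed
  then have "(\<Sum>i. ennreal (norm (g (A i)))) \<le> (\<Sum>i. emeasure M (A i))"
    by (intro suminf_le) auto
  also have "\<dots> = emeasure M E"
    using suminf_emeasure[of A M] A by (simp add: M_def)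
  also have "\<dots> = (\<integral>\<^sup>+x\<in>E. norm (f x) \<partial>N)"
    using A by (auto simp: M_def emeasure_density)
  finally show "(\<Sum>i. ennreal (norm (g (A i)))) \<le> (\<integral>\<^sup>+x\<in>E. norm (f x) \<partial>N)" .
qed

lemma density_radon_measure:
  fixes f :: "'a::euclidean_space \<Rightarrow> 'b::euclidean_space"
  assumes sets: "sets N = sets (restrict_space borel \<Omega>)" and f: "integrable N f"
  shows "(\<lambda>A. if A \<in> sets N then (LINT x:A|N. f x) else 0) \<in> radon_measures \<Omega>"
proof -
  let ?g = "\<lambda>A :: 'a set. if A \<in> sets N then (LINT x:A|N. f x) else 0"
  have "variation \<Omega> ?g \<Omega> \<le> (\<integral>\<^sup>+x\<in>\<Omega>. norm (f x) \<partial>N)"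
    by (rule variation_density_le[OF sets f]) simp
  also have "\<dots> \<le> (\<integral>\<^sup>+x. norm (f x) \<partial>N)"
    by (intro nn_integral_mono) (auto simp: indicator_def)
  also have "\<dots> < \<infinity>"
    using f by (simp add: integrable_iff_bounded)
  finally have "variation \<Omega> ?g \<Omega> < \<infinity>" .
  moreover have "(\<lambda>i. ?g (A i)) sums ?g (\<Union>i. A i)"
    if "range A \<subseteq> sets (restrict_space borel \<Omega>)" "disjoint_family A" for A :: "nat \<Rightarrow> 'a set"
  proof -
    have "A i \<in> sets N" for i
      using that(1) by (auto simp: sets)
    then show ?thesis
      using set_integral_sums[OF f _ that(2)] by (simp add: image_subset_iff sets.countable_UN)
  qed
  ultimately show ?thesis
    unfolding radon_measures_def by (auto simp: sets)
qed

text \<open>\<open>ennreal (f x)\<close> is 0 where \<open>f\<close> is negative, so the right-hand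
  side has the positive part of \<open>f\<close> as its density.\<close>

lemma jordan_pos_density:
  fixes f :: "'a::euclidean_space \<Rightarrow> real"
  assumes sets: "sets N = sets (restrict_space borel \<Omega>)" and f: "integrable N f"
    and \<mu>: "\<And>A. A \<in> sets N \<Longrightarrow> \<mu> A = (LINT x:A|N. f x)"
  shows "jordan_pos \<Omega> \<mu> = density N (\<lambda>x. ennreal (f x))"
proof -
  have sp: "space N = \<Omega>"
    using sets by (drule_tac sets_eq_imp_space_eq) (simp add: space_restrict_space)
  have [measurable]: "f \<in> borel_measurable N"
    using f by simp
  define M where "M = density N (\<lambda>x. ennreal (f x))"
  have sM: "sets M = sets (restrict_space borel \<Omega>)"
    by (simp add: M_def sets)
  have eq: "(SUP F \<in> {F \<in> sets (restrict_space borel \<Omega>). F \<subseteq> E}. ennreal (\<mu> F)) = emeasure M E"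
    if "E \<in> sets (restrict_space borel \<Omega>)" for E
  proof (rule antisym)
    have E [measurable]: "E \<in> sets N"
      using that by (simp add: sets)
    show "(SUP F \<in> {F \<in> sets (restrict_space borel \<Omega>). F \<subseteq> E}. ennreal (\<mu> F)) \<le> emeasure M E"
    proof (rule SUP_least)
      fix F assume "F \<in> {F \<in> sets (restrict_space borel \<Omega>). F \<subseteq> E}"
      then have F [measurable]: "F \<in> sets N" "F \<subseteq> E"
        by (auto simp: sets)
      have int: "integrable N (\<lambda>x. indicator F x *\<^sub>R f x)"
        using F f by (intro integrable_mult_indicator) auto
      have "\<mu> F \<le> (\<integral>x. max 0 (indicator F x *\<^sub>R f x) \<partial>N)"
        unfolding \<mu>[OF F(1)] set_lebesgue_integral_def
        using int by (intro integral_mono) auto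
      then have "ennreal (\<mu> F) \<le> ennreal (\<integral>x. max 0 (indicator F x *\<^sub>R f x) \<partial>N)"
        by (rule ennreal_leI)
      also have "\<dots> = (\<integral>\<^sup>+x. ennreal (max 0 (indicator F x *\<^sub>R f x)) \<partial>N)"
        using int by (intro nn_integral_eq_integral[symmetric]) auto
      also have "\<dots> = emeasure M F"
        by (auto simp: M_def emeasure_density indicator_def max_def ennreal_neg intro!: nn_integral_cong)
      also have "\<dots> \<le> emeasure M E"
        using F(2) E by (intro emeasure_mono) (auto simp: M_def)
      finally show "ennreal (\<mu> F) \<le> emeasure M E" .
    qed
    \<comment> \<open>The part of \<open>E\<close> where the density is positive attains the
      supremum, as a Hahn set does.\<close>
    define P where "P = {x \<in> space N. x \<in> E \<and> 0 < f x}"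
    have P [measurable]: "P \<in> sets N"
      unfolding P_def by measurable
    have int: "integrable N (\<lambda>x. indicator P x *\<^sub>R f x)"
      using f by (intro integrable_mult_indicator) auto
    have "emeasure M E = (\<integral>\<^sup>+x. ennreal (indicator P x *\<^sub>R f x) \<partial>N)"
      using E by (auto simp: M_def emeasure_density P_def indicator_def ennreal_neg intro!: nn_integral_cong)
    also have "\<dots> = ennreal (\<mu> P)"
      unfolding \<mu>[OF P] set_lebesgue_integral_def
      using int by (intro nn_integral_eq_integral) (auto simp: P_def indicator_def)
    finally show "emeasure M E \<le> (SUP F \<in> {F \<in> sets (restrict_space borel \<Omega>). F \<subseteq> E}. ennreal (\<mu> F))"
      using P by (auto simp: sets P_def intro!: SUP_upper2[of P])
  qed
  have "space M = \<Omega>"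
    by (simp add: M_def sp)
  have "M = measure_of (space M) (sets M) (emeasure M)"
    by (rule measure_of_of_measure[symmetric])
  also have "\<dots> = jordan_pos \<Omega> \<mu>"
    unfolding jordan_pos_def \<open>space M = \<Omega>\<close> sM
    using sets.space_closed[of N] sets.sigma_sets_eq[of N]
    by (intro measure_of_eq) (auto simp: eq sp sets)
  finally show ?thesis
    by (simp add: M_def)
qed

lemma signed_integral_density:
  fixes f \<phi> :: "'a::euclidean_space \<Rightarrow> real"
  assumes sets: "sets N = sets (restrict_space borel \<Omega>)" and f: "integrable N f"
    and \<mu>: "\<And>A. A \<in> sets N \<Longrightarrow> \<mu> A = (LINT x:A|N. f x)"
    and \<phi>: "\<phi> \<in> borel_measurable N" "\<And>x. \<bar>\<phi> x\<bar> \<le> C"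
  shows "integrable N (\<lambda>x. \<phi> x * f x)" "signed_integral \<Omega> \<mu> \<phi> = (\<integral>x. \<phi> x * f x \<partial>N)"
proof -
  note \<phi>(1)[measurable]
  have [measurable]: "f \<in> borel_measurable N"
    using f by simp
  have C: "C \<ge> 0"
    using \<phi>(2)[of undefined] by linarith
  have int: "integrable N (\<lambda>x. h x *\<^sub>R \<phi> x)" if "h \<in> borel_measurable N" "\<And>x. \<bar>h x\<bar> \<le> \<bar>f x\<bar>" for h
  proof (rule Bochner_Integration.integrable_bound)
    show "integrable N (\<lambda>x. C * f x)"
      using f by simp
    show "AE x in N. norm (h x *\<^sub>R \<phi> x) \<le> norm (C * f x)"
      using \<phi>(2) that(2) C by (intro AE_I2) (auto simp: abs_mult mult.commute[of C] intro!: mult_mono)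
  qed (use that(1) in measurable)
  show "integrable N (\<lambda>x. \<phi> x * f x)"
    using int[of f] by (simp add: mult.commute)
  \<comment> \<open>The truncation hidden in \<open>ennreal\<close> is made explicit, since
    \<open>integral_density\<close> needs a nonnegative real density.\<close>
  have dens: "density N (\<lambda>x. ennreal (h x)) = density N (\<lambda>x. ennreal (max 0 (h x)))" for h
    by (intro arg_cong[where f = "density N"] ext) (simp add: max_def ennreal_neg)
  have "jordan_pos \<Omega> \<mu> = density N (\<lambda>x. ennreal (max 0 (f x)))"
    using jordan_pos_density[OF sets f \<mu>] dens by simp
  moreover have "jordan_pos \<Omega> (\<lambda>A. - \<mu> A) = density N (\<lambda>x. ennreal (max 0 (- f x)))"
    using jordan_pos_density[OF sets, of "\<lambda>x. - f x" "\<lambda>A. - \<mu> A"] f \<mu> dens[of "\<lambda>x. - f x"]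
    by (simp add: set_lebesgue_integral_def)
  ultimately have "signed_integral \<Omega> \<mu> \<phi> = (\<integral>x. max 0 (f x) *\<^sub>R \<phi> x \<partial>N) - (\<integral>x. max 0 (- f x) *\<^sub>R \<phi> x \<partial>N)"
    unfolding signed_integral_def by (simp add: integral_density)
  also have "\<dots> = (\<integral>x. max 0 (f x) *\<^sub>R \<phi> x - max 0 (- f x) *\<^sub>R \<phi> x \<partial>N)"
    by (intro Bochner_Integration.integral_diff[symmetric] int) auto
  also have "\<dots> = (\<integral>x. \<phi> x * f x \<partial>N)"
    by (intro Bochner_Integration.integral_cong) (auto simp: max_def)
  finally show "signed_integral \<Omega> \<mu> \<phi> = (\<integral>x. \<phi> x * f x \<partial>N)" .
qed

lemma vector_integral_density:
  fixes f \<phi> :: "'a::euclidean_space \<Rightarrow> 'b::euclidean_space"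
  assumes sets: "sets N = sets (restrict_space borel \<Omega>)" and f: "integrable N f"
    and g: "\<And>A. A \<in> sets N \<Longrightarrow> g A = (LINT x:A|N. f x)"
    and \<phi>: "\<phi> \<in> borel_measurable N" "\<And>x. norm (\<phi> x) \<le> C"
  shows "integrable N (\<lambda>x. \<phi> x \<bullet> f x)" "vector_integral \<Omega> g \<phi> = (\<integral>x. \<phi> x \<bullet> f x \<partial>N)"
proof -
  note \<phi>(1)[measurable]
  have *: "integrable N (\<lambda>x. (\<phi> x \<bullet> b) * (f x \<bullet> b))"
    "signed_integral \<Omega> (\<lambda>E. g E \<bullet> b) (\<lambda>x. \<phi> x \<bullet> b) = (\<integral>x. (\<phi> x \<bullet> b) * (f x \<bullet> b) \<partial>N)"
    if b: "b \<in> Basis" for b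
  proof -
    have gb: "g A \<bullet> b = (LINT x:A|N. f x \<bullet> b)" if "A \<in> sets N" for A
      using integral_inner_left[OF integrable_mult_indicator[OF that f], of b]
      by (simp add: g[OF that] set_lebesgue_integral_def)
    have \<phi>b: "\<bar>\<phi> x \<bullet> b\<bar> \<le> C" for x
      using Basis_le_norm[OF b, of "\<phi> x"] \<phi>(2)[of x] by simp
    have "integrable N (\<lambda>x. f x \<bullet> b)"
      using f by simp
    from signed_integral_density[OF sets this gb _ \<phi>b]
    show "integrable N (\<lambda>x. (\<phi> x \<bullet> b) * (f x \<bullet> b))"
      "signed_integral \<Omega> (\<lambda>E. g E \<bullet> b) (\<lambda>x. \<phi> x \<bullet> b) = (\<integral>x. (\<phi> x \<bullet> b) * (f x \<bullet> b) \<partial>N)"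
      by auto
  qed
  have eq: "(\<lambda>x. \<phi> x \<bullet> f x) = (\<lambda>x. \<Sum>b\<in>Basis. (\<phi> x \<bullet> b) * (f x \<bullet> b))"
    by (intro ext euclidean_inner)
  show "integrable N (\<lambda>x. \<phi> x \<bullet> f x)"
    unfolding eq by (intro Bochner_Integration.integrable_sum *(1))
  show "vector_integral \<Omega> g \<phi> = (\<integral>x. \<phi> x \<bullet> f x \<partial>N)"
    unfolding eq vector_integral_def
    by (subst Bochner_Integration.integral_sum) (auto intro: *(1) simp: *(2))
qed

section \<open>The variation of a vector measure is a measure\<close>

lemma suminf_commute_ennreal:
  fixes a :: "nat \<Rightarrow> nat \<Rightarrow> ennreal"
  shows "(\<Sum>i. \<Sum>j. a i j) = (\<Sum>j. \<Sum>i. a i j)"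
  using nn_integral_suminf[of "\<lambda>i j. a j i" "count_space UNIV"]
  by (simp add: nn_integral_count_space_nat)

section \<open>Additivity of vector measures and of their variation\<close>

lemma radon_measures_sums:
  assumes "g \<in> radon_measures \<Omega>" "range A \<subseteq> sets (restrict_space borel \<Omega>)" "disjoint_family A"
  shows "(\<lambda>i. g (A i)) sums g (\<Union>i. A i)"
  using assms unfolding radon_measures_def by blast

lemma radon_measures_empty:
  assumes "g \<in> radon_measures \<Omega>"
  shows "g {} = 0"
proof -
  have "(\<lambda>i::nat. g {}) sums g {}"
    using radon_measures_sums[OF assms, of "\<lambda>i. {}"] by (simp add: disjoint_family_on_def)
  then have "(\<lambda>i::nat. g {}) \<longlonglongrightarrow> 0"
    using summable_LIMSEQ_zero sums_summable by blast
  then show ?thesis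
    by (simp add: LIMSEQ_const_iff)
qed

lemma disjoint_family_binaryset: "A \<inter> B = {} \<Longrightarrow> disjoint_family (binaryset A B)"
  by (auto simp: disjoint_family_on_def binaryset_def)

lemma radon_measures_Un:
  assumes g: "g \<in> radon_measures \<Omega>"
    and AB: "A \<in> sets (restrict_space borel \<Omega>)" "B \<in> sets (restrict_space borel \<Omega>)" "A \<inter> B = {}"
  shows "g (A \<union> B) = g A + g B"
proof -
  have "(\<lambda>i. g (binaryset A B i)) sums g (\<Union>i. binaryset A B i)"
    using AB by (intro radon_measures_sums[OF g] disjoint_family_binaryset)
      (simp_all add: range_binaryset_eq)
  then have "(\<lambda>i. g (binaryset A B i)) sums g (A \<union> B)"
    by (simp only: UN_binaryset_eq)
  moreover have "(\<lambda>i. g (binaryset A B i)) sums (g A + g B)"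
    by (rule binaryset_sums) (rule radon_measures_empty[OF g])
  ultimately show ?thesis
    by (rule sums_unique2)
qed

lemma variation_upper:
  assumes "range A \<subseteq> sets (restrict_space borel \<Omega>)" "disjoint_family A" "(\<Union>i. A i) = E"
  shows "(\<Sum>i. ennreal (norm (g (A i)))) \<le> variation \<Omega> g E"
  unfolding variation_def using assms by (intro SUP_upper) blast

lemma norm_le_variation:
  assumes "g {} = 0" "E \<in> sets (restrict_space borel \<Omega>)"
  shows "ennreal (norm (g E)) \<le> variation \<Omega> g E"
proof -
  have "(\<Sum>i. ennreal (norm (g (binaryset E {} i)))) \<le> variation \<Omega> g E"
  proof (rule variation_upper)
    show "range (binaryset E {}) \<subseteq> sets (restrict_space borel \<Omega>)"
      using assms(2) by (simp add: range_binaryset_eq)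
    show "disjoint_family (binaryset E {})"
      by (rule disjoint_family_binaryset) simp
    show "(\<Union>i. binaryset E {} i) = E"
      by (simp only: UN_binaryset_eq Un_empty_right)
  qed
  also have "(\<Sum>i. ennreal (norm (g (binaryset E {} i)))) = ennreal (norm (g E)) + ennreal (norm (g {}))"
    by (rule suminf_binaryset_eq) (simp add: assms(1))
  finally show ?thesis
    by (simp add: assms(1))
qed

text \<open>A partition of \<open>E\<close> and one of \<open>F\<close> are interleaved, even
  indices for one and odd for the other, into a partition of the union. The two suprema are then
  taken independently.\<close>

lemma variation_superadditive:
  assumes "E \<in> sets (restrict_space borel \<Omega>)" "F \<in> sets (restrict_space borel \<Omega>)" "E \<inter> F = {}"
  shows "variation \<Omega> g E + variation \<Omega> g F \<le> variation \<Omega> g (E \<union> F)"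
proof -
  define P where "P E = {A :: nat \<Rightarrow> 'a set. range A \<subseteq> sets (restrict_space borel \<Omega>) \<and>
      disjoint_family A \<and> (\<Union>i. A i) = E}" for E
  let ?s = "\<lambda>A. \<Sum>i. ennreal (norm (g (A i)))"
  have var: "variation \<Omega> g E = (SUP A\<in>P E. ?s A)" for E
    unfolding variation_def P_def ..
  have ne: "P E \<noteq> {}" if "E \<in> sets (restrict_space borel \<Omega>)" for E
  proof -
    have "binaryset E {} \<in> P E"
      using that unfolding P_def mem_Collect_eq range_binaryset_eq UN_binaryset_eq
      by (simp add: disjoint_family_binaryset)
    then show ?thesis
      by blast
  qed
  have "?s A + ?s B \<le> variation \<Omega> g (E \<union> F)" if "A \<in> P E" "B \<in> P F" for A B
  proof -
    define C where "C i = (if even i then A (i div 2) else B (i div 2))" for i :: nat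
    have A: "range A \<subseteq> sets (restrict_space borel \<Omega>)" "disjoint_family A" "(\<Union>i. A i) = E"
      and B: "range B \<subseteq> sets (restrict_space borel \<Omega>)" "disjoint_family B" "(\<Union>i. B i) = F"
      using that by (auto simp: P_def)
    have "C (2 * i) = A i" "C (Suc (2 * i)) = B i" for i
      by (auto simp: C_def)
    \<comment> \<open>Only partial sums of even length are compared; they already bound both series
      in the limit.\<close>
    then have sum: "(\<Sum>i<2 * n. ennreal (norm (g (C i)))) =
        (\<Sum>i<n. ennreal (norm (g (A i)))) + (\<Sum>i<n. ennreal (norm (g (B i))))" for n
      by (induction n) (simp_all add: algebra_simps)
    have "?s C \<le> variation \<Omega> g (E \<union> F)"
    proof (rule variation_upper)
      show "range C \<subseteq> sets (restrict_space borel \<Omega>)"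
        using A(1) B(1) by (auto simp: C_def)
      have AB: "A i \<inter> B j = {}" "B j \<inter> A i = {}" for i j
        using A(3) B(3) assms(3) by blast+
      show "disjoint_family C"
        unfolding disjoint_family_on_def
      proof (intro ballI impI)
        fix i j :: nat assume "i \<noteq> j"
        have "i div 2 \<noteq> j div 2" if "even i \<longleftrightarrow> even j"
          using that \<open>i \<noteq> j\<close> by presburger
        then show "C i \<inter> C j = {}"
          using disjoint_family_onD[OF A(2), of "i div 2" "j div 2"]
            disjoint_family_onD[OF B(2), of "i div 2" "j div 2"] AB
          by (cases "even i"; cases "even j") (simp_all add: C_def)
      qed
      show "(\<Union>i. C i) = E \<union> F"
      proof -
        have "C i \<subseteq> E \<union> F" for i
          using A(3) B(3) by (auto simp: C_def)
        moreover have "A i \<subseteq> (\<Union>i. C i)" "B i \<subseteq> (\<Union>i. C i)" for i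
          using \<open>C (2 * i) = A i\<close> \<open>C (Suc (2 * i)) = B i\<close> by blast+
        ultimately show ?thesis
          using A(3) B(3) by blast
      qed
    qed
    moreover have "?s A + ?s B \<le> ?s C"
    proof (rule LIMSEQ_le_const2)
      show "(\<lambda>n. (\<Sum>i<n. ennreal (norm (g (A i)))) + (\<Sum>i<n. ennreal (norm (g (B i))))) \<longlonglongrightarrow> ?s A + ?s B"
        by (intro tendsto_add summable_LIMSEQ) auto
      show "\<exists>N. \<forall>n\<ge>N. (\<Sum>i<n. ennreal (norm (g (A i)))) + (\<Sum>i<n. ennreal (norm (g (B i)))) \<le> ?s C"
        unfolding sum[symmetric] by (intro exI allI impI sum_le_suminf) simp_all
    qed
    ultimately show ?thesis
      by simp
  qed
  then have "(SUP A\<in>P E. SUP B\<in>P F. ?s A + ?s B) \<le> variation \<Omega> g (E \<union> F)"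
    by (intro SUP_least)
  also have "(SUP A\<in>P E. SUP B\<in>P F. ?s A + ?s B) = (SUP A\<in>P E. ?s A + (SUP B\<in>P F. ?s B))"
    by (intro SUP_cong refl ennreal_SUP_add_right[symmetric] ne assms(2))
  also have "\<dots> = variation \<Omega> g E + variation \<Omega> g F"
    unfolding var[of E] var[of F] by (rule ennreal_SUP_add_left[OF ne[OF assms(1)]])
  finally show ?thesis .
qed

text \<open>Any partition \<open>B\<close> of the union is refined by the sets \<open>A i\<close>.
  Countable additivity of \<open>g\<close> and the triangle inequality bound each
  \<open>norm (g (B j))\<close> by its refined row; after exchanging the sums, the pieces of each
  \<open>A i\<close> form a partition of \<open>A i\<close>.\<close>

lemma variation_countably_subadditive:
  assumes g: "g \<in> radon_measures \<Omega>"
    and A: "range A \<subseteq> sets (restrict_space borel \<Omega>)" "disjoint_family A"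
  shows "variation \<Omega> g (\<Union>i. A i) \<le> (\<Sum>i. variation \<Omega> g (A i))"
  unfolding variation_def[of \<Omega> g "\<Union>i. A i"]
proof (rule SUP_least)
  fix B assume "B \<in> {B :: nat \<Rightarrow> 'a set. range B \<subseteq> sets (restrict_space borel \<Omega>) \<and>
      disjoint_family B \<and> (\<Union>i. B i) = (\<Union>i. A i)}"
  then have B: "range B \<subseteq> sets (restrict_space borel \<Omega>)" "disjoint_family B" "(\<Union>i. B i) = (\<Union>i. A i)"
    by auto
  have AB: "A i \<inter> B j \<in> sets (restrict_space borel \<Omega>)" for i j
    using A(1) B(1) by (intro sets.Int) auto
  have "ennreal (norm (g (B j))) \<le> (\<Sum>i. ennreal (norm (g (A i \<inter> B j))))" for j
  proof -
    have "(\<lambda>i. g (A i \<inter> B j)) sums g (\<Union>i. A i \<inter> B j)"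
      using A AB by (intro radon_measures_sums[OF g]) (auto simp: disjoint_family_on_def)
    moreover have "(\<Union>i. A i \<inter> B j) = B j"
      using B(3) by auto
    ultimately have "(\<lambda>n. \<Sum>i<n. g (A i \<inter> B j)) \<longlonglongrightarrow> g (B j)"
      by (simp add: sums_def)
    then have "(\<lambda>n. ennreal (norm (\<Sum>i<n. g (A i \<inter> B j)))) \<longlonglongrightarrow> ennreal (norm (g (B j)))"
      by (intro tendsto_ennrealI tendsto_norm)
    then show ?thesis
    proof (rule LIMSEQ_le_const2, intro exI allI impI)
      fix n
      have "ennreal (norm (\<Sum>i<n. g (A i \<inter> B j))) \<le> ennreal (\<Sum>i<n. norm (g (A i \<inter> B j)))"
        by (intro ennreal_leI norm_sum)
      also have "\<dots> = (\<Sum>i<n. ennreal (norm (g (A i \<inter> B j))))"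
        by simp
      also have "\<dots> \<le> (\<Sum>i. ennreal (norm (g (A i \<inter> B j))))"
        by (intro sum_le_suminf) auto
      finally show "ennreal (norm (\<Sum>i<n. g (A i \<inter> B j))) \<le> (\<Sum>i. ennreal (norm (g (A i \<inter> B j))))" .
    qed
  qed
  then have "(\<Sum>j. ennreal (norm (g (B j)))) \<le> (\<Sum>j. \<Sum>i. ennreal (norm (g (A i \<inter> B j))))"
    by (intro suminf_le) auto
  also have "\<dots> = (\<Sum>i. \<Sum>j. ennreal (norm (g (A i \<inter> B j))))"
    by (rule suminf_commute_ennreal)
  also have "\<dots> \<le> (\<Sum>i. variation \<Omega> g (A i))"
  proof (intro suminf_le variation_upper allI)
    show "disjoint_family (\<lambda>j. A i \<inter> B j)" for i
      using B(2) by (auto simp: disjoint_family_on_def)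
    show "(\<Union>j. A i \<inter> B j) = A i" for i
      using B(3) by auto
  qed (use AB in auto)
  finally show "(\<Sum>j. ennreal (norm (g (B j)))) \<le> (\<Sum>i. variation \<Omega> g (A i))" .
qed

lemma variation_mono:
  assumes "E \<in> sets (restrict_space borel \<Omega>)" "F \<in> sets (restrict_space borel \<Omega>)" "E \<subseteq> F"
  shows "variation \<Omega> g E \<le> variation \<Omega> g F"
proof -
  have "variation \<Omega> g E \<le> variation \<Omega> g E + variation \<Omega> g (F - E)"
    by simp
  also have "\<dots> \<le> variation \<Omega> g (E \<union> (F - E))"
    using assms by (intro variation_superadditive) auto
  also have "E \<union> (F - E) = F"
    using assms(3) by auto
  finally show ?thesis .
qed

text \<open>Countable additivity comes from two opposite inequalities: superadditivity bounds every
  finite partial sum, and subadditivity bounds the union. The last conclusion supplies the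
  domination from which densities are obtained.\<close>

lemma variation_measure:
  assumes g: "g \<in> radon_measures \<Omega>" and \<Omega>: "\<Omega> \<in> sets borel"
  obtains V where "sets V = sets (restrict_space borel \<Omega>)" "finite_measure V"
    "\<And>E. E \<in> sets V \<Longrightarrow> emeasure V E = variation \<Omega> g E"
    "\<And>E. E \<in> sets V \<Longrightarrow> norm (g E) \<le> measure V E"
proof -
  let ?B = "restrict_space borel \<Omega>"
  have sp: "space ?B = \<Omega>"
    by (simp add: space_restrict_space)
  define V where "V = measure_of (space ?B) (sets ?B) (variation \<Omega> g)"
  have sV: "sets V = sets ?B"
    by (simp add: V_def)
  have "variation \<Omega> g {} \<le> (\<Sum>i::nat. 0)"
    unfolding variation_def
  proof (rule SUP_least)
    fix A assume "A \<in> {A :: nat \<Rightarrow> 'a set. range A \<subseteq> sets (restrict_space borel \<Omega>) \<and>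
        disjoint_family A \<and> (\<Union>i. A i) = {}}"
    then have "A i = {}" for i
      by auto
    then show "(\<Sum>i. ennreal (norm (g (A i)))) \<le> (\<Sum>i::nat. 0)"
      by (simp add: radon_measures_empty[OF g])
  qed
  then have pos: "positive (sets ?B) (variation \<Omega> g)"
    by (simp add: positive_def)
  have "countably_additive (sets ?B) (variation \<Omega> g)"
    unfolding countably_additive_def
  proof (intro allI impI)
    fix A :: "nat \<Rightarrow> 'a set"
    assume A: "range A \<subseteq> sets ?B" "disjoint_family A" "\<Union> (range A) \<in> sets ?B"
    have "(\<Sum>i<n. variation \<Omega> g (A i)) \<le> variation \<Omega> g (\<Union>i<n. A i)" for n
    proof (induction n)
      case (Suc n)
      have "(\<Sum>i<Suc n. variation \<Omega> g (A i)) \<le> variation \<Omega> g (\<Union>i<n. A i) + variation \<Omega> g (A n)"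
        using Suc by (simp add: add_right_mono)
      also have "\<dots> \<le> variation \<Omega> g ((\<Union>i<n. A i) \<union> A n)"
      proof (rule variation_superadditive)
        show "(\<Union>i<n. A i) \<inter> A n = {}"
        proof -
          have "A i \<inter> A n = {}" if "i < n" for i
            using that disjoint_family_onD[OF A(2), of i n] by simp
          then show ?thesis
            by blast
        qed
      qed (use A(1) in auto)
      also have "(\<Union>i<n. A i) \<union> A n = (\<Union>i<Suc n. A i)"
        by (auto simp: lessThan_Suc)
      finally show ?case .
    qed simp
    also have "variation \<Omega> g (\<Union>i<n. A i) \<le> variation \<Omega> g (\<Union>i. A i)" for n
      using A by (intro variation_mono) auto
    finally have "(\<Sum>i. variation \<Omega> g (A i)) \<le> variation \<Omega> g (\<Union>i. A i)"
      by (intro suminf_le_const) auto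
    then show "(\<Sum>i. variation \<Omega> g (A i)) = variation \<Omega> g (\<Union>i. A i)"
      using variation_countably_subadditive[OF g A(1,2)] by simp
  qed
  then have V: "emeasure V E = variation \<Omega> g E" if "E \<in> sets ?B" for E
    unfolding V_def by (rule emeasure_measure_of_sigma[OF sets.sigma_algebra_axioms pos _ that])
  have "space V = \<Omega>"
    using sets_eq_imp_space_eq[OF sV] sp by simp
  moreover have "\<Omega> \<in> sets ?B"
    using sets.top[of ?B] by (simp add: sp)
  ultimately have fin: "finite_measure V"
    using g V[of \<Omega>] by (intro finite_measureI) (auto simp: radon_measures_def)
  then interpret V: finite_measure V .
  have "norm (g E) \<le> measure V E" if "E \<in> sets V" for E
  proof -
    have "ennreal (norm (g E)) \<le> emeasure V E"
      using norm_le_variation[of g E \<Omega>, OF radon_measures_empty[OF g]] V[of E] that by (simp add: sV)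
    then show ?thesis
      by (simp add: V.emeasure_eq_measure)
  qed
  then show ?thesis
    using that[OF sV fin] V by (simp add: sV)
qed

section \<open>Bounded functionals on test fields\<close>

text \<open>Only linearity is assumed of \<open>T\<close>. Bounds enter as hypotheses of single
  lemmas, so the set functions built from \<open>T\<close> may be infinite before that.\<close>

locale test_functional =
  fixes \<Omega> :: "'a::euclidean_space set" and T :: "('a \<Rightarrow> 'a) \<Rightarrow> real"
  assumes open_domain: "open \<Omega>"
    and T_add: "\<phi> \<in> test_fields \<Omega> \<Longrightarrow> \<psi> \<in> test_fields \<Omega> \<Longrightarrow> T (\<lambda>x. \<phi> x + \<psi> x) = T \<phi> + T \<psi>"
    and T_scaleR: "\<phi> \<in> test_fields \<Omega> \<Longrightarrow> T (\<lambda>x. c *\<^sub>R \<phi> x) = c * T \<phi>"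
begin

lemma T_zero: "T (\<lambda>x. 0) = 0"
  using T_scaleR[of "\<lambda>x. 0" 0] by simp

lemma T_diff:
  "\<phi> \<in> test_fields \<Omega> \<Longrightarrow> \<psi> \<in> test_fields \<Omega> \<Longrightarrow> T (\<lambda>x. \<phi> x - \<psi> x) = T \<phi> - T \<psi>"
  using T_add[of \<phi> "\<lambda>x. (-1) *\<^sub>R \<psi> x"] T_scaleR[of \<psi> "-1"] test_fields_uminus[of \<psi> \<Omega>] by simp

lemma T_sum:
  assumes "finite I" "\<And>i. i \<in> I \<Longrightarrow> \<phi> i \<in> test_fields \<Omega>"
  shows "(\<lambda>x. \<Sum>i\<in>I. \<phi> i x) \<in> test_fields \<Omega> \<and> T (\<lambda>x. \<Sum>i\<in>I. \<phi> i x) = (\<Sum>i\<in>I. T (\<phi> i))"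
  using assms by (induction I rule: finite_induct) (auto simp: T_zero T_add test_fields_add)

text \<open>
  The admissible field \<open>\<phi> = 0\<close> makes the truncation of negative values by \<open>ennreal\<close> harmless.
\<close>

definition size :: "'a set \<Rightarrow> ennreal" where
  "size U = (SUP \<phi>\<in>{\<phi> \<in> test_fields U. \<forall>x. norm (\<phi> x) \<le> 1}. ennreal (T \<phi>))"

lemma size_upper: "\<phi> \<in> test_fields U \<Longrightarrow> (\<And>x. norm (\<phi> x) \<le> 1) \<Longrightarrow> ennreal (T \<phi>) \<le> size U"
  unfolding size_def by (intro SUP_upper) auto

lemma size_mono: "U \<subseteq> V \<Longrightarrow> size U \<le> size V"
  unfolding size_def by (intro SUP_subset_mono) (auto intro: test_fields_mono)

lemma size_empty: "size {} = 0"
proof -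
  have "T \<phi> = 0" if "\<phi> \<in> test_fields {}" for \<phi>
  proof -
    have "\<phi> = (\<lambda>x. 0)"
      using test_fieldsD(5)[OF that] by auto
    then show ?thesis
      by (simp add: T_zero)
  qed
  then have "size {} \<le> 0"
    unfolding size_def by (intro SUP_least) auto
  then show ?thesis
    by simp
qed

lemma le_size:
  assumes "\<phi> \<in> test_fields U" "U \<subseteq> \<Omega>" "\<And>x. norm (\<phi> x) \<le> a"
  shows "ennreal (T \<phi>) \<le> ennreal a * size U"
proof (cases "a > 0")
  case True
  let ?\<psi> = "\<lambda>x. (1 / a) *\<^sub>R \<phi> x"
  have "?\<psi> \<in> test_fields U"
    using assms(1) by (rule test_fields_scaleR)
  moreover have "norm (?\<psi> x) \<le> 1" for x
    using assms(3)[of x] True by (simp add: field_simps)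
  ultimately have le: "ennreal (T ?\<psi>) \<le> size U"
    by (rule size_upper)
  have "T \<phi> = a * T ?\<psi>"
    using T_scaleR[OF test_fields_mono[OF assms(2,1)], of "1 / a"] True by simp
  then have "ennreal (T \<phi>) = ennreal a * ennreal (T ?\<psi>)"
    using True by (simp only: ennreal_mult' less_imp_le)
  also have "\<dots> \<le> ennreal a * size U"
    by (intro mult_left_mono le) simp
  finally show ?thesis .
next
  case False
  then have "\<phi> x = 0" for x
    using order_trans[OF norm_ge_zero assms(3)[of x]] assms(3)[of x] by simp
  then have "\<phi> = (\<lambda>x. 0)"
    by auto
  then show ?thesis
    by (simp add: T_zero)
qed

lemma ennreal_add_le: "ennreal (a + b) \<le> ennreal a + ennreal b"
proof -
  have "ennreal (a + b) \<le> ennreal (max 0 a + max 0 b)"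
    by (intro ennreal_leI) auto
  also have "\<dots> = ennreal (max 0 a) + ennreal (max 0 b)"
    by (intro ennreal_plus) auto
  also have "\<dots> = ennreal a + ennreal b"
    by (simp add: max_def ennreal_neg)
  finally show ?thesis .
qed

text \<open>A partition of unity built one set at a time. Multiplying by cutoffs never increases the
  norm, so the bound \<open>a i\<close> valid on \<open>V i\<close> survives the splitting. Separate
  weights, rather than a common bound, are what later allows a comparison with an integral.\<close>

lemma le_size_cover:
  assumes "finite I"
  shows "\<lbrakk>\<And>i. i \<in> I \<Longrightarrow> open (V i); \<And>i. i \<in> I \<Longrightarrow> V i \<subseteq> \<Omega>; \<psi> \<in> test_fields (\<Union>i\<in>I. V i);
    \<And>i x. i \<in> I \<Longrightarrow> x \<in> V i \<Longrightarrow> norm (\<psi> x) \<le> a i; \<And>i. i \<in> I \<Longrightarrow> 0 \<le> a i\<rbrakk>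
    \<Longrightarrow> ennreal (T \<psi>) \<le> (\<Sum>i\<in>I. ennreal (a i) * size (V i))"
  using assms
proof (induction I arbitrary: \<psi> rule: finite_induct)
  case empty
  then have \<psi>: "\<psi> \<in> test_fields {}"
    by simp
  have "ennreal (T \<psi>) \<le> ennreal 1 * size {}"
    using \<psi> test_fieldsD(5)[OF \<psi>] by (intro le_size) auto
  then show ?case
    by (simp add: size_empty)
next
  case (insert j I)
  define U where "U = (\<Union>i\<in>I. V i)"
  define C where "C = closure {x. \<psi> x \<noteq> 0}"
  have C: "compact C" "C \<subseteq> V j \<union> U" "{x. \<psi> x \<noteq> 0} \<subseteq> C"
    using test_fieldsD(2-4)[OF insert.prems(3)] by (auto simp: C_def U_def)
  have "open U" "open (V j)" "U \<subseteq> \<Omega>" "V j \<subseteq> \<Omega>"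
    using insert.prems(1,2) by (auto simp: U_def)
  \<comment> \<open>The part of the support that \<open>V j\<close> misses is compact inside
    \<open>U\<close>. A cutoff equal to 1 near it leaves the remainder \<open>\<psi>2\<close>
    supported in the compact set \<open>C - W\<close>, which lies in \<open>V j\<close>.\<close>
  have "compact (C - V j)"
    using C(1) \<open>open (V j)\<close> by (rule compact_diff)
  moreover have "C - V j \<subseteq> U"
    using C(2) by auto
  ultimately obtain \<eta> W where \<eta>: "\<eta> \<in> cutoffs U" and W: "open W" "C - V j \<subseteq> W" "\<And>x. x \<in> W \<Longrightarrow> \<eta> x = 1"
    using cutoff_exists[OF _ \<open>open U\<close>, of "C - V j"] by blast
  note \<eta>' = cutoffD[OF \<eta>]
  define \<psi>1 where "\<psi>1 x = \<eta> x *\<^sub>R \<psi> x" for x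
  define \<psi>2 where "\<psi>2 x = (1 - \<eta> x) *\<^sub>R \<psi> x" for x
  have \<psi>1: "\<psi>1 \<in> test_fields U"
    unfolding \<psi>1_def using \<eta> test_fieldsD(1)[OF insert.prems(3)] by (rule cutoff_scaleR_test_field)
  have \<psi>2: "\<psi>2 \<in> test_fields (V j)"
  proof (rule test_fieldsI)
    show "smooth \<psi>2"
      unfolding \<psi>2_def
      using smooth_one_minus[OF \<eta>'(1)] test_fieldsD(1)[OF insert.prems(3)]
      by (simp add: times_continuously_differentiable_scaleR)
    show "compact (C - W)"
      using C(1) W(1) by (rule compact_diff)
    show "C - W \<subseteq> V j"
      using W(2) by auto
    show "{x. \<psi>2 x \<noteq> 0} \<subseteq> C - W"
      using C(3) W(3) by (auto simp: \<psi>2_def)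
  qed
  have le1: "norm (\<psi>1 x) \<le> norm (\<psi> x)" and le2: "norm (\<psi>2 x) \<le> norm (\<psi> x)" for x
    using \<eta>'(2,3)[of x] by (auto simp: \<psi>1_def \<psi>2_def intro!: mult_left_le_one_le)
  have "T \<psi> = T \<psi>2 + T \<psi>1"
    using T_add[OF test_fields_mono[OF \<open>V j \<subseteq> \<Omega>\<close> \<psi>2] test_fields_mono[OF \<open>U \<subseteq> \<Omega>\<close> \<psi>1]]
    by (simp add: \<psi>1_def \<psi>2_def algebra_simps)
  then have "ennreal (T \<psi>) \<le> ennreal (T \<psi>2) + ennreal (T \<psi>1)"
    using ennreal_add_le by simp
  also have "\<dots> \<le> ennreal (a j) * size (V j) + (\<Sum>i\<in>I. ennreal (a i) * size (V i))"
  proof (rule add_mono)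
    have "norm (\<psi>2 x) \<le> a j" for x
      using order_trans[OF le2 insert.prems(4)[of j x]] insert.prems(5)[of j] test_fieldsD(5)[OF \<psi>2]
      by (cases "x \<in> V j") auto
    then show "ennreal (T \<psi>2) \<le> ennreal (a j) * size (V j)"
      by (intro le_size \<psi>2 \<open>V j \<subseteq> \<Omega>\<close>)
    show "ennreal (T \<psi>1) \<le> (\<Sum>i\<in>I. ennreal (a i) * size (V i))"
    proof (rule insert.IH)
      show "\<psi>1 \<in> test_fields (\<Union>i\<in>I. V i)"
        using \<psi>1 by (simp add: U_def)
      show "norm (\<psi>1 x) \<le> a i" if "i \<in> I" "x \<in> V i" for i x
        using order_trans[OF le1 insert.prems(4)[of i x]] that by auto
    qed (use insert.prems in auto)
  qed
  finally show ?case
    using insert.hyps by simp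
qed

lemma size_countably_subadditive:
  fixes V :: "nat \<Rightarrow> 'a set"
  assumes "\<And>i. open (V i)" "\<And>i. V i \<subseteq> \<Omega>"
  shows "size (\<Union>i. V i) \<le> (\<Sum>i. size (V i))"
  unfolding size_def[of "\<Union>i. V i"]
proof (rule SUP_least)
  fix \<phi> assume "\<phi> \<in> {\<phi> \<in> test_fields (\<Union>i. V i). \<forall>x. norm (\<phi> x) \<le> 1}"
  then have \<phi>: "\<phi> \<in> test_fields (\<Union>i. V i)" "\<And>x. norm (\<phi> x) \<le> 1"
    by auto
  obtain I where I: "finite I" "closure {x. \<phi> x \<noteq> 0} \<subseteq> (\<Union>i\<in>I. V i)"
    using compactE_image[OF test_fieldsD(2)[OF \<phi>(1)], of UNIV V] test_fieldsD(3)[OF \<phi>(1)] assms(1)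
    by metis
  have "\<phi> \<in> test_fields (\<Union>i\<in>I. V i)"
    using I(2) \<phi>(1) by (simp add: test_fields_def)
  then have "ennreal (T \<phi>) \<le> (\<Sum>i\<in>I. ennreal 1 * size (V i))"
    using assms I(1) \<phi>(2) by (intro le_size_cover[where a = "\<lambda>_. 1"]) auto
  also have "\<dots> \<le> (\<Sum>i. size (V i))"
    using I(1) by (simp add: sum_le_suminf)
  finally show "ennreal (T \<phi>) \<le> (\<Sum>i. size (V i))" .
qed

section \<open>From the values on open sets to a Borel measure, by Caratheodory's
  construction\<close>

definition outer :: "'a set \<Rightarrow> ennreal" where
  "outer E = (INF U\<in>{U. open U \<and> E \<subseteq> U \<and> U \<subseteq> \<Omega>}. size U)"

lemma outer_open: "open U \<Longrightarrow> U \<subseteq> \<Omega> \<Longrightarrow> outer U = size U"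
  unfolding outer_def by (intro antisym INF_lower INF_greatest size_mono) auto

lemma outer_lower: "open U \<Longrightarrow> E \<subseteq> U \<Longrightarrow> U \<subseteq> \<Omega> \<Longrightarrow> outer E \<le> size U"
  unfolding outer_def by (intro INF_lower) auto

lemma outer_mono: "E \<subseteq> F \<Longrightarrow> outer E \<le> outer F"
  unfolding outer_def by (intro INF_superset_mono) auto

lemma outer_empty: "outer {} = 0"
  using outer_open[of "{}"] by (simp add: size_empty)

lemma outer_measure_space_outer: "outer_measure_space (Pow \<Omega>) outer"
  unfolding outer_measure_space_def
proof (intro conjI)
  show "positive (Pow \<Omega>) outer"
    by (simp add: positive_def outer_empty)
  show "increasing (Pow \<Omega>) outer"
    by (simp add: increasing_def outer_mono)
  show "countably_subadditive (Pow \<Omega>) outer"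
    unfolding countably_subadditive_def
  proof (intro allI impI)
    fix A :: "nat \<Rightarrow> 'a set"
    assume A: "range A \<subseteq> Pow \<Omega>"
    show "outer (\<Union>i. A i) \<le> (\<Sum>i. outer (A i))"
    proof (rule ennreal_le_epsilon)
      fix e :: real
      assume e: "0 < e" and fin: "(\<Sum>i. outer (A i)) < top"
      have "\<exists>V. open V \<and> A i \<subseteq> V \<and> V \<subseteq> \<Omega> \<and> size V \<le> outer (A i) + ennreal (e * (1 / 2) ^ Suc i)" for i
      proof -
        have "outer (A i) \<noteq> \<infinity>"
          using ennreal_suminf_lessD[OF fin, of i] by simp
        have "\<exists>V\<in>{U. open U \<and> A i \<subseteq> U \<and> U \<subseteq> \<Omega>}. size V < outer (A i) + ennreal (e * (1 / 2) ^ Suc i)"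
          by (rule INF_approx_ennreal[OF _ outer_def \<open>outer (A i) \<noteq> \<infinity>\<close>]) (use e in simp)
        then show ?thesis
          by (auto intro: less_imp_le)
      qed
      then obtain V where V: "\<And>i. open (V i)" "\<And>i. A i \<subseteq> V i" "\<And>i. V i \<subseteq> \<Omega>"
        "\<And>i. size (V i) \<le> outer (A i) + ennreal (e * (1 / 2) ^ Suc i)"
        by metis
      have "outer (\<Union>i. A i) \<le> size (\<Union>i. V i)"
      proof (rule outer_lower)
        show "open (\<Union>i. V i)"
          using V(1) by blast
        show "(\<Union>i. A i) \<subseteq> (\<Union>i. V i)"
          using V(2) by blast
        show "(\<Union>i. V i) \<subseteq> \<Omega>"
          using V(3) by blast
      qed
      also have "\<dots> \<le> (\<Sum>i. size (V i))"
        using V by (intro size_countably_subadditive)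
      also have "\<dots> \<le> (\<Sum>i. outer (A i) + ennreal (e * (1 / 2) ^ Suc i))"
        using V(4) by (intro suminf_le) auto
      also have "\<dots> = (\<Sum>i. outer (A i)) + (\<Sum>i. ennreal (e * (1 / 2) ^ Suc i))"
        by (rule suminf_add[symmetric]) auto
      also have "(\<Sum>i. ennreal (e * (1 / 2) ^ Suc i)) = ennreal e"
      proof (rule suminf_ennreal_eq)
        show "(\<lambda>i. e * (1 / 2) ^ Suc i) sums e"
          using sums_mult[OF power_half_series, of e] by simp
      qed (use e in simp)
      finally show "outer (\<Union>i. A i) \<le> (\<Sum>i. outer (A i)) + ennreal e" .
    qed
  qed
qed

lemma outer_Un_le: "E \<subseteq> \<Omega> \<Longrightarrow> F \<subseteq> \<Omega> \<Longrightarrow> E \<inter> F = {} \<Longrightarrow> outer (E \<union> F) \<le> outer E + outer F"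
  using outer_measure_space_outer
  by (intro subadditiveD[OF ring_of_sets.countably_subadditive_subadditive[OF ring_of_sets_Pow]])
    (auto simp: outer_measure_space_def)

text \<open>The nontrivial half of the Caratheodory criterion for open \<open>U\<close>. After a
  nearly optimal \<phi> in \<open>U \<inter> V\<close>, the field \<psi> is chosen in
  \<open>V\<close> minus the support of \<phi>. With disjoint supports
  \<open>\<phi> + \<psi>\<close> still has norm at most 1, and \<open>V - K\<close> is an open set
  containing \<open>x - U\<close>.\<close>

lemma size_split:
  assumes U: "open U" "U \<subseteq> \<Omega>" and V: "open V" "V \<subseteq> \<Omega>" "x \<subseteq> V"
  shows "outer (U \<inter> x) + outer (x - U) \<le> size V"
proof -
  let ?P = "\<lambda>U. {\<phi> \<in> test_fields U. \<forall>x. norm (\<phi> x) \<le> 1}"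
  have ne: "?P W \<noteq> {}" for W
    by (auto intro!: exI[of _ "\<lambda>x. 0"])
  have main: "ennreal (T \<phi>) + outer (x - U) \<le> size V" if "\<phi> \<in> ?P (U \<inter> V)" for \<phi>
  proof -
    define K where "K = closure {x. \<phi> x \<noteq> 0}"
    have \<phi>: "\<phi> \<in> test_fields (U \<inter> V)" "\<And>x. norm (\<phi> x) \<le> 1"
      using that by auto
    have K: "compact K" "K \<subseteq> U \<inter> V" "{x. \<phi> x \<noteq> 0} \<subseteq> K"
      using test_fieldsD(2-4)[OF \<phi>(1)] by (simp_all add: K_def)
    have \<phi>V: "\<phi> \<in> test_fields V"
      using \<phi>(1) by (rule test_fields_mono[rotated]) simp
    have "outer (x - U) \<le> size (V - K)"
      using K U V by (intro outer_lower open_Diff compact_imp_closed) auto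
    then have "ennreal (T \<phi>) + outer (x - U) \<le> ennreal (T \<phi>) + size (V - K)"
      by (rule add_left_mono)
    also have "\<dots> = (SUP \<psi>\<in>?P (V - K). ennreal (T \<phi>) + ennreal (T \<psi>))"
      unfolding size_def by (rule ennreal_SUP_add_right[OF ne])
    also have "\<dots> \<le> size V"
    proof (rule SUP_least)
      fix \<psi> assume "\<psi> \<in> ?P (V - K)"
      then have \<psi>: "\<psi> \<in> test_fields (V - K)" "\<And>x. norm (\<psi> x) \<le> 1"
        by auto
      have \<psi>V: "\<psi> \<in> test_fields V"
        using \<psi>(1) by (rule test_fields_mono[rotated]) auto
      have le: "norm (\<phi> x + \<psi> x) \<le> 1" for x
      proof -
        have "\<phi> x = 0 \<or> \<psi> x = 0"
          using K(3) test_fieldsD(5)[OF \<psi>(1), of x] by blast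
        then show ?thesis
          using \<phi>(2)[of x] \<psi>(2)[of x] by auto
      qed
      show "ennreal (T \<phi>) + ennreal (T \<psi>) \<le> size V"
      \<comment> \<open>Additivity passes through \<open>ennreal\<close> only for nonnegative
        values. A negative value contributes 0, and the other field alone is then
        admissible.\<close>
      proof (cases "T \<phi> \<ge> 0 \<and> T \<psi> \<ge> 0")
        case True
        then have "ennreal (T \<phi>) + ennreal (T \<psi>) = ennreal (T (\<lambda>x. \<phi> x + \<psi> x))"
          using T_add[OF \<phi>V[THEN test_fields_mono[OF V(2)]] \<psi>V[THEN test_fields_mono[OF V(2)]]]
          by simp
        also have "\<dots> \<le> size V"
          by (intro size_upper test_fields_add \<phi>V \<psi>V le)
        finally show ?thesis .
      next
        case False
        then show ?thesis
          using size_upper[OF \<phi>V \<phi>(2)] size_upper[OF \<psi>V \<psi>(2)] by (auto simp: ennreal_neg)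
      qed
    qed
    finally show ?thesis .
  qed
  have "outer (U \<inter> x) + outer (x - U) \<le> size (U \<inter> V) + outer (x - U)"
    using U V by (intro add_right_mono outer_lower) auto
  also have "\<dots> = (SUP \<phi>\<in>?P (U \<inter> V). ennreal (T \<phi>) + outer (x - U))"
    unfolding size_def by (rule ennreal_SUP_add_left[OF ne, symmetric])
  also have "\<dots> \<le> size V"
    using main by (intro SUP_least)
  finally show ?thesis .
qed

lemma open_in_lambda_system:
  assumes "open U" "U \<subseteq> \<Omega>"
  shows "U \<in> lambda_system \<Omega> (Pow \<Omega>) outer"
  unfolding lambda_system_def
proof (intro CollectI conjI ballI antisym)
  fix x assume x: "x \<in> Pow \<Omega>"
  have "(\<Omega> - U) \<inter> x = x - U"
    using x by auto
  moreover have "outer (U \<inter> x) + outer (x - U) \<le> outer x"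
    unfolding outer_def[of x] using assms by (intro INF_greatest) (auto intro: size_split)
  ultimately show "outer (U \<inter> x) + outer ((\<Omega> - U) \<inter> x) \<le> outer x"
    by simp
  have "outer x = outer (U \<inter> x \<union> (\<Omega> - U) \<inter> x)"
    using x by (intro arg_cong[where f = outer]) auto
  also have "\<dots> \<le> outer (U \<inter> x) + outer ((\<Omega> - U) \<inter> x)"
    using x by (intro outer_Un_le) auto
  finally show "outer x \<le> outer (U \<inter> x) + outer ((\<Omega> - U) \<inter> x)" .
qed (use assms in auto)

text \<open>The Caratheodory sets form a sigma-algebra containing the open subsets of \<Omega>,
  hence its Borel sets. The bound \<open>C\<close> is used for finiteness, since it bounds
  \<open>size \<Omega>\<close>.\<close>

lemma outer_measure_exists:
  assumes C: "\<And>\<phi>. \<phi> \<in> test_fields \<Omega> \<Longrightarrow> (\<And>x. norm (\<phi> x) \<le> 1) \<Longrightarrow> T \<phi> \<le> C"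
  obtains \<mu> where "sets \<mu> = sets (restrict_space borel \<Omega>)" "finite_measure \<mu>"
    "\<And>E. E \<in> sets \<mu> \<Longrightarrow> emeasure \<mu> E = outer E"
proof -
  let ?B = "restrict_space borel \<Omega>" and ?L = "lambda_system \<Omega> (Pow \<Omega>) outer"
  have sp: "space ?B = \<Omega>"
    by (simp add: space_restrict_space)
  interpret Pow: sigma_algebra \<Omega> "Pow \<Omega>"
    by (rule sigma_algebra_Pow)
  have ms: "measure_space \<Omega> ?L outer"
    by (rule Pow.caratheodory_lemma[OF outer_measure_space_outer])
  then interpret L: sigma_algebra \<Omega> ?L
    by (simp add: measure_space_def)
  have "A \<inter> \<Omega> \<in> ?L" if "A \<in> sigma_sets UNIV {S. open S}" for A
    using that
  proof induction
    case (Basic a)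
    then show ?case
      using open_domain by (intro open_in_lambda_system) auto
  next
    case (Compl a)
    have "(UNIV - a) \<inter> \<Omega> = \<Omega> - a \<inter> \<Omega>"
      by auto
    then show ?case
      using L.compl_sets[OF Compl.IH] by simp
  next
    case (Union a)
    have "(\<Union>i. a i) \<inter> \<Omega> = (\<Union>i. a i \<inter> \<Omega>)"
      by auto
    moreover have "(\<Union>i. a i \<inter> \<Omega>) \<in> ?L"
      using Union.IH by (intro L.countable_nat_UN) blast
    ultimately show ?case
      by (simp only:)
  qed auto
  then have BL: "sets ?B \<subseteq> ?L"
    by (auto simp: sets_restrict_space borel_def Int_commute)
  have "sigma_algebra \<Omega> (sets ?B)"
    using sets.sigma_algebra_axioms[of ?B] unfolding sp .
  then have "measure_space \<Omega> (sets ?B) outer"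
    using measure_down[OF ms _ BL] by blast
  then have B: "positive (sets ?B) outer" "countably_additive (sets ?B) outer"
    by (auto simp: measure_space_def)
  define \<mu> where "\<mu> = measure_of (space ?B) (sets ?B) outer"
  have s\<mu>: "sets \<mu> = sets ?B"
    by (simp add: \<mu>_def)
  have \<mu>: "emeasure \<mu> E = outer E" if "E \<in> sets ?B" for E
    unfolding \<mu>_def by (rule emeasure_measure_of_sigma[OF sets.sigma_algebra_axioms B that])
  have "space \<mu> = \<Omega>"
    using sets_eq_imp_space_eq[OF s\<mu>] sp by simp
  moreover have "\<Omega> \<in> sets ?B"
    using sets.top[of ?B] by (simp add: sp)
  moreover have "size \<Omega> \<le> ennreal C"
    unfolding size_def using C by (intro SUP_least ennreal_leI) auto
  ultimately have "emeasure \<mu> (space \<mu>) \<noteq> \<infinity>"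
    using \<mu>[of \<Omega>] outer_open[OF open_domain] by (auto simp: top_unique)
  then show ?thesis
    using that[of \<mu>] s\<mu> \<mu> by (simp add: finite_measureI)
qed

text \<open>This turns the supremum norm hidden in \<open>size\<close> into an integral: the values
  of \<open>norm (\<phi> x)\<close> are cut into steps of height \<open>e\<close>, each open
  enlargement of a level set gets its own weight in \<open>le_size_cover\<close>, and the result is
  an upper Riemann sum of the integral.\<close>

lemma le_integral_norm:
  assumes sets: "sets \<mu> = sets (restrict_space borel \<Omega>)" and fin: "finite_measure \<mu>"
    and \<mu>: "\<And>E. E \<in> sets \<mu> \<Longrightarrow> emeasure \<mu> E = outer E"
    and \<phi>: "\<phi> \<in> test_fields \<Omega>"
  shows "T \<phi> \<le> (\<integral>x. norm (\<phi> x) \<partial>\<mu>)"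
proof -
  interpret finite_measure \<mu> by fact
  have sp: "space \<mu> = \<Omega>"
    using sets by (rule space_eq_if_sets_restrict_borel)
  have cont: "continuous_on UNIV \<phi>"
    using \<phi> by (rule test_fields_continuous)
  then have [measurable]: "\<phi> \<in> borel_measurable \<mu>"
    by (rule continuous_imp_measurable_restrict[OF sets])
  obtain M where M: "M > 0" "\<And>x. norm (\<phi> x) \<le> M"
    using test_fields_bounded[OF \<phi>] by blast
  have int: "integrable \<mu> (\<lambda>x. norm (\<phi> x))"
    using M(2) by (intro integrable_const_bound[where B = M]) auto
  \<comment> \<open>The weight \<open>(k + 2) * e\<close> exceeds the value on level
    \<open>k\<close> by at most \<open>2 * e\<close>, which costs \<open>2 * e\<close> times the
    total mass; the excess measure of the open sets costs a further \<open>e\<close>.\<close>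
  have eps: "T \<phi> \<le> (\<integral>x. norm (\<phi> x) \<partial>\<mu>) + e * (2 * measure \<mu> \<Omega> + 1)" if e: "e > 0" for e
  proof -
    define q where "q x = nat \<lfloor>norm (\<phi> x) / e\<rfloor>" for x
    define n where "n = Suc (nat \<lfloor>M / e\<rfloor>)"
    have q: "real (q x) * e \<le> norm (\<phi> x)" "norm (\<phi> x) < (real (q x) + 1) * e" for x
    proof -
      have "0 \<le> norm (\<phi> x) / e"
        using e by simp
      then have "real (q x) \<le> norm (\<phi> x) / e" "norm (\<phi> x) / e < real (q x) + 1"
        unfolding q_def by linarith+
      then show "real (q x) * e \<le> norm (\<phi> x)" "norm (\<phi> x) < (real (q x) + 1) * e"
        using e by (simp_all add: field_simps)
    qed
    have qn: "q x < n" for x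
      unfolding q_def n_def less_Suc_eq_le
      using M(2)[of x] e by (intro nat_mono floor_mono divide_right_mono) auto
    define E where "E k = {x \<in> space \<mu>. q x = k}" for k
    have [measurable]: "q \<in> measurable \<mu> (count_space UNIV)"
      unfolding q_def by measurable
    have E [measurable]: "E k \<in> sets \<mu>" for k
      unfolding E_def by measurable
    \<comment> \<open>There are \<open>n\<close> levels with weights at most
      \<open>(n + 1) * e\<close>, so an excess \<open>d\<close> on each adds at most
      \<open>n * (n + 1) * e * d = e\<close>.\<close>
    define d where "d = 1 / (real n * (real n + 1))"
    have "d > 0"
      by (simp add: d_def n_def)
    have "\<exists>V. open V \<and> E k \<subseteq> V \<and> V \<subseteq> \<Omega> \<and> size V \<le> ennreal (measure \<mu> (E k) + d)" for k
    proof -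
      have "\<exists>V\<in>{U. open U \<and> E k \<subseteq> U \<and> U \<subseteq> \<Omega>}. size V < outer (E k) + ennreal d"
        by (rule INF_approx_ennreal[OF \<open>d > 0\<close> outer_def]) (simp add: \<mu>[OF E, symmetric])
      then obtain V where "open V" "E k \<subseteq> V" "V \<subseteq> \<Omega>" "size V < outer (E k) + ennreal d"
        by blast
      then show ?thesis
        using \<open>d > 0\<close> by (intro exI[of _ V])
          (simp add: \<mu>[OF E, symmetric] emeasure_eq_measure ennreal_plus less_imp_le)
    qed
    then obtain V where V: "\<And>k. open (V k)" "\<And>k. E k \<subseteq> V k" "\<And>k. V k \<subseteq> \<Omega>"
      "\<And>k. size (V k) \<le> ennreal (measure \<mu> (E k) + d)"
      by metis
    \<comment> \<open>the level sets \<open>E k\<close> are disjoint, so enlarging them slightly to open sets \<open>W k\<close> that still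
      cover \<open>\<Omega>\<close> loses only \<open>O(e)\<close> in the total\<close>
    define W where "W k = V k \<inter> {x. norm (\<phi> x) < (real k + 2) * e}" for k
    have W: "open (W k)" "W k \<subseteq> \<Omega>" "W k \<subseteq> V k" for k
      unfolding W_def using V(1,3) cont by (auto intro!: open_Int open_Collect_less continuous_intros)
    have "\<Omega> \<subseteq> (\<Union>k<n. W k)"
    proof
      fix x assume "x \<in> \<Omega>"
      then have "x \<in> V (q x)"
        using V(2)[of "q x"] by (auto simp: E_def sp)
      moreover have "norm (\<phi> x) < (real (q x) + 2) * e"
        using q(2)[of x] e by (simp add: algebra_simps)
      ultimately show "x \<in> (\<Union>k<n. W k)"
        using qn[of x] by (auto simp: W_def)
    qed
    then have "\<phi> \<in> test_fields (\<Union>k<n. W k)"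
      using \<phi> by (rule test_fields_mono)
    then have "ennreal (T \<phi>) \<le> (\<Sum>k<n. ennreal ((real k + 2) * e) * size (W k))"
      using W e by (intro le_size_cover) (auto simp: W_def)
    also have "\<dots> \<le> (\<Sum>k<n. ennreal ((real k + 2) * e) * ennreal (measure \<mu> (E k) + d))"
      using order_trans[OF size_mono[OF W(3)] V(4)] by (intro sum_mono mult_left_mono) auto
    also have "\<dots> = (\<Sum>k<n. ennreal ((real k + 2) * e * (measure \<mu> (E k) + d)))"
      using e \<open>d > 0\<close> by (intro sum.cong refl ennreal_mult[symmetric]) auto
    also have "\<dots> = ennreal (\<Sum>k<n. (real k + 2) * e * (measure \<mu> (E k) + d))"
      using e \<open>d > 0\<close> by (intro sum_ennreal) auto
    finally have "T \<phi> \<le> (\<Sum>k<n. (real k + 2) * e * (measure \<mu> (E k) + d))"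
      using e \<open>d > 0\<close> by (subst (asm) ennreal_le_iff) (auto intro!: sum_nonneg)
    also have "\<dots> = (\<Sum>k<n. (real k + 2) * e * measure \<mu> (E k)) + (\<Sum>k<n. (real k + 2) * e * d)"
      by (simp add: distrib_left sum.distrib)
    also have "(\<Sum>k<n. (real k + 2) * e * d) \<le> (\<Sum>k<n. (real n + 1) * e * d)"
      using e \<open>d > 0\<close> by (intro sum_mono mult_right_mono) auto
    also have "(\<Sum>k<n. (real n + 1) * e * d) = e"
      by (simp add: d_def n_def)
    also have "(\<Sum>k<n. (real k + 2) * e * measure \<mu> (E k)) \<le> (\<integral>x. norm (\<phi> x) \<partial>\<mu>) + 2 * e * measure \<mu> \<Omega>"
    proof -
      have iE: "integrable \<mu> (\<lambda>x. indicator (E k) x :: real)" for k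
        by (simp add: integrable_indicator_iff emeasure_eq_measure)
      have "(\<Sum>k<n. (real k + 2) * e * measure \<mu> (E k)) = (\<integral>x. (\<Sum>k<n. (real k + 2) * e * indicator (E k) x) \<partial>\<mu>)"
        using iE sets.sets_into_space[OF E]
        by (subst Bochner_Integration.integral_sum) (simp_all add: Int_absorb2)
      also have "\<dots> \<le> (\<integral>x. norm (\<phi> x) + 2 * e \<partial>\<mu>)"
      proof (rule integral_mono)
        show "integrable \<mu> (\<lambda>x. \<Sum>k<n. (real k + 2) * e * indicator (E k) x)"
          by (intro Bochner_Integration.integrable_sum integrable_mult_right iE)
        show "integrable \<mu> (\<lambda>x. norm (\<phi> x) + 2 * e)"
          using int by simp
        fix x assume "x \<in> space \<mu>"
        then have "(\<Sum>k<n. (real k + 2) * e * indicator (E k) x) = (\<Sum>k<n. if k = q x then (real k + 2) * e else 0)"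
          by (intro sum.cong) (auto simp: E_def indicator_def)
        also have "\<dots> = (real (q x) + 2) * e"
          using qn[of x] by simp
        also have "\<dots> \<le> norm (\<phi> x) + 2 * e"
          using q(1)[of x] by (simp add: algebra_simps)
        finally show "(\<Sum>k<n. (real k + 2) * e * indicator (E k) x) \<le> norm (\<phi> x) + 2 * e" .
      qed
      also have "\<dots> = (\<integral>x. norm (\<phi> x) \<partial>\<mu>) + 2 * e * measure \<mu> \<Omega>"
        using int by (simp add: sp mult.commute)
      finally show ?thesis .
    qed
    finally show ?thesis
      by (simp add: algebra_simps)
  qed
  show ?thesis
  proof (rule field_le_epsilon)
    fix r :: real assume "r > 0"
    define c where "c = 2 * measure \<mu> \<Omega> + 1"
    have "c > 0"
      by (simp add: c_def add_nonneg_pos)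
    then show "T \<phi> \<le> (\<integral>x. norm (\<phi> x) \<partial>\<mu>) + r"
      using eps[of "r / c"] \<open>r > 0\<close> by (simp add: c_def[symmetric])
  qed
qed

end

section \<open>Integral representation\<close>

context test_functional
begin

text \<open>Test fields are vector fields, so a scalar test function is encoded by its products with
  all constant vectors. Closure under linear operations is then inherited.\<close>

definition scalar_fields :: "('a \<Rightarrow> real) set" where
  "scalar_fields = {a. \<forall>c. (\<lambda>x. a x *\<^sub>R c) \<in> test_fields \<Omega>}"

lemma scalar_fields_add:
  "a \<in> scalar_fields \<Longrightarrow> b \<in> scalar_fields \<Longrightarrow> (\<lambda>x. a x + b x) \<in> scalar_fields"
  by (auto simp: scalar_fields_def scaleR_add_left intro: test_fields_add)

lemma scalar_fields_mult: "a \<in> scalar_fields \<Longrightarrow> (\<lambda>x. r * a x) \<in> scalar_fields"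
  using test_fields_scaleR[of _ \<Omega> r] by (fastforce simp: scalar_fields_def)

lemma scalar_fields_diff:
  "a \<in> scalar_fields \<Longrightarrow> b \<in> scalar_fields \<Longrightarrow> (\<lambda>x. a x - b x) \<in> scalar_fields"
  by (auto simp: scalar_fields_def scaleR_diff_left intro: test_fields_diff)

lemma cutoff_scalar_field: "\<eta> \<in> cutoffs \<Omega> \<Longrightarrow> \<eta> \<in> scalar_fields"
  by (auto simp: scalar_fields_def intro: cutoff_scaleR_test_field)

lemma test_field_component:
  assumes "\<phi> \<in> test_fields \<Omega>"
  shows "(\<lambda>x. \<phi> x \<bullet> b) \<in> scalar_fields"
  unfolding scalar_fields_def
proof (intro CollectI allI)
  fix c :: 'a
  have "times_continuously_differentiable k (\<lambda>x. \<phi> x \<bullet> b)" for k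
    using test_fieldsD(1)[OF assms, rule_format, of k]
    by (rule times_continuously_differentiable_bounded_linear[OF bounded_linear_inner_left])
  then show "(\<lambda>x. (\<phi> x \<bullet> b) *\<^sub>R c) \<in> test_fields \<Omega>"
    using test_fieldsD(2-4)[OF assms]
    by (intro test_fieldsI[of _ "closure {x. \<phi> x \<noteq> 0}"])
      (auto intro!: times_continuously_differentiable_scaleR)
qed

text \<open>The functional \<open>R\<close> is 1-Lipschitz for the L1 norm of \<nu> on a dense
  class, so it has limits along cutoffs approaching an indicator. These limits form an additive set
  function dominated by \<nu>, whose density is \<open>f\<close>. The remaining point is that
  integration against \<open>f\<close> gives back \<open>R\<close> on the smooth functions
  themselves.\<close>

lemma scalar_density:
  assumes sets: "sets \<nu> = sets (restrict_space borel \<Omega>)" and fin: "finite_measure \<nu>"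
    and le: "\<And>\<phi>. \<phi> \<in> test_fields \<Omega> \<Longrightarrow> T \<phi> \<le> (\<integral>x. norm (\<phi> x) \<partial>\<nu>)"
    and b: "norm b = 1"
  obtains f :: "'a \<Rightarrow> real" where "f \<in> borel_measurable \<nu>" "\<And>x. \<bar>f x\<bar> \<le> 1"
    "\<And>a. a \<in> scalar_fields \<Longrightarrow> T (\<lambda>x. a x *\<^sub>R b) = (\<integral>x. a x * f x \<partial>\<nu>)"
proof -
  interpret finite_measure \<nu> by fact
  define R where "R a = T (\<lambda>x. a x *\<^sub>R b)" for a
  have R_add: "R (\<lambda>x. a x + c x) = R a + R c"
    and R_diff: "R (\<lambda>x. a x - c x) = R a - R c"
    if "a \<in> scalar_fields" "c \<in> scalar_fields" for a c
    using that T_add[of "\<lambda>x. a x *\<^sub>R b" "\<lambda>x. c x *\<^sub>R b"] T_diff[of "\<lambda>x. a x *\<^sub>R b" "\<lambda>x. c x *\<^sub>R b"]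
    by (auto simp: R_def scalar_fields_def scaleR_add_left scaleR_diff_left)
  have R_mult: "R (\<lambda>x. r * a x) = r * R a" if "a \<in> scalar_fields" for a r
    using that T_scaleR[of "\<lambda>x. a x *\<^sub>R b" r] by (auto simp: R_def scalar_fields_def)
  have meas: "a \<in> borel_measurable \<nu>" and int: "integrable \<nu> a" if "a \<in> scalar_fields" for a
  proof -
    have ab: "(\<lambda>x. a x *\<^sub>R b) \<in> test_fields \<Omega>"
      using that by (simp add: scalar_fields_def)
    have "b \<bullet> b = 1"
      using b by (simp add: power2_norm_eq_inner[symmetric])
    then have "continuous_on UNIV a"
      using continuous_on_inner[OF test_fields_continuous[OF ab] continuous_on_const[of _ b]] by simp
    then show m: "a \<in> borel_measurable \<nu>"
      by (rule continuous_imp_measurable_restrict[OF sets])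
    obtain M where "\<And>x. norm (a x *\<^sub>R b) \<le> M"
      using test_fields_bounded[OF ab] by blast
    then show "integrable \<nu> a"
      using m b by (intro integrable_const_bound[where B = M]) auto
  qed
  have R_le: "\<bar>R a\<bar> \<le> (\<integral>x. \<bar>a x\<bar> \<partial>\<nu>)" if "a \<in> scalar_fields" for a
    using le[of "\<lambda>x. a x *\<^sub>R b"] le[of "\<lambda>x. - (a x *\<^sub>R b)"] that b
      T_scaleR[of "\<lambda>x. a x *\<^sub>R b" "-1"] test_fields_uminus[of "\<lambda>x. a x *\<^sub>R b"]
    by (auto simp: R_def scalar_fields_def abs_le_iff)
  have "\<exists>\<eta>\<in>scalar_fields. (\<integral>x. \<bar>\<eta> x - indicator A x\<bar> \<partial>\<nu>) < 1 / real (Suc n)" if "A \<in> sets \<nu>" for A n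
    using cutoff_approx_indicator[OF open_domain sets fin that, of "1 / real (Suc n)"]
      cutoff_scalar_field by auto
  then obtain \<eta> where \<eta>: "\<And>A n. A \<in> sets \<nu> \<Longrightarrow> \<eta> A n \<in> scalar_fields"
    "\<And>A n. A \<in> sets \<nu> \<Longrightarrow> (\<integral>x. \<bar>\<eta> A n x - indicator A x\<bar> \<partial>\<nu>) < 1 / real (Suc n)"
    by metis
  have int_ind: "integrable \<nu> (\<lambda>x. indicator A x :: real)" if "A \<in> sets \<nu>" for A
    using that by (simp add: integrable_indicator_iff emeasure_eq_measure)
  \<comment> \<open>Both approximants are L1-close to the same indicator, hence to each other, and
    \<open>R\<close> does not expand L1 distances.\<close>
  have conv: "convergent (\<lambda>n. R (\<eta> A n))" if A: "A \<in> sets \<nu>" for A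
  proof (rule Cauchy_convergent, rule metric_CauchyI)
    fix e :: real assume "e > 0"
    then obtain N where N: "1 / real (Suc N) < e / 2"
      using nat_approx_posE[of "e / 2"] by (metis half_gt_zero)
    have "dist (R (\<eta> A m)) (R (\<eta> A n)) < e" if "N \<le> m" "N \<le> n" for m n
    proof -
      have "dist (R (\<eta> A m)) (R (\<eta> A n)) = \<bar>R (\<lambda>x. \<eta> A m x - \<eta> A n x)\<bar>"
        using R_diff[OF \<eta>(1)[OF A] \<eta>(1)[OF A]] by (simp add: dist_real_def)
      also have "\<dots> \<le> (\<integral>x. \<bar>\<eta> A m x - \<eta> A n x\<bar> \<partial>\<nu>)"
        by (intro R_le scalar_fields_diff \<eta>(1) A)
      also have "\<dots> \<le> (\<integral>x. \<bar>\<eta> A m x - indicator A x\<bar> + \<bar>\<eta> A n x - indicator A x\<bar> \<partial>\<nu>)"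
        using int[OF \<eta>(1)[OF A]] int_ind[OF A] by (intro integral_mono) auto
      also have "\<dots> = (\<integral>x. \<bar>\<eta> A m x - indicator A x\<bar> \<partial>\<nu>) + (\<integral>x. \<bar>\<eta> A n x - indicator A x\<bar> \<partial>\<nu>)"
        using int[OF \<eta>(1)[OF A]] int_ind[OF A] by simp
      also have "\<dots> < 1 / real (Suc m) + 1 / real (Suc n)"
        by (intro add_strict_mono \<eta>(2) A)
      also have "\<dots> \<le> 1 / real (Suc N) + 1 / real (Suc N)"
        using that by (intro add_mono divide_left_mono) auto
      also have "\<dots> < e"
        using N by simp
      finally show ?thesis .
    qed
    then show "\<exists>N. \<forall>m\<ge>N. \<forall>n\<ge>N. dist (R (\<eta> A m)) (R (\<eta> A n)) < e"
      by blast
  qed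
  define m where "m A = lim (\<lambda>n. R (\<eta> A n))" for A
  have m: "(\<lambda>n. R (\<eta> A n)) \<longlonglongrightarrow> m A" if "A \<in> sets \<nu>" for A
    using conv[OF that] by (simp add: m_def convergent_LIMSEQ_iff)
  have inv0: "(\<lambda>n. c * (1 / real (Suc n))) \<longlonglongrightarrow> 0" for c :: real
    using tendsto_mult[OF tendsto_const[of c] LIMSEQ_inverse_real_of_nat]
    by (simp add: inverse_eq_divide)
  have m_add: "m (A \<union> B) = m A + m B" if AB: "A \<in> sets \<nu>" "B \<in> sets \<nu>" "A \<inter> B = {}" for A B
  proof -
    have U: "A \<union> B \<in> sets \<nu>"
      using AB by auto
    let ?d = "\<lambda>n x. \<eta> (A \<union> B) n x - (\<eta> A n x + \<eta> B n x)"
    \<comment> \<open>The indicators of disjoint sets add exactly, so only three approximation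
      errors remain.\<close>
    have "\<bar>R (\<eta> (A \<union> B) n) - (R (\<eta> A n) + R (\<eta> B n))\<bar> \<le> 3 * (1 / real (Suc n))" for n
    proof -
      have "R (\<eta> (A \<union> B) n) - (R (\<eta> A n) + R (\<eta> B n)) = R (?d n)"
        using R_diff[OF \<eta>(1)[OF U] scalar_fields_add[OF \<eta>(1)[OF AB(1)] \<eta>(1)[OF AB(2)]]]
          R_add[OF \<eta>(1)[OF AB(1)] \<eta>(1)[OF AB(2)]] by simp
      then have "\<bar>R (\<eta> (A \<union> B) n) - (R (\<eta> A n) + R (\<eta> B n))\<bar> \<le> (\<integral>x. \<bar>?d n x\<bar> \<partial>\<nu>)"
        using R_le[of "?d n"] scalar_fields_diff scalar_fields_add \<eta>(1) U AB by simp
      also have "\<dots> \<le> (\<integral>x. \<bar>\<eta> (A \<union> B) n x - indicator (A \<union> B) x\<bar>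
          + (\<bar>\<eta> A n x - indicator A x\<bar> + \<bar>\<eta> B n x - indicator B x\<bar>) \<partial>\<nu>)"
        using int[OF \<eta>(1)[OF U]] int[OF \<eta>(1)[OF AB(1)]] int[OF \<eta>(1)[OF AB(2)]]
          int_ind[OF U] int_ind[OF AB(1)] int_ind[OF AB(2)] AB(3)
        by (intro integral_mono) (auto simp: indicator_disj_union)
      also have "\<dots> = (\<integral>x. \<bar>\<eta> (A \<union> B) n x - indicator (A \<union> B) x\<bar> \<partial>\<nu>)
          + ((\<integral>x. \<bar>\<eta> A n x - indicator A x\<bar> \<partial>\<nu>) + (\<integral>x. \<bar>\<eta> B n x - indicator B x\<bar> \<partial>\<nu>))"
        using int[OF \<eta>(1)[OF U]] int[OF \<eta>(1)[OF AB(1)]] int[OF \<eta>(1)[OF AB(2)]]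
          int_ind[OF U] int_ind[OF AB(1)] int_ind[OF AB(2)]
        by simp
      also have "\<dots> \<le> 3 * (1 / real (Suc n))"
        using \<eta>(2)[OF U, of n] \<eta>(2)[OF AB(1), of n] \<eta>(2)[OF AB(2), of n] by linarith
      finally show ?thesis .
    qed
    then have "(\<lambda>n. R (\<eta> (A \<union> B) n) - (R (\<eta> A n) + R (\<eta> B n))) \<longlonglongrightarrow> 0"
      by (intro Lim_null_comparison[OF _ inv0[of 3]] always_eventually) simp
    moreover have "(\<lambda>n. R (\<eta> (A \<union> B) n) - (R (\<eta> A n) + R (\<eta> B n))) \<longlonglongrightarrow> m (A \<union> B) - (m A + m B)"
      by (intro tendsto_intros m U AB)
    ultimately have "m (A \<union> B) - (m A + m B) = 0"
      using LIMSEQ_unique by blast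
    then show ?thesis
      by simp
  qed
  have m_le: "norm (m A) \<le> measure \<nu> A" if A: "A \<in> sets \<nu>" for A
  proof (rule LIMSEQ_le)
    show "(\<lambda>n. norm (R (\<eta> A n))) \<longlonglongrightarrow> norm (m A)"
      by (intro tendsto_norm m A)
    show "(\<lambda>n. measure \<nu> A + 1 * (1 / real (Suc n))) \<longlonglongrightarrow> measure \<nu> A"
      using tendsto_add[OF tendsto_const[of "measure \<nu> A"] inv0[of 1]] by simp
    have "norm (R (\<eta> A n)) \<le> measure \<nu> A + 1 * (1 / real (Suc n))" for n
    proof -
      have "norm (R (\<eta> A n)) \<le> (\<integral>x. \<bar>\<eta> A n x\<bar> \<partial>\<nu>)"
        using R_le[OF \<eta>(1)[OF A]] by simp
      also have "\<dots> \<le> (\<integral>x. indicator A x + \<bar>\<eta> A n x - indicator A x\<bar> \<partial>\<nu>)"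
        using int[OF \<eta>(1)[OF A]] int_ind[OF A] by (intro integral_mono) (auto split: split_indicator)
      also have "\<dots> = measure \<nu> A + (\<integral>x. \<bar>\<eta> A n x - indicator A x\<bar> \<partial>\<nu>)"
        using int[OF \<eta>(1)[OF A]] int_ind[OF A] sets.sets_into_space[OF A] by (simp add: Int_absorb2)
      also have "\<dots> \<le> measure \<nu> A + 1 * (1 / real (Suc n))"
        using \<eta>(2)[OF A, of n] by simp
      finally show ?thesis .
    qed
    then show "\<exists>N. \<forall>n\<ge>N. norm (R (\<eta> A n)) \<le> measure \<nu> A + 1 * (1 / real (Suc n))"
      by blast
  qed
  obtain f where f: "f \<in> borel_measurable \<nu>" "\<And>x. norm (f x) \<le> 1"
    "\<And>A. A \<in> sets \<nu> \<Longrightarrow> m A = (LINT x:A|\<nu>. f x)"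
    using dominated_additive_density[OF fin m_add m_le] by blast
  note f(1)[measurable]
  have int_f: "integrable \<nu> (\<lambda>x. h x * f x)" and le_f: "\<bar>\<integral>x. h x * f x \<partial>\<nu>\<bar> \<le> (\<integral>x. \<bar>h x\<bar> \<partial>\<nu>)"
    if h: "integrable \<nu> h" for h :: "'a \<Rightarrow> real"
  proof -
    have *: "\<bar>h x * f x\<bar> \<le> \<bar>h x\<bar>" for x
      using f(2)[of x] by (simp add: abs_mult mult_left_le)
    show i: "integrable \<nu> (\<lambda>x. h x * f x)"
      using * h by (intro Bochner_Integration.integrable_bound[OF h]) auto
    have "\<bar>\<integral>x. h x * f x \<partial>\<nu>\<bar> \<le> (\<integral>x. \<bar>h x * f x\<bar> \<partial>\<nu>)"
      by (rule integral_abs_bound)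
    also have "\<dots> \<le> (\<integral>x. \<bar>h x\<bar> \<partial>\<nu>)"
      using * h i by (intro integral_mono) auto
    finally show "\<bar>\<integral>x. h x * f x \<partial>\<nu>\<bar> \<le> (\<integral>x. \<bar>h x\<bar> \<partial>\<nu>)" .
  qed
  define Q where "Q h = (\<forall>e>0. \<exists>a\<in>scalar_fields. (\<integral>x. \<bar>a x - h x\<bar> \<partial>\<nu>) < e \<and>
      \<bar>R a - (\<integral>x. h x * f x \<partial>\<nu>)\<bar> < e)" for h :: "'a \<Rightarrow> real"
  have Q: "Q h" if "integrable \<nu> h" for h
    using that
  proof induction
    case (base A c)
    note A = \<open>A \<in> sets \<nu>\<close>
    show ?case
      unfolding Q_def
    proof (intro allI impI)
      fix e :: real assume "e > 0"
      have "(\<lambda>n. R (\<lambda>x. c * \<eta> A n x)) \<longlonglongrightarrow> c * m A"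
        using R_mult[OF \<eta>(1)[OF A]] tendsto_mult[OF tendsto_const m[OF A]] by simp
      then have "eventually (\<lambda>n. dist (R (\<lambda>x. c * \<eta> A n x)) (c * m A) < e) sequentially"
        using \<open>e > 0\<close> by (rule tendstoD)
      moreover have "eventually (\<lambda>n. dist (\<bar>c\<bar> * (1 / real (Suc n))) 0 < e) sequentially"
        using \<open>e > 0\<close> by (intro tendstoD inv0)
      ultimately obtain n where n: "dist (R (\<lambda>x. c * \<eta> A n x)) (c * m A) < e"
        "dist (\<bar>c\<bar> * (1 / real (Suc n))) 0 < e"
        using eventually_conj[THEN eventually_happens] by (metis (no_types, lifting) trivial_limit_sequentially)
      have "(\<integral>x. \<bar>c * \<eta> A n x - indicator A x *\<^sub>R c\<bar> \<partial>\<nu>) = (\<integral>x. \<bar>c\<bar> * \<bar>\<eta> A n x - indicator A x\<bar> \<partial>\<nu>)"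
        by (intro Bochner_Integration.integral_cong) (auto simp flip: abs_mult simp: algebra_simps)
      also have "\<dots> = \<bar>c\<bar> * (\<integral>x. \<bar>\<eta> A n x - indicator A x\<bar> \<partial>\<nu>)"
        by simp
      also have "\<dots> \<le> \<bar>c\<bar> * (1 / real (Suc n))"
        by (intro mult_left_mono less_imp_le[OF \<eta>(2)[OF A]]) simp
      also have "\<dots> < e"
        using n(2) by simp
      finally have "(\<integral>x. \<bar>c * \<eta> A n x - indicator A x *\<^sub>R c\<bar> \<partial>\<nu>) < e" .
      moreover have "(\<integral>x. (indicator A x *\<^sub>R c) * f x \<partial>\<nu>) = c * m A"
        unfolding f(3)[OF A] set_lebesgue_integral_def integral_mult_right_zero[symmetric]
        by (intro Bochner_Integration.integral_cong) (simp_all add: mult_ac)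
      ultimately show "\<exists>a\<in>scalar_fields. (\<integral>x. \<bar>a x - indicator A x *\<^sub>R c\<bar> \<partial>\<nu>) < e \<and>
          \<bar>R a - (\<integral>x. (indicator A x *\<^sub>R c) * f x \<partial>\<nu>)\<bar> < e"
        using n(1) scalar_fields_mult[OF \<eta>(1)[OF A]]
        by (intro bexI[of _ "\<lambda>x. c * \<eta> A n x"]) (auto simp: dist_real_def)
    qed
  next
    case (add g h)
    show ?case
      unfolding Q_def
    proof (intro allI impI)
      fix e :: real assume "e > 0"
      then have "e / 2 > 0"
        by simp
      obtain a where a: "a \<in> scalar_fields" "(\<integral>x. \<bar>a x - g x\<bar> \<partial>\<nu>) < e / 2"
        "\<bar>R a - (\<integral>x. g x * f x \<partial>\<nu>)\<bar> < e / 2"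
        using add.IH(1) \<open>e / 2 > 0\<close> unfolding Q_def by blast
      obtain c where c: "c \<in> scalar_fields" "(\<integral>x. \<bar>c x - h x\<bar> \<partial>\<nu>) < e / 2"
        "\<bar>R c - (\<integral>x. h x * f x \<partial>\<nu>)\<bar> < e / 2"
        using add.IH(2) \<open>e / 2 > 0\<close> unfolding Q_def by blast
      note i = int[OF a(1)] int[OF c(1)] add.hyps int_f[OF add.hyps(1)] int_f[OF add.hyps(2)]
      have "(\<integral>x. \<bar>a x + c x - (g x + h x)\<bar> \<partial>\<nu>) \<le> (\<integral>x. \<bar>a x - g x\<bar> + \<bar>c x - h x\<bar> \<partial>\<nu>)"
        using i by (intro integral_mono) auto
      also have "\<dots> < e"
        using i a(2) c(2) by simp
      finally have "(\<integral>x. \<bar>a x + c x - (g x + h x)\<bar> \<partial>\<nu>) < e" .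
      moreover have "R (\<lambda>x. a x + c x) - (\<integral>x. (g x + h x) * f x \<partial>\<nu>)
          = (R a - (\<integral>x. g x * f x \<partial>\<nu>)) + (R c - (\<integral>x. h x * f x \<partial>\<nu>))"
        using i R_add[OF a(1) c(1)] by (simp add: distrib_right)
      ultimately show "\<exists>a\<in>scalar_fields. (\<integral>x. \<bar>a x - (g x + h x)\<bar> \<partial>\<nu>) < e \<and>
          \<bar>R a - (\<integral>x. (g x + h x) * f x \<partial>\<nu>)\<bar> < e"
        using a(3) c(3) scalar_fields_add[OF a(1) c(1)]
        by (intro bexI[of _ "\<lambda>x. a x + c x"] conjI) linarith+
    qed
  next
    case (lim h s)
    have "(\<lambda>i. \<integral>x. \<bar>s i x - h x\<bar> \<partial>\<nu>) \<longlonglongrightarrow> (\<integral>x. 0 \<partial>\<nu>)"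
    \<comment> \<open>The approximants supplied by the induction satisfy
      \<open>\<bar>s i x\<bar> \<le> 2 * \<bar>h x\<bar>\<close>; the third copy accounts for
      \<open>h\<close> itself.\<close>
    proof (rule integral_dominated_convergence[where w = "\<lambda>x. 3 * \<bar>h x\<bar>"])
      show "AE x in \<nu>. (\<lambda>i. \<bar>s i x - h x\<bar>) \<longlonglongrightarrow> 0"
        using lim.hyps(2) by (intro AE_I2) (simp add: LIM_zero tendsto_rabs_zero)
      show "AE x in \<nu>. norm \<bar>s i x - h x\<bar> \<le> 3 * \<bar>h x\<bar>" for i
      proof (rule AE_I2)
        fix x assume "x \<in> space \<nu>"
        then show "norm \<bar>s i x - h x\<bar> \<le> 3 * \<bar>h x\<bar>"
          using lim.hyps(3)[of x i] abs_triangle_ineq4[of "s i x" "h x"] by simp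
      qed
    qed (use lim.hyps in auto)
    then have lim0: "(\<lambda>i. \<integral>x. \<bar>s i x - h x\<bar> \<partial>\<nu>) \<longlonglongrightarrow> 0"
      by simp
    show ?case
      unfolding Q_def
    proof (intro allI impI)
      fix e :: real assume "e > 0"
      then have "e / 2 > 0"
        by simp
      have "eventually (\<lambda>i. (\<integral>x. \<bar>s i x - h x\<bar> \<partial>\<nu>) < e / 2) sequentially"
        using lim0 \<open>e / 2 > 0\<close> by (rule order_tendstoD)
      then obtain i where i: "(\<integral>x. \<bar>s i x - h x\<bar> \<partial>\<nu>) < e / 2"
        by (auto simp: eventually_sequentially)
      obtain a where a: "a \<in> scalar_fields" "(\<integral>x. \<bar>a x - s i x\<bar> \<partial>\<nu>) < e / 2"
        "\<bar>R a - (\<integral>x. s i x * f x \<partial>\<nu>)\<bar> < e / 2"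
        using lim.IH[of i] \<open>e / 2 > 0\<close> unfolding Q_def by blast
      note ints = int[OF a(1)] lim.hyps(1)[of i] lim.hyps(4)
      have "(\<integral>x. \<bar>a x - h x\<bar> \<partial>\<nu>) \<le> (\<integral>x. \<bar>a x - s i x\<bar> + \<bar>s i x - h x\<bar> \<partial>\<nu>)"
        using ints by (intro integral_mono) auto
      also have "\<dots> < e"
        using ints a(2) i by simp
      finally have "(\<integral>x. \<bar>a x - h x\<bar> \<partial>\<nu>) < e" .
      moreover have "\<bar>(\<integral>x. s i x * f x \<partial>\<nu>) - (\<integral>x. h x * f x \<partial>\<nu>)\<bar> < e / 2"
      proof -
        have "(\<integral>x. s i x * f x \<partial>\<nu>) - (\<integral>x. h x * f x \<partial>\<nu>) = (\<integral>x. (s i x - h x) * f x \<partial>\<nu>)"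
          using int_f[OF ints(2)] int_f[OF ints(3)] by (simp add: left_diff_distrib)
        then show ?thesis
          using le_f[of "\<lambda>x. s i x - h x"] ints i by simp
      qed
      ultimately show "\<exists>a\<in>scalar_fields. (\<integral>x. \<bar>a x - h x\<bar> \<partial>\<nu>) < e \<and> \<bar>R a - (\<integral>x. h x * f x \<partial>\<nu>)\<bar> < e"
        using a(1,3) by (intro bexI[of _ a] conjI) linarith+
    qed
  qed
  \<comment> \<open>With \<open>h = a\<close>, the approximants approach \<open>a\<close> in L1, so
    \<open>R\<close> on them approaches both \<open>R a\<close> and the integral. A gap between
    these would be less than twice its own half.\<close>
  have "R a = (\<integral>x. a x * f x \<partial>\<nu>)" if a: "a \<in> scalar_fields" for a
  proof (rule ccontr)
    assume "R a \<noteq> (\<integral>x. a x * f x \<partial>\<nu>)"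
    then have "\<bar>R a - (\<integral>x. a x * f x \<partial>\<nu>)\<bar> / 2 > 0"
      by simp
    then obtain c where c: "c \<in> scalar_fields"
      "(\<integral>x. \<bar>c x - a x\<bar> \<partial>\<nu>) < \<bar>R a - (\<integral>x. a x * f x \<partial>\<nu>)\<bar> / 2"
      "\<bar>R c - (\<integral>x. a x * f x \<partial>\<nu>)\<bar> < \<bar>R a - (\<integral>x. a x * f x \<partial>\<nu>)\<bar> / 2"
      using Q[OF int[OF a]] unfolding Q_def by blast
    have "\<bar>R c - R a\<bar> \<le> (\<integral>x. \<bar>c x - a x\<bar> \<partial>\<nu>)"
      using R_le[OF scalar_fields_diff[OF c(1) a]] R_diff[OF c(1) a] by simp
    moreover have "\<bar>R a - (\<integral>x. a x * f x \<partial>\<nu>)\<bar> \<le> \<bar>R c - R a\<bar> + \<bar>R c - (\<integral>x. a x * f x \<partial>\<nu>)\<bar>"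
      by (simp add: abs_if)
    ultimately show False
      using c(2,3) by simp
  qed
  then show ?thesis
    using that[of f] f(1,2) by (simp add: R_def)
qed

text \<open>The coordinate densities are at most 1, and the triangle inequality over the basis gives
  the crude dimensional bound. Later steps need only some constant bound on
  \<open>f\<close>.\<close>

lemma density_exists:
  assumes sets: "sets \<nu> = sets (restrict_space borel \<Omega>)" and fin: "finite_measure \<nu>"
    and le: "\<And>\<phi>. \<phi> \<in> test_fields \<Omega> \<Longrightarrow> T \<phi> \<le> (\<integral>x. norm (\<phi> x) \<partial>\<nu>)"
  obtains f :: "'a \<Rightarrow> 'a" where "f \<in> borel_measurable \<nu>" "\<And>x. norm (f x) \<le> real DIM('a)"
    "\<And>\<phi>. \<phi> \<in> test_fields \<Omega> \<Longrightarrow> T \<phi> = (\<integral>x. \<phi> x \<bullet> f x \<partial>\<nu>)"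
proof -
  interpret finite_measure \<nu> by fact
  have "\<exists>f. f \<in> borel_measurable \<nu> \<and> (\<forall>x. \<bar>f x\<bar> \<le> 1) \<and>
      (\<forall>a\<in>scalar_fields. T (\<lambda>x. a x *\<^sub>R b) = (\<integral>x. a x * f x \<partial>\<nu>))" if "b \<in> Basis" for b
    using scalar_density[OF sets fin le, of b] that by (metis norm_Basis)
  then obtain f where f: "\<And>b. b \<in> Basis \<Longrightarrow> f b \<in> borel_measurable \<nu>"
    "\<And>b x. b \<in> Basis \<Longrightarrow> \<bar>f b x\<bar> \<le> 1"
    "\<And>b a. b \<in> Basis \<Longrightarrow> a \<in> scalar_fields \<Longrightarrow> T (\<lambda>x. a x *\<^sub>R b) = (\<integral>x. a x * f b x \<partial>\<nu>)"
    by metis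
  define F where "F x = (\<Sum>b\<in>Basis. f b x *\<^sub>R b)" for x
  show thesis
  proof (rule that[of F])
    show "F \<in> borel_measurable \<nu>"
      unfolding F_def using f(1) by (intro borel_measurable_sum borel_measurable_scaleR) auto
    show "norm (F x) \<le> real DIM('a)" for x
      using f(2) sum_norm_bound[of Basis "\<lambda>b. f b x *\<^sub>R b" 1] by (simp add: F_def)
    show "T \<phi> = (\<integral>x. \<phi> x \<bullet> F x \<partial>\<nu>)" if \<phi>: "\<phi> \<in> test_fields \<Omega>" for \<phi>
    proof -
      have comp: "(\<lambda>x. (\<phi> x \<bullet> b) *\<^sub>R b) \<in> test_fields \<Omega>" for b
        using test_field_component[OF \<phi>, of b] by (simp add: scalar_fields_def)
      have i: "integrable \<nu> (\<lambda>x. (\<phi> x \<bullet> b) * f b x)" if b: "b \<in> Basis" for b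
      proof -
        note f(1)[OF b, measurable]
        have [measurable]: "\<phi> \<in> borel_measurable \<nu>"
          by (intro continuous_imp_measurable_restrict[OF sets] test_fields_continuous[OF \<phi>])
        obtain M where M: "\<And>x. norm (\<phi> x) \<le> M"
          using test_fields_bounded[OF \<phi>] by blast
        have "\<bar>\<phi> x \<bullet> b\<bar> * \<bar>f b x\<bar> \<le> M * 1" for x
          using M[of x] Basis_le_norm[OF b, of "\<phi> x"] f(2)[OF b, of x]
          by (intro mult_mono) auto
        then show ?thesis
          by (intro integrable_const_bound[where B = M]) (auto simp: abs_mult)
      qed
      have "T \<phi> = T (\<lambda>x. \<Sum>b\<in>Basis. (\<phi> x \<bullet> b) *\<^sub>R b)"
        by (simp add: euclidean_representation)
      also have "\<dots> = (\<Sum>b\<in>Basis. T (\<lambda>x. (\<phi> x \<bullet> b) *\<^sub>R b))"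
        using T_sum[of Basis "\<lambda>b x. (\<phi> x \<bullet> b) *\<^sub>R b"] comp by simp
      also have "\<dots> = (\<Sum>b\<in>Basis. \<integral>x. (\<phi> x \<bullet> b) * f b x \<partial>\<nu>)"
        by (intro sum.cong refl f(3) test_field_component \<phi>)
      also have "\<dots> = (\<integral>x. (\<Sum>b\<in>Basis. (\<phi> x \<bullet> b) * f b x) \<partial>\<nu>)"
        using i by (subst Bochner_Integration.integral_sum) auto
      also have "\<dots> = (\<integral>x. \<phi> x \<bullet> F x \<partial>\<nu>)"
        by (intro Bochner_Integration.integral_cong) (auto simp: F_def inner_sum_right mult.commute)
      finally show ?thesis .
    qed
  qed
qed

end

text \<open>The field \<open>d\<close> is tested with itself. A test field \<phi> close to
  \<open>d\<close> in L1 pairs to 0 with \<open>d\<close>, while replacing \<phi> by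
  \<open>d\<close> changes the pairing by at most the L1 error because \<open>d\<close> is bounded
  by 1. So the integral of \<open>d x \<bullet> d x\<close> vanishes.\<close>

lemma test_field_density_unique:
  fixes d :: "'a::euclidean_space \<Rightarrow> 'a"
  assumes "open \<Omega>" and sets: "sets N = sets (restrict_space borel \<Omega>)" and fin: "finite_measure N"
    and d [measurable]: "d \<in> borel_measurable N" and le: "\<And>x. norm (d x) \<le> 1"
    and 0: "\<And>\<phi>. \<phi> \<in> test_fields \<Omega> \<Longrightarrow> (\<integral>x. \<phi> x \<bullet> d x \<partial>N) = 0"
  shows "AE x in N. d x = 0"
proof -
  interpret finite_measure N by fact
  have int: "integrable N (\<lambda>x. h x \<bullet> d x)"
    if [measurable]: "h \<in> borel_measurable N" and h: "\<And>x. norm (h x) \<le> 1" for h :: "'a \<Rightarrow> 'a"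
  proof (rule integrable_const_bound[where B = 1])
    have "\<bar>h x \<bullet> d x\<bar> \<le> 1 * 1" for x
      using Cauchy_Schwarz_ineq2[of "h x" "d x"] mult_mono[OF h le, of x x] by simp
    then show "AE x in N. norm (h x \<bullet> d x) \<le> 1"
      by simp
  qed measurable
  have "(\<integral>x. d x \<bullet> d x \<partial>N) \<le> 0"
  proof (rule field_le_epsilon)
    fix e :: real assume "e > 0"
    obtain \<phi> where \<phi>: "\<phi> \<in> test_fields \<Omega>" "\<And>x. norm (\<phi> x) \<le> 1" "(\<integral>x. norm (\<phi> x - d x) \<partial>N) < e"
      using test_field_approx[OF assms(1) sets fin d le \<open>e > 0\<close>] by blast
    have [measurable]: "\<phi> \<in> borel_measurable N"
      by (intro continuous_imp_measurable_restrict[OF sets] test_fields_continuous[OF \<phi>(1)])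
    have "(\<integral>x. d x \<bullet> d x \<partial>N) = (\<integral>x. d x \<bullet> d x \<partial>N) - (\<integral>x. \<phi> x \<bullet> d x \<partial>N)"
      using 0[OF \<phi>(1)] by simp
    also have "\<dots> = (\<integral>x. d x \<bullet> d x - \<phi> x \<bullet> d x \<partial>N)"
      using int[OF d le] int[OF _ \<phi>(2)] by (intro Bochner_Integration.integral_diff[symmetric]) auto
    also have "\<dots> \<le> (\<integral>x. norm (\<phi> x - d x) \<partial>N)"
    proof (rule integral_mono)
      show "integrable N (\<lambda>x. d x \<bullet> d x - \<phi> x \<bullet> d x)"
        using int[OF d le] int[OF _ \<phi>(2)] by (intro Bochner_Integration.integrable_diff) auto
      show "integrable N (\<lambda>x. norm (\<phi> x - d x))"
        by (intro integrable_norm_diff \<phi>(2) le) measurable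
      fix x
      have "d x \<bullet> d x - \<phi> x \<bullet> d x = (d x - \<phi> x) \<bullet> d x"
        by (simp add: inner_diff_left)
      also have "\<dots> \<le> norm (d x - \<phi> x) * norm (d x)"
        by (rule norm_cauchy_schwarz)
      also have "\<dots> \<le> norm (d x - \<phi> x) * 1"
        by (intro mult_left_mono le) simp
      finally show "d x \<bullet> d x - \<phi> x \<bullet> d x \<le> norm (\<phi> x - d x)"
        by (simp add: norm_minus_commute)
    qed
    finally show "(\<integral>x. d x \<bullet> d x \<partial>N) \<le> 0 + e"
      using \<phi>(3) by simp
  qed
  then have "(\<integral>x. d x \<bullet> d x \<partial>N) = 0"
    by (intro antisym integral_nonneg_AE) auto
  then have "AE x in N. d x \<bullet> d x = 0"
    by (subst (asm) integral_nonneg_eq_0_iff_AE[OF int[OF d le]]) auto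
  then show ?thesis
    by simp
qed

section \<open>The weak gradient as a functional\<close>

text \<open>Off its closed support \<phi> is locally constant. Directional derivatives are thus test
  fields, which makes the divergence continuous and bounded and its pairing with an L1 function
  finite.\<close>

lemma frechet_derivative_test_field:
  assumes "\<phi> \<in> test_fields U"
  shows "(\<lambda>x. frechet_derivative \<phi> (at x) v) \<in> test_fields U"
proof (rule test_fieldsI)
  let ?K = "closure {x. \<phi> x \<noteq> 0}"
  show "smooth (\<lambda>x. frechet_derivative \<phi> (at x) v)"
    using test_fieldsD(1)[OF assms] times_continuously_differentiable_SucD(2) by blast
  show "compact ?K" "?K \<subseteq> U"
    using test_fieldsD[OF assms] by auto
  have "frechet_derivative \<phi> (at x) v = 0" if "x \<notin> ?K" for x
  proof -
    have "(\<phi> has_derivative (\<lambda>v. 0)) (at x)"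
    proof (rule has_derivative_transform_within_open[OF has_derivative_const])
      show "open (- ?K)" "x \<in> - ?K"
        using that by auto
      show "0 = \<phi> y" if "y \<in> - ?K" for y
        using that test_fieldsD(4)[OF assms] by auto
    qed
    then show ?thesis
      using frechet_derivative_at by metis
  qed
  then show "{x. frechet_derivative \<phi> (at x) v \<noteq> 0} \<subseteq> ?K"
    by blast
qed

lemma test_field_has_derivative:
  "\<phi> \<in> test_fields U \<Longrightarrow> (\<phi> has_derivative frechet_derivative \<phi> (at x)) (at x)"
  using test_fieldsD(1) times_continuously_differentiable_SucD(1) by blast

lemma integrable_mult_divergence:
  assumes \<phi>: "\<phi> \<in> test_fields U" and u: "integrable (lebesgue_on \<Omega>) u"
  shows "integrable (lebesgue_on \<Omega>) (\<lambda>x. u x * divergence \<phi> x)"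
proof -
  have "integrable (lebesgue_on \<Omega>) (\<lambda>x. (frechet_derivative \<phi> (at x) b \<bullet> b) * u x)"
    if b: "b \<in> Basis" for b
  proof -
    note D = frechet_derivative_test_field[OF \<phi>, of b]
    have "continuous_on UNIV (\<lambda>x. frechet_derivative \<phi> (at x) b \<bullet> b)"
      by (intro continuous_intros test_fields_continuous[OF D])
    then have meas: "(\<lambda>x. frechet_derivative \<phi> (at x) b \<bullet> b) \<in> borel_measurable (lebesgue_on \<Omega>)"
      by (intro measurable_restrict_space1 measurable_completion)
        (simp add: borel_measurable_continuous_onI)
    obtain M where M: "\<And>x. norm (frechet_derivative \<phi> (at x) b) \<le> M"
      using test_fields_bounded[OF D] by blast
    have le: "norm ((frechet_derivative \<phi> (at x) b \<bullet> b) * u x) \<le> norm (M * u x)" for x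
      using Basis_le_norm[OF b, of "frechet_derivative \<phi> (at x) b"] M[of x]
      by (simp add: abs_mult mult_right_mono)
    show ?thesis
      by (rule Bochner_Integration.integrable_bound[OF integrable_mult_right[OF u]
            borel_measurable_times[OF meas borel_measurable_integrable[OF u]] AE_I2[OF le]])
  qed
  then have "integrable (lebesgue_on \<Omega>) (\<lambda>x. \<Sum>b\<in>Basis. (frechet_derivative \<phi> (at x) b \<bullet> b) * u x)"
    by (intro Bochner_Integration.integrable_sum)
  then show ?thesis
    by (simp add: divergence_def sum_distrib_left mult.commute)
qed

lemma divergence_add:
  assumes "\<phi> \<in> test_fields U" "\<psi> \<in> test_fields U"
  shows "divergence (\<lambda>x. \<phi> x + \<psi> x) x = divergence \<phi> x + divergence \<psi> x"
  using frechet_derivative_at[OF has_derivative_add[OF test_field_has_derivative[OF assms(1)]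
        test_field_has_derivative[OF assms(2)]], symmetric]
  by (simp add: divergence_def inner_add_left sum.distrib)

lemma divergence_scaleR:
  assumes "\<phi> \<in> test_fields U"
  shows "divergence (\<lambda>x. c *\<^sub>R \<phi> x) x = c * divergence \<phi> x"
  using frechet_derivative_at[OF has_derivative_scaleR_right[OF test_field_has_derivative[OF assms]],
      symmetric, of c]
  by (simp add: divergence_def sum_distrib_left)

lemma weak_gradient_functional:
  assumes "open \<Omega>" "integrable (lebesgue_on \<Omega>) u"
  shows "test_functional \<Omega> (weak_gradient \<Omega> u)"
proof
  show "open \<Omega>" by fact
  show "weak_gradient \<Omega> u (\<lambda>x. \<phi> x + \<psi> x) = weak_gradient \<Omega> u \<phi> + weak_gradient \<Omega> u \<psi>"
    if "\<phi> \<in> test_fields \<Omega>" "\<psi> \<in> test_fields \<Omega>" for \<phi> \<psi>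
    using integrable_mult_divergence[OF that(1) assms(2)] integrable_mult_divergence[OF that(2) assms(2)]
    by (simp add: weak_gradient_def divergence_add[OF that] distrib_left)
  show "weak_gradient \<Omega> u (\<lambda>x. c *\<^sub>R \<phi> x) = c * weak_gradient \<Omega> u \<phi>"
    if "\<phi> \<in> test_fields \<Omega>" for \<phi> c
    by (simp add: weak_gradient_def divergence_scaleR[OF that] mult.left_commute)
qed

section \<open>Duality\<close>

lemma integrable_inner_bounded:
  fixes f \<phi> :: "'a \<Rightarrow> 'b::euclidean_space"
  assumes f: "integrable N f" and \<phi> [measurable]: "\<phi> \<in> borel_measurable N"
    and C: "\<And>x. norm (\<phi> x) \<le> C"
  shows "integrable N (\<lambda>x. \<phi> x \<bullet> f x)"
proof (rule Bochner_Integration.integrable_bound)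
  show "integrable N (\<lambda>x. C * norm (f x))"
    using f by simp
  have [measurable]: "f \<in> borel_measurable N"
    using f by simp
  show "(\<lambda>x. \<phi> x \<bullet> f x) \<in> borel_measurable N"
    by measurable
  have "norm (\<phi> x \<bullet> f x) \<le> norm (C * norm (f x))" for x
  proof -
    have "\<bar>\<phi> x \<bullet> f x\<bar> \<le> norm (\<phi> x) * norm (f x)"
      by (rule Cauchy_Schwarz_ineq2)
    also have "\<dots> \<le> C * norm (f x)"
      by (intro mult_right_mono C) simp
    finally show ?thesis
      by simp
  qed
  then show "AE x in N. norm (\<phi> x \<bullet> f x) \<le> norm (C * norm (f x))"
    by simp
qed

lemma radon_measure_density:
  fixes g :: "'a::euclidean_space set \<Rightarrow> 'a"
  assumes g: "g \<in> radon_measures \<Omega>" and sets: "sets N = sets (restrict_space borel \<Omega>)"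
    and fin: "finite_measure N" and le: "\<And>A. A \<in> sets N \<Longrightarrow> norm (g A) \<le> measure N A"
  obtains f where "f \<in> borel_measurable N" "\<And>x. norm (f x) \<le> 1"
    "\<And>A. A \<in> sets N \<Longrightarrow> g A = (LINT x:A|N. f x)"
    "\<And>\<phi>. \<phi> \<in> test_fields \<Omega> \<Longrightarrow> integrable N (\<lambda>x. \<phi> x \<bullet> f x)"
    "\<And>\<phi>. \<phi> \<in> test_fields \<Omega> \<Longrightarrow> vector_integral \<Omega> g \<phi> = (\<integral>x. \<phi> x \<bullet> f x \<partial>N)"
proof -
  interpret finite_measure N by fact
  have add: "g (A \<union> B) = g A + g B" if "A \<in> sets N" "B \<in> sets N" "A \<inter> B = {}" for A B
    using that by (intro radon_measures_Un[OF g]) (simp_all add: sets)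
  obtain f where f: "f \<in> borel_measurable N" "\<And>x. norm (f x) \<le> 1"
    "\<And>A. A \<in> sets N \<Longrightarrow> g A = (LINT x:A|N. f x)"
    using dominated_additive_density[OF fin add le] by blast
  have int: "integrable N f"
    using f(1,2) by (intro integrable_const_bound[where B = 1]) auto
  have "integrable N (\<lambda>x. \<phi> x \<bullet> f x)" "vector_integral \<Omega> g \<phi> = (\<integral>x. \<phi> x \<bullet> f x \<partial>N)"
    if \<phi>: "\<phi> \<in> test_fields \<Omega>" for \<phi>
  proof -
    obtain M where "\<And>x. norm (\<phi> x) \<le> M"
      using test_fields_bounded[OF \<phi>] by blast
    moreover have "\<phi> \<in> borel_measurable N"
      by (intro continuous_imp_measurable_restrict[OF sets] test_fields_continuous[OF \<phi>])
    ultimately show "integrable N (\<lambda>x. \<phi> x \<bullet> f x)" "vector_integral \<Omega> g \<phi> = (\<integral>x. \<phi> x \<bullet> f x \<partial>N)"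
      using vector_integral_density[OF sets int f(3)] by blast+
  qed
  with f that show ?thesis
    by blast
qed

lemma vector_integral_le:
  assumes g: "g \<in> radon_measures \<Omega>" and sets: "sets N = sets (restrict_space borel \<Omega>)"
    and fin: "finite_measure N" and le: "\<And>A. A \<in> sets N \<Longrightarrow> norm (g A) \<le> measure N A"
    and \<phi>: "\<phi> \<in> test_fields \<Omega>"
  shows "vector_integral \<Omega> g \<phi> \<le> (\<integral>x. norm (\<phi> x) \<partial>N)"
proof -
  interpret finite_measure N by fact
  obtain f where f: "f \<in> borel_measurable N" "\<And>x. norm (f x) \<le> 1"
    "\<And>\<phi>. \<phi> \<in> test_fields \<Omega> \<Longrightarrow> integrable N (\<lambda>x. \<phi> x \<bullet> f x)"
    "\<And>\<phi>. \<phi> \<in> test_fields \<Omega> \<Longrightarrow> vector_integral \<Omega> g \<phi> = (\<integral>x. \<phi> x \<bullet> f x \<partial>N)"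
    using radon_measure_density[OF g sets fin le] by metis
  obtain M where M: "\<And>x. norm (\<phi> x) \<le> M"
    using test_fields_bounded[OF \<phi>] by blast
  have [measurable]: "\<phi> \<in> borel_measurable N"
    by (intro continuous_imp_measurable_restrict[OF sets] test_fields_continuous[OF \<phi>])
  have "(\<integral>x. \<phi> x \<bullet> f x \<partial>N) \<le> (\<integral>x. norm (\<phi> x) \<partial>N)"
  proof (rule integral_mono[OF f(3)[OF \<phi>]])
    show "integrable N (\<lambda>x. norm (\<phi> x))"
      using M by (intro integrable_const_bound[where B = M]) auto
    show "\<phi> x \<bullet> f x \<le> norm (\<phi> x)" for x
      using norm_cauchy_schwarz[of "\<phi> x" "f x"] mult_left_mono[OF f(2)[of x], of "norm (\<phi> x)"] by simp
  qed
  then show ?thesis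
    using f(4)[OF \<phi>] by simp
qed

text \<open>The sum of the two variations is a common reference measure. With respect to it the
  densities have equal pairings with all test fields, so they agree almost everywhere.\<close>

lemma represents_unique:
  assumes \<Omega>: "open \<Omega>" and h1: "represents \<Omega> h1 T" and h2: "represents \<Omega> h2 T"
  shows "h1 = h2"
proof -
  have r: "h1 \<in> radon_measures \<Omega>" "h2 \<in> radon_measures \<Omega>"
    using h1 h2 by (auto simp: represents_def)
  obtain V1 where V1: "sets V1 = sets (restrict_space borel \<Omega>)" "finite_measure V1"
    "\<And>E. E \<in> sets V1 \<Longrightarrow> norm (h1 E) \<le> measure V1 E"
    using variation_measure[OF r(1)] \<Omega> by (metis borel_open)
  obtain V2 where V2: "sets V2 = sets (restrict_space borel \<Omega>)" "finite_measure V2"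
    "\<And>E. E \<in> sets V2 \<Longrightarrow> norm (h2 E) \<le> measure V2 E"
    using variation_measure[OF r(2)] \<Omega> by (metis borel_open)
  obtain N where N: "sets N = sets V2" "finite_measure N"
    "\<And>A. A \<in> sets V2 \<Longrightarrow> emeasure N A = emeasure V1 A + emeasure V2 A"
    using finite_measure_sum[of V1 V2] V1 V2 by metis
  interpret V1: finite_measure V1 by fact
  interpret V2: finite_measure V2 by fact
  interpret finite_measure N by fact
  have sets: "sets N = sets (restrict_space borel \<Omega>)"
    using N(1) V2(1) by simp
  have m: "measure N A = measure V1 A + measure V2 A" if "A \<in> sets N" for A
    using N(3)[of A] that N(1)
    by (simp add: emeasure_eq_measure V1.emeasure_eq_measure V2.emeasure_eq_measure flip: ennreal_plus)
  have le1: "norm (h1 A) \<le> measure N A" and le2: "norm (h2 A) \<le> measure N A" if "A \<in> sets N" for A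
    using that V1(3)[of A] V2(3)[of A] m[OF that] sets V1(1) V2(1) by (auto intro: order_trans)
  obtain f1 where f1: "f1 \<in> borel_measurable N" "\<And>x. norm (f1 x) \<le> 1"
    "\<And>A. A \<in> sets N \<Longrightarrow> h1 A = (LINT x:A|N. f1 x)"
    "\<And>\<phi>. \<phi> \<in> test_fields \<Omega> \<Longrightarrow> integrable N (\<lambda>x. \<phi> x \<bullet> f1 x)"
    "\<And>\<phi>. \<phi> \<in> test_fields \<Omega> \<Longrightarrow> vector_integral \<Omega> h1 \<phi> = (\<integral>x. \<phi> x \<bullet> f1 x \<partial>N)"
    using radon_measure_density[OF r(1) sets N(2) le1] by metis
  obtain f2 where f2: "f2 \<in> borel_measurable N" "\<And>x. norm (f2 x) \<le> 1"
    "\<And>A. A \<in> sets N \<Longrightarrow> h2 A = (LINT x:A|N. f2 x)"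
    "\<And>\<phi>. \<phi> \<in> test_fields \<Omega> \<Longrightarrow> integrable N (\<lambda>x. \<phi> x \<bullet> f2 x)"
    "\<And>\<phi>. \<phi> \<in> test_fields \<Omega> \<Longrightarrow> vector_integral \<Omega> h2 \<phi> = (\<integral>x. \<phi> x \<bullet> f2 x \<partial>N)"
    using radon_measure_density[OF r(2) sets N(2) le2] by metis
  note f1(1)[measurable] f2(1)[measurable]
  \<comment> \<open>The factor one half brings the difference of two unit-bounded densities back
    into the unit ball.\<close>
  define d where "d x = (1 / 2) *\<^sub>R (f1 x - f2 x)" for x
  have "AE x in N. d x = 0"
  proof (rule test_field_density_unique[OF \<Omega> sets N(2)])
    show "d \<in> borel_measurable N"
      unfolding d_def by measurable
    show "norm (d x) \<le> 1" for x
      using norm_diff_le_2[OF f1(2)[of x] f2(2)[of x]] by (simp add: d_def)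
    show "(\<integral>x. \<phi> x \<bullet> d x \<partial>N) = 0" if \<phi>: "\<phi> \<in> test_fields \<Omega>" for \<phi>
    proof -
      have "vector_integral \<Omega> h1 \<phi> = vector_integral \<Omega> h2 \<phi>"
        using h1 h2 \<phi> by (simp add: represents_def)
      then show ?thesis
        using f1(4,5)[OF \<phi>] f2(4,5)[OF \<phi>] by (simp add: d_def inner_diff_right)
    qed
  qed
  then have ae: "AE x in N. f1 x = f2 x"
    by (simp add: d_def)
  show ?thesis
  proof
    fix A
    show "h1 A = h2 A"
    proof (cases "A \<in> sets N")
      case True
      then show ?thesis
        unfolding f1(3)[OF True] f2(3)[OF True] set_lebesgue_integral_def
        using ae by (intro integral_cong_AE) auto
    next
      \<comment> \<open>Off the Borel sets both functions are 0 by the convention in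
        \<open>radon_measures\<close>.\<close>
      case False
      then show ?thesis
        using r by (simp add: radon_measures_def sets)
    qed
  qed
qed

lemma radon_norm_eq_variation:
  assumes "open \<Omega>" "represents \<Omega> h T"
  shows "radon_norm \<Omega> T = variation \<Omega> h \<Omega>"
proof -
  have "(THE h. represents \<Omega> h T) = h"
    using represents_unique[OF assms(1)] assms(2) by (intro the_equality)
  then show ?thesis
    using assms(2) by (auto simp: radon_norm_def)
qed

section \<open>Weak duality\<close>

lemma TV_pwL_ge:
  fixes \<Omega> :: "'a::euclidean_space set"
  assumes \<Omega>: "open \<Omega>" and sets: "sets \<gamma> = sets (restrict_space borel \<Omega>)" and fin: "finite_measure \<gamma>"
    and u: "integrable (lebesgue_on \<Omega>) u" and \<phi>: "\<phi> \<in> test_fields \<Omega>" "\<And>x. x \<in> \<Omega> \<Longrightarrow> norm (\<phi> x) \<le> 1"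
  shows "ennreal ((\<integral>x. u x * divergence \<phi> x \<partial>lebesgue_on \<Omega>) - (\<integral>x. norm (\<phi> x) \<partial>\<gamma>)) \<le> TV_pwL \<Omega> \<gamma> u"
  unfolding TV_pwL_def
proof (rule INF_greatest)
  fix g :: "'a set \<Rightarrow> 'a"
  assume "g \<in> {g \<in> radon_measures \<Omega>.
      \<forall>E\<in>sets (restrict_space borel \<Omega>). variation \<Omega> g E \<le> emeasure \<gamma> E}"
  then have g: "g \<in> radon_measures \<Omega>" "\<And>E. E \<in> sets \<gamma> \<Longrightarrow> variation \<Omega> g E \<le> emeasure \<gamma> E"
    by (auto simp: sets)
  interpret finite_measure \<gamma> by fact
  interpret test_functional \<Omega> "weak_gradient \<Omega> u"
    using \<Omega> u by (rule weak_gradient_functional)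
  let ?T = "\<lambda>\<phi>. weak_gradient \<Omega> u \<phi> - vector_integral \<Omega> g \<phi>"
  let ?a = "(\<integral>x. u x * divergence \<phi> x \<partial>lebesgue_on \<Omega>) - (\<integral>x. norm (\<phi> x) \<partial>\<gamma>)"
  show "ennreal ?a \<le> radon_norm \<Omega> ?T"
  proof (cases "\<exists>h. represents \<Omega> h ?T")
    case True
    then obtain h where h: "represents \<Omega> h ?T"
      by blast
    then have h': "h \<in> radon_measures \<Omega>"
      by (simp add: represents_def)
    obtain V where V: "sets V = sets (restrict_space borel \<Omega>)" "finite_measure V"
      "\<And>E. E \<in> sets V \<Longrightarrow> emeasure V E = variation \<Omega> h E"
      "\<And>E. E \<in> sets V \<Longrightarrow> norm (h E) \<le> measure V E"
      using variation_measure[OF h'] \<Omega> by (metis borel_open)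
    interpret V: finite_measure V by fact
    have spV: "space V = \<Omega>"
      using V(1) by (rule space_eq_if_sets_restrict_borel)
    have gle: "norm (g E) \<le> measure \<gamma> E" if "E \<in> sets \<gamma>" for E
    proof -
      have "ennreal (norm (g E)) \<le> emeasure \<gamma> E"
        using norm_le_variation[of g E \<Omega>, OF radon_measures_empty[OF g(1)]] g(2)[OF that] that
        by (auto simp: sets intro: order_trans)
      then show ?thesis
        by (simp add: emeasure_eq_measure)
    qed
    \<comment> \<open>The weak gradient carries a minus sign; testing it with the negated field
      yields the integral of \<open>u\<close> times the divergence of \<phi>.\<close>
    define \<psi> where "\<psi> x = - \<phi> x" for x
    have \<psi>: "\<psi> \<in> test_fields \<Omega>"
      unfolding \<psi>_def using \<phi>(1) by (rule test_fields_uminus)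
    have "(\<integral>x. u x * divergence \<phi> x \<partial>lebesgue_on \<Omega>) = weak_gradient \<Omega> u \<psi>"
      using T_scaleR[OF \<phi>(1), of "-1"] by (simp add: \<psi>_def[abs_def] weak_gradient_def)
    also have "\<dots> = vector_integral \<Omega> h \<psi> + vector_integral \<Omega> g \<psi>"
    proof -
      have "weak_gradient \<Omega> u \<psi> - vector_integral \<Omega> g \<psi> = vector_integral \<Omega> h \<psi>"
        using h \<psi> unfolding represents_def by blast
      then show ?thesis
        by simp
    qed
    also have "\<dots> \<le> (\<integral>x. norm (\<psi> x) \<partial>V) + (\<integral>x. norm (\<psi> x) \<partial>\<gamma>)"
      by (intro add_mono vector_integral_le[OF h' V(1,2,4) \<psi>] vector_integral_le[OF g(1) sets fin gle \<psi>])
    \<comment> \<open>Only the integral against the variation of \<open>h\<close> is bounded by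
      total mass; the one against \<gamma> is kept, as it is the penalty in the dual
      functional.\<close>
    also have "(\<integral>x. norm (\<psi> x) \<partial>V) \<le> (\<integral>x. 1 \<partial>V)"
    proof (rule integral_mono)
      have [measurable]: "\<psi> \<in> borel_measurable V"
        by (intro continuous_imp_measurable_restrict[OF V(1)] test_fields_continuous[OF \<psi>])
      show le: "norm (\<psi> x) \<le> 1" if "x \<in> space V" for x
        using \<phi>(2) that by (simp add: \<psi>_def spV)
      then show "integrable V (\<lambda>x. norm (\<psi> x))"
        by (intro V.integrable_const_bound[where B = 1] AE_I2) simp_all
    qed simp
    also have "(\<integral>x. 1 \<partial>V) = measure V \<Omega>"
      by (simp add: spV)
    finally have "?a \<le> measure V \<Omega>"
      by (simp add: \<psi>_def)
    then have "ennreal ?a \<le> emeasure V \<Omega>"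
      by (simp add: V.emeasure_eq_measure ennreal_leI)
    also have "\<dots> = radon_norm \<Omega> ?T"
      using V(3)[of \<Omega>] sets.top[of V] radon_norm_eq_variation[OF \<Omega> h] by (simp add: spV)
    finally show ?thesis .
  next
    case False
    then show ?thesis
      by (simp add: radon_norm_def)
  qed
qed

text \<open>Both terms of the dual functional are continuous for L1 convergence with respect to
  \<nu>: the pairing because \<open>f\<close> is bounded, and the penalty because \<gamma> is at
  most \<nu>. So a bound on test fields extends to measurable fields in the unit ball.\<close>

lemma integral_le_of_test_fields:
  fixes f \<theta> :: "'a::euclidean_space \<Rightarrow> 'a"
  assumes \<Omega>: "open \<Omega>" and sets: "sets \<nu> = sets (restrict_space borel \<Omega>)" and fin: "finite_measure \<nu>"
    and s\<gamma>: "sets \<gamma> = sets \<nu>" and \<gamma>\<nu>: "\<And>A. A \<in> sets \<nu> \<Longrightarrow> emeasure \<gamma> A \<le> emeasure \<nu> A"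
    and \<gamma>: "\<gamma> = density \<nu> (\<lambda>x. ennreal (c x))"
    and c [measurable]: "c \<in> borel_measurable \<nu>" and c_nonneg: "\<And>x. 0 \<le> c x"
    and f [measurable]: "f \<in> borel_measurable \<nu>" and f_le: "\<And>x. norm (f x) \<le> C"
    and le: "\<And>\<phi>. \<phi> \<in> test_fields \<Omega> \<Longrightarrow> (\<And>x. norm (\<phi> x) \<le> 1) \<Longrightarrow>
      (\<integral>x. \<phi> x \<bullet> f x \<partial>\<nu>) - (\<integral>x. norm (\<phi> x) \<partial>\<gamma>) \<le> s"
    and \<theta> [measurable]: "\<theta> \<in> borel_measurable \<nu>" and \<theta>_le: "\<And>x. norm (\<theta> x) \<le> 1"
  shows "(\<integral>x. \<theta> x \<bullet> f x - c x * norm (\<theta> x) \<partial>\<nu>) \<le> s"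
proof (rule field_le_epsilon)
  fix r :: real assume "r > 0"
  interpret finite_measure \<nu> by fact
  have C: "C \<ge> 0"
    using order_trans[OF norm_ge_zero f_le] .
  \<comment> \<open>An L1 error \<open>e\<close> costs at most \<open>C * e\<close> in the pairing
    with \<open>f\<close> and \<open>e\<close> in the integral against \<gamma>.\<close>
  define e where "e = r / (C + 1)"
  have "(C + 1) * e = r"
    using C by (simp add: e_def)
  then have e: "C * e + e = r"
    by (simp only: distrib_right mult_1)
  have "e > 0"
    unfolding e_def using \<open>r > 0\<close> C by (intro divide_pos_pos) simp_all
  obtain \<phi> where \<phi>: "\<phi> \<in> test_fields \<Omega>" "\<And>x. norm (\<phi> x) \<le> 1" "(\<integral>x. norm (\<phi> x - \<theta> x) \<partial>\<nu>) < e"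
    using test_field_approx[OF \<Omega> sets fin \<theta> \<theta>_le \<open>e > 0\<close>] by blast
  have \<phi>m [measurable]: "\<phi> \<in> borel_measurable \<nu>"
    by (intro continuous_imp_measurable_restrict[OF sets] test_fields_continuous[OF \<phi>(1)])
  have int_d: "integrable \<nu> (\<lambda>x. norm (\<phi> x - \<theta> x))"
    by (rule integrable_norm_diff[OF \<phi>m \<theta> \<phi>(2) \<theta>_le])
  have int_le1: "integrable \<nu> (\<lambda>x. norm (\<psi> x))" "integrable \<gamma> (\<lambda>x. norm (\<psi> x))"
    if "\<psi> \<in> borel_measurable \<nu>" "\<And>x. norm (\<psi> x) \<le> 1" for \<psi> :: "'a \<Rightarrow> 'a"
  proof -
    show i: "integrable \<nu> (\<lambda>x. norm (\<psi> x))"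
      using that by (intro integrable_const_bound[where B = 1]) auto
    show "integrable \<gamma> (\<lambda>x. norm (\<psi> x))"
      using integral_dominated_measure(1)[OF s\<gamma> \<gamma>\<nu> i] by simp
  qed
  note \<phi>\<gamma> = int_le1(2)[OF \<phi>m \<phi>(2)] and \<theta>\<gamma> = int_le1(2)[OF \<theta> \<theta>_le]
  have int_f: "integrable \<nu> f"
    using f_le by (intro integrable_const_bound[where B = C]) auto
  note \<phi>f = integrable_inner_bounded[OF int_f \<phi>m \<phi>(2)]
    and \<theta>f = integrable_inner_bounded[OF int_f \<theta> \<theta>_le]
  have int_c: "integrable \<nu> (\<lambda>x. c x * norm (\<theta> x))"
    using \<theta>\<gamma> c_nonneg unfolding \<gamma> by (subst (asm) integrable_density) auto
  have c_eq: "(\<integral>x. norm (\<theta> x) \<partial>\<gamma>) = (\<integral>x. c x * norm (\<theta> x) \<partial>\<nu>)"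
    unfolding \<gamma> using c_nonneg by (subst integral_density) auto
  have "(\<integral>x. \<theta> x \<bullet> f x \<partial>\<nu>) \<le> (\<integral>x. \<phi> x \<bullet> f x + C * norm (\<phi> x - \<theta> x) \<partial>\<nu>)"
  proof (rule integral_mono[OF \<theta>f])
    show "integrable \<nu> (\<lambda>x. \<phi> x \<bullet> f x + C * norm (\<phi> x - \<theta> x))"
      using \<phi>f int_d by simp
    fix x
    have "(\<theta> x - \<phi> x) \<bullet> f x \<le> norm (\<theta> x - \<phi> x) * norm (f x)"
      by (rule norm_cauchy_schwarz)
    also have "\<dots> \<le> norm (\<theta> x - \<phi> x) * C"
      by (intro mult_left_mono f_le) simp
    finally show "\<theta> x \<bullet> f x \<le> \<phi> x \<bullet> f x + C * norm (\<phi> x - \<theta> x)"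
      by (simp add: inner_diff_left norm_minus_commute mult.commute)
  qed
  also have "\<dots> = (\<integral>x. \<phi> x \<bullet> f x \<partial>\<nu>) + C * (\<integral>x. norm (\<phi> x - \<theta> x) \<partial>\<nu>)"
    using \<phi>f int_d by simp
  also have "\<dots> \<le> (\<integral>x. \<phi> x \<bullet> f x \<partial>\<nu>) + C * e"
    using \<phi>(3) C by (intro add_left_mono mult_left_mono) auto
  finally have 1: "(\<integral>x. \<theta> x \<bullet> f x \<partial>\<nu>) \<le> (\<integral>x. \<phi> x \<bullet> f x \<partial>\<nu>) + C * e" .
  have d\<gamma>: "integrable \<gamma> (\<lambda>x. norm (\<phi> x - \<theta> x))"
    "(\<integral>x. norm (\<phi> x - \<theta> x) \<partial>\<gamma>) \<le> (\<integral>x. norm (\<phi> x - \<theta> x) \<partial>\<nu>)"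
    using integral_dominated_measure[OF s\<gamma> \<gamma>\<nu> int_d] by simp_all
  have "(\<integral>x. norm (\<phi> x) \<partial>\<gamma>) \<le> (\<integral>x. norm (\<theta> x) + norm (\<phi> x - \<theta> x) \<partial>\<gamma>)"
    using \<phi>\<gamma> \<theta>\<gamma> d\<gamma>(1) by (intro integral_mono norm_triangle_sub) simp_all
  also have "\<dots> = (\<integral>x. norm (\<theta> x) \<partial>\<gamma>) + (\<integral>x. norm (\<phi> x - \<theta> x) \<partial>\<gamma>)"
    using \<theta>\<gamma> d\<gamma>(1) by (rule Bochner_Integration.integral_add)
  finally have "(\<integral>x. norm (\<phi> x) \<partial>\<gamma>) \<le> (\<integral>x. norm (\<theta> x) \<partial>\<gamma>) + e"
    using d\<gamma>(2) \<phi>(3) by linarith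
  moreover have "(\<integral>x. \<theta> x \<bullet> f x - c x * norm (\<theta> x) \<partial>\<nu>) = (\<integral>x. \<theta> x \<bullet> f x \<partial>\<nu>) - (\<integral>x. norm (\<theta> x) \<partial>\<gamma>)"
    unfolding c_eq using \<theta>f int_c by (rule Bochner_Integration.integral_diff)
  ultimately show "(\<integral>x. \<theta> x \<bullet> f x - c x * norm (\<theta> x) \<partial>\<nu>) \<le> s + r"
    using 1 le[OF \<phi>(1,2)] e by linarith
qed

section \<open>Strong duality, with an explicit minimiser\<close>

lemma TV_pwL_le:
  fixes \<Omega> :: "'a::euclidean_space set"
  assumes \<Omega>: "open \<Omega>" and sets: "sets \<gamma> = sets (restrict_space borel \<Omega>)" and fin: "finite_measure \<gamma>"
    and u: "integrable (lebesgue_on \<Omega>) u"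
    and le: "\<And>\<phi>. \<phi> \<in> test_fields \<Omega> \<Longrightarrow> (\<And>x. norm (\<phi> x) \<le> 1) \<Longrightarrow>
      (\<integral>x. u x * divergence \<phi> x \<partial>lebesgue_on \<Omega>) - (\<integral>x. norm (\<phi> x) \<partial>\<gamma>) \<le> s"
  shows "TV_pwL \<Omega> \<gamma> u \<le> ennreal s"
proof -
  interpret \<gamma>: finite_measure \<gamma> by fact
  let ?T = "weak_gradient \<Omega> u"
  interpret test_functional \<Omega> ?T
    using \<Omega> u by (rule weak_gradient_functional)
  have \<phi>m: "\<phi> \<in> borel_measurable N"
    if "\<phi> \<in> test_fields \<Omega>" "sets N = sets (restrict_space borel \<Omega>)" for \<phi> and N :: "'a measure"
    using that by (intro continuous_imp_measurable_restrict test_fields_continuous)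
  \<comment> \<open>Test fields and the norm constraint are symmetric, so passing to the negated
    field removes the sign in \<open>weak_gradient\<close>.\<close>
  have T_le: "?T \<phi> - (\<integral>x. norm (\<phi> x) \<partial>\<gamma>) \<le> s"
    if "\<phi> \<in> test_fields \<Omega>" "\<And>x. norm (\<phi> x) \<le> 1" for \<phi>
    using le[OF test_fields_uminus[OF that(1)]] that T_scaleR[OF that(1), of "-1"]
    by (simp add: weak_gradient_def)
  have "?T \<phi> \<le> s + measure \<gamma> (space \<gamma>)"
    if \<phi>: "\<phi> \<in> test_fields \<Omega>" "\<And>x. norm (\<phi> x) \<le> 1" for \<phi>
  proof -
    have "(\<integral>x. norm (\<phi> x) \<partial>\<gamma>) \<le> (\<integral>x. 1 \<partial>\<gamma>)"
      using \<phi>(2) \<phi>m[OF \<phi>(1) sets]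
      by (intro integral_mono \<gamma>.integrable_const_bound[where B = 1]) auto
    then show ?thesis
      using T_le[OF \<phi>] by simp
  qed
  from outer_measure_exists[OF this]
  obtain \<mu> where \<mu>: "sets \<mu> = sets (restrict_space borel \<Omega>)" "finite_measure \<mu>"
    "\<And>E. E \<in> sets \<mu> \<Longrightarrow> emeasure \<mu> E = outer E"
    by blast
  obtain \<nu> where \<nu>: "sets \<nu> = sets \<gamma>" "finite_measure \<nu>"
    "\<And>A. A \<in> sets \<gamma> \<Longrightarrow> emeasure \<nu> A = emeasure \<mu> A + emeasure \<gamma> A"
    using finite_measure_sum[of \<mu> \<gamma>] \<mu> sets fin by metis
  interpret \<nu>: finite_measure \<nu> by fact
  have s\<nu>: "sets \<nu> = sets (restrict_space borel \<Omega>)"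
    using \<nu>(1) sets by simp
  have sp: "space \<nu> = \<Omega>"
    using s\<nu> by (rule space_eq_if_sets_restrict_borel)
  have s\<mu>\<nu>: "sets \<mu> = sets \<nu>"
    using \<mu>(1) s\<nu> by simp
  have \<mu>\<nu>: "emeasure \<mu> A \<le> emeasure \<nu> A" and \<gamma>\<nu>: "emeasure \<gamma> A \<le> emeasure \<nu> A" if "A \<in> sets \<nu>" for A
    using \<nu>(3)[of A] \<nu>(1) that by auto
  have T\<nu>: "?T \<phi> \<le> (\<integral>x. norm (\<phi> x) \<partial>\<nu>)" if \<phi>: "\<phi> \<in> test_fields \<Omega>" for \<phi>
  proof -
    obtain M where "\<And>x. norm (\<phi> x) \<le> M"
      using test_fields_bounded[OF \<phi>] by blast
    then have "integrable \<nu> (\<lambda>x. norm (\<phi> x))"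
      using \<phi>m[OF \<phi> s\<nu>] by (intro \<nu>.integrable_const_bound[where B = M]) auto
    then have "(\<integral>x. norm (\<phi> x) \<partial>\<mu>) \<le> (\<integral>x. norm (\<phi> x) \<partial>\<nu>)"
      using integral_dominated_measure(2)[OF s\<mu>\<nu> \<mu>\<nu>, of "\<lambda>x. norm (\<phi> x)"] by simp
    moreover have "?T \<phi> \<le> (\<integral>x. norm (\<phi> x) \<partial>\<mu>)"
      by (rule le_integral_norm[OF \<mu> \<phi>])
    ultimately show ?thesis
      by simp
  qed
  obtain f where f: "f \<in> borel_measurable \<nu>" "\<And>x. norm (f x) \<le> real DIM('a)"
    "\<And>\<phi>. \<phi> \<in> test_fields \<Omega> \<Longrightarrow> ?T \<phi> = (\<integral>x. \<phi> x \<bullet> f x \<partial>\<nu>)"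
    using density_exists[OF s\<nu> \<nu>(2) T\<nu>] by blast
  have "absolutely_continuous \<nu> \<gamma>"
    using \<nu>(1,3) by (auto simp: absolutely_continuous_def null_sets_def)
  from \<nu>.real_RN_deriv[OF fin this \<nu>(1)[symmetric]] obtain c
    where c: "c \<in> borel_measurable \<nu>" "AE x in \<nu>. RN_deriv \<nu> \<gamma> x = ennreal (c x)" "\<And>x. 0 \<le> c x"
    by metis
  have \<gamma>_dens: "\<gamma> = density \<nu> (\<lambda>x. ennreal (c x))"
    using \<nu>.density_RN_deriv[OF \<open>absolutely_continuous \<nu> \<gamma>\<close> \<nu>(1)[symmetric]] c(1,2)
      density_cong[of "RN_deriv \<nu> \<gamma>" \<nu> "\<lambda>x. ennreal (c x)"] by simp
  note [measurable] = f(1) c(1)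
  \<comment> \<open>In the second branch \<open>norm (f x) > c x \<ge> 0\<close>, so the quotients
    here and in \<theta> never divide by zero.\<close>
  define g where "g x = (if norm (f x) \<le> c x then f x else (c x / norm (f x)) *\<^sub>R f x)" for x
  define \<theta> where "\<theta> x = (if norm (f x) \<le> c x then 0 else (1 / norm (f x)) *\<^sub>R f x)" for x
  have [measurable]: "g \<in> borel_measurable \<nu>" "\<theta> \<in> borel_measurable \<nu>"
    unfolding g_def \<theta>_def by measurable
  have gc: "norm (g x) \<le> c x" and gf: "norm (g x) \<le> norm (f x)"
    and \<theta>1: "norm (\<theta> x) \<le> 1"
    and key: "norm (f x - g x) = \<theta> x \<bullet> f x - c x * norm (\<theta> x)" for x
  proof -
    show "norm (g x) \<le> c x" "norm (g x) \<le> norm (f x)" "norm (\<theta> x) \<le> 1"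
      using c(3)[of x] by (auto simp: g_def \<theta>_def divide_simps)
    \<comment> \<open>Complementary slackness at a point: where the constraint is inactive,
      \<open>g = f\<close> and \<theta> is 0; elsewhere \<open>f - g\<close> points along the unit
      vector \<theta> and both sides are \<open>norm (f x) - c x\<close>.\<close>
    show "norm (f x - g x) = \<theta> x \<bullet> f x - c x * norm (\<theta> x)"
    proof (cases "norm (f x) \<le> c x")
      case False
      then have pos: "norm (f x) > 0" and "f x \<noteq> 0"
        using c(3)[of x] by auto
      have "f x - g x = (1 - c x / norm (f x)) *\<^sub>R f x"
        using False by (simp add: g_def scaleR_diff_left)
      moreover have "1 - c x / norm (f x) \<ge> 0"
        using False pos by (simp add: field_simps)
      ultimately have "norm (f x - g x) = (1 - c x / norm (f x)) * norm (f x)"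
        by (simp only: norm_scaleR abs_of_nonneg)
      also have "\<dots> = norm (f x) - c x"
        using pos by (simp add: field_simps)
      finally have "norm (f x - g x) = norm (f x) - c x" .
      moreover have "\<theta> x \<bullet> f x = norm (f x)" "norm (\<theta> x) = 1"
        using False pos by (simp_all add: \<theta>_def power2_norm_eq_inner[symmetric] power2_eq_square)
      ultimately show ?thesis
        by simp
    qed (simp add: g_def \<theta>_def)
  qed
  have int_f: "integrable \<nu> f"
    using f(2) by (intro \<nu>.integrable_const_bound[where B = "real DIM('a)"]) auto
  have int_g: "integrable \<nu> g"
    using gf by (intro Bochner_Integration.integrable_bound[OF int_f]) auto
  have int_fg: "integrable \<nu> (\<lambda>x. f x - g x)"
    using int_f int_g by simp
  define G where "G A = (if A \<in> sets \<nu> then (LINT x:A|\<nu>. g x) else 0)" for A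
  define h where "h A = (if A \<in> sets \<nu> then (LINT x:A|\<nu>. f x - g x) else 0)" for A
  have G_eq: "G A = (LINT x:A|\<nu>. g x)" and h_eq: "h A = (LINT x:A|\<nu>. f x - g x)" if "A \<in> sets \<nu>" for A
    using that by (simp_all add: G_def h_def)
  have G: "G \<in> radon_measures \<Omega>"
    unfolding G_def by (rule density_radon_measure[OF s\<nu> int_g])
  have h: "h \<in> radon_measures \<Omega>"
    unfolding h_def by (rule density_radon_measure[OF s\<nu> int_fg])
  have G_le: "variation \<Omega> G E \<le> emeasure \<gamma> E" if "E \<in> sets (restrict_space borel \<Omega>)" for E
  proof -
    have E: "E \<in> sets \<nu>"
      using that s\<nu> by simp
    have "variation \<Omega> G E \<le> (\<integral>\<^sup>+x\<in>E. norm (g x) \<partial>\<nu>)"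
      by (rule variation_density_le[OF s\<nu> int_g G_eq])
    also have "\<dots> \<le> (\<integral>\<^sup>+x\<in>E. c x \<partial>\<nu>)"
      using gc by (intro nn_integral_mono mult_right_mono ennreal_leI) auto
    also have "\<dots> = emeasure \<gamma> E"
      using E by (subst \<gamma>_dens) (simp add: emeasure_density)
    finally show ?thesis .
  qed
  have "represents \<Omega> h (\<lambda>\<phi>. ?T \<phi> - vector_integral \<Omega> G \<phi>)"
    unfolding represents_def
  proof (intro conjI ballI h)
    fix \<phi> assume \<phi>: "\<phi> \<in> test_fields \<Omega>"
    obtain M where M: "\<And>x. norm (\<phi> x) \<le> M"
      using test_fields_bounded[OF \<phi>] by blast
    have i: "integrable \<nu> (\<lambda>x. \<phi> x \<bullet> f x)"
      by (rule integrable_inner_bounded[OF int_f \<phi>m[OF \<phi> s\<nu>] M])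
    have G\<phi>: "integrable \<nu> (\<lambda>x. \<phi> x \<bullet> g x)" "vector_integral \<Omega> G \<phi> = (\<integral>x. \<phi> x \<bullet> g x \<partial>\<nu>)"
      using vector_integral_density[OF s\<nu> int_g G_eq \<phi>m[OF \<phi> s\<nu>] M] by blast+
    have "vector_integral \<Omega> h \<phi> = (\<integral>x. \<phi> x \<bullet> (f x - g x) \<partial>\<nu>)"
      by (rule vector_integral_density(2)[OF s\<nu> int_fg h_eq \<phi>m[OF \<phi> s\<nu>] M])
    then show "?T \<phi> - vector_integral \<Omega> G \<phi> = vector_integral \<Omega> h \<phi>"
      using i G\<phi> f(3)[OF \<phi>] by (simp add: inner_diff_right)
  qed
  then have "radon_norm \<Omega> (\<lambda>\<phi>. ?T \<phi> - vector_integral \<Omega> G \<phi>) = variation \<Omega> h \<Omega>"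
    by (rule radon_norm_eq_variation[OF \<Omega>])
  then have "TV_pwL \<Omega> \<gamma> u \<le> variation \<Omega> h \<Omega>"
    unfolding TV_pwL_def using G G_le by (intro INF_lower2[of G]) auto
  also have "\<dots> \<le> (\<integral>\<^sup>+x\<in>\<Omega>. norm (f x - g x) \<partial>\<nu>)"
    by (rule variation_density_le[OF s\<nu> int_fg h_eq])
  also have "\<dots> = (\<integral>\<^sup>+x. norm (f x - g x) \<partial>\<nu>)"
    by (intro nn_integral_cong) (simp add: sp)
  also have "\<dots> = ennreal (\<integral>x. norm (f x - g x) \<partial>\<nu>)"
    using int_fg by (intro nn_integral_eq_integral) auto
  also have "(\<integral>x. norm (f x - g x) \<partial>\<nu>) = (\<integral>x. \<theta> x \<bullet> f x - c x * norm (\<theta> x) \<partial>\<nu>)"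
    by (simp only: key)
  also have "ennreal \<dots> \<le> ennreal s"
  proof (rule ennreal_leI, rule integral_le_of_test_fields[OF \<Omega> s\<nu> \<nu>(2) \<nu>(1)[symmetric] \<gamma>\<nu> \<gamma>_dens c(1,3) f(1,2)])
    show "(\<integral>x. \<phi> x \<bullet> f x \<partial>\<nu>) - (\<integral>x. norm (\<phi> x) \<partial>\<gamma>) \<le> s"
      if "\<phi> \<in> test_fields \<Omega>" "\<And>x. norm (\<phi> x) \<le> 1" for \<phi>
      using T_le[OF that] f(3)[OF that(1)] by simp
  qed (use \<theta>1 in auto)
  finally show ?thesis .
qed

text \<open>The dual functional may be negative at single fields, so the supremum is taken in
  \<open>ereal\<close>. The zero field makes it nonnegative, and hence comparable with an
  \<open>ennreal\<close> without loss.\<close>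

theorem TV_pwL_dual:
  fixes \<Omega> :: "'a::euclidean_space set"
  assumes \<Omega>: "open \<Omega>" and sets: "sets \<gamma> = sets (restrict_space borel \<Omega>)" and fin: "finite_measure \<gamma>"
    and u: "integrable (lebesgue_on \<Omega>) u"
  shows "enn2ereal (TV_pwL \<Omega> \<gamma> u) =
    (SUP \<phi> \<in> {\<phi> \<in> test_fields \<Omega>. \<forall>x \<in> \<Omega>. norm (\<phi> x) \<le> 1}.
       ereal (integral\<^sup>L (lebesgue_on \<Omega>) (\<lambda>x. u x * divergence \<phi> x)
              - integral\<^sup>L \<gamma> (\<lambda>x. norm (\<phi> x))))"
    (is "?L = (SUP \<phi>\<in>?P. ereal (?F \<phi>))")
proof (rule antisym)
  show "(SUP \<phi>\<in>?P. ereal (?F \<phi>)) \<le> ?L"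
  proof (rule SUP_least)
    fix \<phi> assume "\<phi> \<in> ?P"
    then have "ennreal (?F \<phi>) \<le> TV_pwL \<Omega> \<gamma> u"
      by (intro TV_pwL_ge[OF assms]) auto
    then have "enn2ereal (ennreal (?F \<phi>)) \<le> ?L"
      by (simp add: less_eq_ennreal.rep_eq)
    \<comment> \<open>Truncation by \<open>ennreal\<close> can only raise a negative value to 0,
      which is the harmless direction here.\<close>
    moreover have "ereal (?F \<phi>) \<le> enn2ereal (ennreal (?F \<phi>))"
      by (cases "?F \<phi> \<ge> 0") (auto simp: enn2ereal_ennreal ennreal_neg zero_ennreal.rep_eq)
    ultimately show "ereal (?F \<phi>) \<le> ?L"
      by (rule order_trans[rotated])
  qed
  show "?L \<le> (SUP \<phi>\<in>?P. ereal (?F \<phi>))"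
  proof (cases "SUP \<phi>\<in>?P. ereal (?F \<phi>)")
    case PInf
    then show ?thesis
      by simp
  next
    case MInf
    have "ereal (?F (\<lambda>x. 0)) \<le> (SUP \<phi>\<in>?P. ereal (?F \<phi>))"
      by (intro SUP_upper) auto
    then show ?thesis
      unfolding MInf by simp
  next
    case (real s)
    have F_le: "?F \<phi> \<le> s" if "\<phi> \<in> ?P" for \<phi>
      using SUP_upper[OF that, of "\<lambda>\<phi>. ereal (?F \<phi>)"] unfolding real by simp
    have "divergence (\<lambda>x. 0) x = 0" for x :: 'a
      using divergence_scaleR[OF zero_test_field[of \<Omega>], of 0] by simp
    \<comment> \<open>Without this, \<open>ennreal s\<close> could exceed \<open>s\<close> after
      truncation and the upper bound would be lost.\<close>
    then have "0 \<le> s"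
      using F_le[of "\<lambda>x. 0"] by simp
    have "TV_pwL \<Omega> \<gamma> u \<le> ennreal s"
      by (rule TV_pwL_le[OF assms]) (auto intro: F_le)
    then have "?L \<le> enn2ereal (ennreal s)"
      by (simp add: less_eq_ennreal.rep_eq)
    then show ?thesis
      unfolding real using \<open>0 \<le> s\<close> by (simp add: enn2ereal_ennreal)
  qed
qed

theorem theorem1:
  fixes \<Omega> :: "(real ^ 2) set" and \<gamma> :: "(real ^ 2) measure" and u :: "real ^ 2 \<Rightarrow> real"
  assumes "bounded_lipschitz_domain \<Omega>"
    and "sets \<gamma> = sets (restrict_space borel \<Omega>)" and "finite_measure \<gamma>"
    and "integrable (lebesgue_on \<Omega>) u"
  shows "enn2ereal (TV_pwL \<Omega> \<gamma> u) =
    (SUP \<phi> \<in> {\<phi> \<in> test_fields \<Omega>. \<forall>x \<in> \<Omega>. norm (\<phi> x) \<le> 1}.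
       ereal (integral\<^sup>L (lebesgue_on \<Omega>) (\<lambda>x. u x * divergence \<phi> x)
              - integral\<^sup>L \<gamma> (\<lambda>x. norm (\<phi> x))))"
  using assms by (intro TV_pwL_dual) (auto simp: bounded_lipschitz_domain_def)

end
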